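(* Let $G$ be a second countable locally compact abelian group, $\Lambda$ a closed subgroup of the dual group $\widehat{G}$, and let $\Pi$, $D$, $\mathcal{F}$, $Z$ and $\tilde{Z}=Z\circ\mathcal{F}: L^2(G)\to L^2(\Pi,L^2(D))$ be as defined in the context. Suppose that $W\subseteq L^2(G)$ is a $\Lambda$-modulation invariant space with range function $J$. Let $U: W\to W$ be a compact $\Lambda$-modulation preserving operator with range operator $R$. (1) If $U$ is Hilbert–Schmidt, then $R(x)$ is Hilbert–Schmidt for a.e. $x\in\Pi$. (2) If $U$ is positive and of finite trace, then $R(x)$ is positive and of finite trace for a.e. $x\in\Pi$.
   Context: Setting. $G$ is a second countable locally compact abelian (LCA) group, $\widehat{G}$ is its dual group, $\Lambda\subseteq\widehat{G}$ is a closed subgroup (not necessarily discrete or cocompact), and $\Lambda^* = \{x\in G : \lambda(x)=1 \text{ for all } \lambda\in\Lambda\}$ is the annihilator of $\Lambda$ in $G$. $\Pi\subseteq G$ is a Borel section (measurable set of coset representatives) for $G/\Lambda^*$ and $D\subseteq\widehat{G}$ is a Borel section for $\widehat{G}/\Lambda$; $\Pi$ and $D$ carry the measures transported from Haar measure on $G/\Lambda^*$ and $\widehat{G}/\Lambda$ respectively via the quotient bijections. For $\lambda\in\Lambda$, $X_\lambda$ is the corresponding character on $G$: $X_\lambda(x)=\lambda(x)$. Operators. For $\lambda\in\Lambda$, $M_\lambda: L^2(G)\to L^2(G)$ is the modulation operator $M_\lambda f(x)=\lambda(x)f(x)$, and $T_\lambda$ is translation by $\lambda$ on $L^2(\widehat{G})$.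 $\mathcal{F}: L^2(G)\to L^2(\widehat{G})$ is the (unitary) Fourier transform, so that $\mathcal{F}M_\lambda = T_\lambda\mathcal{F}$. $Z: L^2(\widehat{G})\to L^2(\Pi, L^2(D))$ is the Zak transform, an isometric isomorphism (onto) satisfying $Z(T_\lambda\phi) = X_\lambda|_\Pi\, Z(\phi)$ for all $\lambda\in\Lambda$, $\phi\in L^2(\widehat{G})$. Put $\tilde{Z}=Z\circ\mathcal{F}$. Here $L^2(\Pi, L^2(D))$ is the Hilbert space of measurable functions $\phi:\Pi\to L^2(D)$ with $\int_\Pi\|\phi(x)\|^2\,dx<\infty$. Modulation invariant spaces and range functions. A closed subspace $W\subseteq L^2(G)$ is $\Lambda$-modulation invariant if $M_\lambda W\subseteq W$ for all $\lambda\in\Lambda$. A range function is a map $J$ from $\Pi$ to the closed subspaces of $L^2(D)$; $P_J(x)$ denotes the orthogonal projection of $L^2(D)$ onto $J(x)$, and $J$ is measurable if $x\mapsto\langle P_J(x)a,b\rangle$ is measurable for all $a,b\in L^2(D)$. Every $\Lambda$-modulation invariant space $W$ has a measurable range function $J$, unique up to a.e. equality, with $W=\{f\in L^2(G) : \tilde{Z}f(x)\in J(x)\text{ for a.e. }x\in\Pi\}$; this is called the range function of $W$. Modulation preserving operators and range operators. A bounded linear operator $U: W\to L^2(G)$ is $\Lambda$-modulation preserving if $UM_\lambda f=M_\lambda Uf$ for all $\lambda\in\Lambda$, $f\in W$. A range operator $R$ on $J$ is a map assigning to $x\in\Pi$ a bounded linear operator $R(x)$ from a closed subspace of $L^2(D)$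 into $L^2(D)$, such that the domain of $R(x)$ equals $J(x)$ for a.e. $x\in\Pi$; it is measurable if $x\mapsto\langle R(x)P_J(x)a,b\rangle$ is measurable for all $a,b\in L^2(D)$. The range operator of a $\Lambda$-modulation preserving operator $U$ is the measurable range operator $R$ on $J$, unique up to a.e. equality, such that for all $\phi\in W$, $\tilde{Z}(U\phi)(x)=R(x)(\tilde{Z}\phi(x))$ for a.e. $x\in\Pi$. When $U$ maps $W$ into $W$, $R(x)$ maps $J(x)$ into $J(x)$ for a.e. $x$, and $R(x)$ is regarded as an operator on the Hilbert space $J(x)$. Hilbert–Schmidt and trace. For an operator $T$ on a Hilbert space $\mathcal{H}$ with orthonormal basis $E$, $\|T\|_{HS}=\big(\sum_{e\in E}\|Te\|^2\big)^{1/2}$ and $T$ is Hilbert–Schmidt if $\|T\|_{HS}<\infty$; a positive operator $T$ is of finite trace if $\operatorname{tr}(T)=\sum_{e\in E}\langle Te,e\rangle<\infty$. *)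

theory Defs
  imports
    "HOL-Analysis.Analysis"
    "HOL-Algebra.Coset"
    "HOL-Library.Function_Algebras"
begin

text \<open>
  Elements of \<open>L\<^sup>2\<close>-spaces are represented by functions, and equality almost everywhere by \<open>heq\<close>
  below.  All Hilbert space notions are therefore formulated for a carrier with a positive
  semidefinite inner product, and linearity, intertwining relations etc. are required up to
  \<open>heq\<close>.  A closed subspace is automatically a union of \<open>heq\<close>-classes, and a bounded linear
  operator automatically respects \<open>heq\<close>.
\<close>

subsection \<open>Complex Hilbert spaces on carriers\<close>

class complex_vec = ab_group_add +
  fixes cscale :: "complex \<Rightarrow> 'a \<Rightarrow> 'a"
  assumes cscale_add_right: "cscale c (a + b) = cscale c a + cscale c b"
    and cscale_add_left: "cscale (c + d) a = cscale c a + cscale d a"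
    and cscale_cscale: "cscale c (cscale d a) = cscale (c * d) a"
    and cscale_one: "cscale 1 a = a"

instantiation complex :: complex_vec
begin
definition cscale_complex :: "complex \<Rightarrow> complex \<Rightarrow> complex" where
  "cscale_complex c z = c * z"
instance
  by standard (simp_all add: cscale_complex_def algebra_simps)
end

instantiation "fun" :: (type, complex_vec) complex_vec
begin
definition cscale_fun :: "complex \<Rightarrow> ('a \<Rightarrow> 'b) \<Rightarrow> 'a \<Rightarrow> 'b" where
  "cscale_fun c f = (\<lambda>x. cscale c (f x))"
instance
  by standard
    (simp_all add: cscale_fun_def fun_eq_iff cscale_add_right cscale_add_left cscale_cscale cscale_one)
end

record 'v hspace =
  hcarrier :: "'v set"
  hinner :: "'v \<Rightarrow> 'v \<Rightarrow> complex"

definition hnorm :: "'v hspace \<Rightarrow> 'v \<Rightarrow> real" where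
  "hnorm H a = sqrt (Re (hinner H a a))"

definition heq :: "('v::complex_vec) hspace \<Rightarrow> 'v \<Rightarrow> 'v \<Rightarrow> bool" where
  "heq H a b \<longleftrightarrow> hnorm H (a - b) = 0"

definition subspace_of :: "'v set \<Rightarrow> 'v hspace \<Rightarrow> 'v hspace" where
  "subspace_of V H = H\<lparr>hcarrier := V\<rparr>"

definition closed_subspace :: "('v::complex_vec) hspace \<Rightarrow> 'v set \<Rightarrow> bool" where
  "closed_subspace H V \<longleftrightarrow>
     V \<subseteq> hcarrier H \<and> 0 \<in> V \<and>
     (\<forall>a\<in>V. \<forall>b\<in>V. a + b \<in> V) \<and> (\<forall>c. \<forall>a\<in>V. cscale c a \<in> V) \<and>
     (\<forall>s l. (\<forall>n::nat. s n \<in> V) \<and> l \<in> hcarrier H \<and> (\<lambda>n. hnorm H (s n - l)) \<longlonglongrightarrow> 0 \<longrightarrow> l \<in> V)"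

definition linear_op ::
  "('v::complex_vec) hspace \<Rightarrow> ('w::complex_vec) hspace \<Rightarrow> ('v \<Rightarrow> 'w) \<Rightarrow> bool" where
  "linear_op H K T \<longleftrightarrow>
     (\<forall>a\<in>hcarrier H. T a \<in> hcarrier K) \<and>
     (\<forall>a\<in>hcarrier H. \<forall>b\<in>hcarrier H. heq K (T (a + b)) (T a + T b)) \<and>
     (\<forall>c. \<forall>a\<in>hcarrier H. heq K (T (cscale c a)) (cscale c (T a)))"

definition bounded_op ::
  "('v::complex_vec) hspace \<Rightarrow> ('w::complex_vec) hspace \<Rightarrow> ('v \<Rightarrow> 'w) \<Rightarrow> bool" where
  "bounded_op H K T \<longleftrightarrow>
     linear_op H K T \<and> (\<exists>C. \<forall>a\<in>hcarrier H. hnorm K (T a) \<le> C * hnorm H a)"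

definition isometric_iso ::
  "('v::complex_vec) hspace \<Rightarrow> ('w::complex_vec) hspace \<Rightarrow> ('v \<Rightarrow> 'w) \<Rightarrow> bool" where
  "isometric_iso H K T \<longleftrightarrow>
     linear_op H K T \<and> (\<forall>a\<in>hcarrier H. hnorm K (T a) = hnorm H a) \<and>
     (\<forall>b\<in>hcarrier K. \<exists>a\<in>hcarrier H. heq K (T a) b)"

definition compact_op ::
  "('v::complex_vec) hspace \<Rightarrow> ('w::complex_vec) hspace \<Rightarrow> ('v \<Rightarrow> 'w) \<Rightarrow> bool" where
  "compact_op H K T \<longleftrightarrow>
     bounded_op H K T \<and>
     (\<forall>s. (\<forall>n::nat. s n \<in> hcarrier H \<and> hnorm H (s n) \<le> 1) \<longrightarrow>
       (\<exists>r l. strict_mono r \<and> l \<in> hcarrier K \<and> (\<lambda>n. hnorm K (T (s (r n)) - l)) \<longlonglongrightarrow> 0))"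

definition orth_proj :: "('v::complex_vec) hspace \<Rightarrow> 'v set \<Rightarrow> 'v \<Rightarrow> 'v" where
  "orth_proj H V a = (SOME p. p \<in> V \<and> (\<forall>v\<in>V. hinner H (a - p) v = 0))"

definition orthonormal_basis :: "('v::complex_vec) hspace \<Rightarrow> 'v set \<Rightarrow> bool" where
  "orthonormal_basis H E \<longleftrightarrow>
     E \<subseteq> hcarrier H \<and>
     (\<forall>e\<in>E. \<forall>e'\<in>E. hinner H e e' = (if e = e' then 1 else 0)) \<and>
     (\<forall>a\<in>hcarrier H. (\<forall>e\<in>E. hinner H a e = 0) \<longrightarrow> hnorm H a = 0)"

text \<open>
  The two sums below have nonnegative terms, so summability means that they are finite; their
  values do not depend on the orthonormal basis.
\<close>

definition hilbert_schmidt :: "('v::complex_vec) hspace \<Rightarrow> ('v \<Rightarrow> 'v) \<Rightarrow> bool" where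
  "hilbert_schmidt H T \<longleftrightarrow>
     bounded_op H H T \<and>
     (\<exists>E. orthonormal_basis H E \<and> (\<lambda>e. (hnorm H (T e))\<^sup>2) summable_on E)"

definition positive_op :: "('v::complex_vec) hspace \<Rightarrow> ('v \<Rightarrow> 'v) \<Rightarrow> bool" where
  "positive_op H T \<longleftrightarrow>
     bounded_op H H T \<and> (\<forall>a\<in>hcarrier H. hinner H (T a) a \<in> \<real>\<^sub>\<ge>\<^sub>0)"

definition positive_finite_trace :: "('v::complex_vec) hspace \<Rightarrow> ('v \<Rightarrow> 'v) \<Rightarrow> bool" where
  "positive_finite_trace H T \<longleftrightarrow>
     positive_op H T \<and>
     (\<exists>E. orthonormal_basis H E \<and> (\<lambda>e. Re (hinner H (T e) e)) summable_on E)"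

subsection \<open>Spaces of square integrable functions\<close>

definition complex_hspace :: "complex hspace" where
  "complex_hspace = \<lparr>hcarrier = UNIV, hinner = (\<lambda>z w. z * cnj w)\<rparr>"

definition hborel :: "('v::complex_vec) hspace \<Rightarrow> 'v measure" where
  "hborel H = sigma (hcarrier H)
     {U. U \<subseteq> hcarrier H \<and> (\<forall>a\<in>U. \<exists>r>0. \<forall>b\<in>hcarrier H. hnorm H (b - a) < r \<longrightarrow> b \<in> U)}"

definition L2_vec :: "'a measure \<Rightarrow> ('v::complex_vec) hspace \<Rightarrow> ('a \<Rightarrow> 'v) hspace" where
  "L2_vec M H =
     \<lparr>hcarrier = {f \<in> measurable M (hborel H). integrable M (\<lambda>x. (hnorm H (f x))\<^sup>2)},
      hinner = (\<lambda>f g. LINT x|M. hinner H (f x) (g x))\<rparr>"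

abbreviation L2 :: "'a measure \<Rightarrow> ('a \<Rightarrow> complex) hspace" where
  "L2 M \<equiv> L2_vec M complex_hspace"

subsection \<open>Locally compact abelian groups\<close>

definition lca_group :: "('g, 'b) monoid_scheme \<Rightarrow> 'g topology \<Rightarrow> bool" where
  "lca_group G T \<longleftrightarrow>
     comm_group G \<and> topspace T = carrier G \<and>
     continuous_map (prod_topology T T) T (\<lambda>(x, y). x \<otimes>\<^bsub>G\<^esub> y) \<and>
     continuous_map T T (\<lambda>x. inv\<^bsub>G\<^esub> x) \<and>
     Hausdorff_space T \<and> locally_compact_space T"

definition borel_of :: "'a topology \<Rightarrow> 'a measure" where
  "borel_of T = sigma (topspace T) {U. openin T U}"

definition circle_group :: "complex monoid" where
  "circle_group = \<lparr>carrier = {z. cmod z = 1}, mult = (*), one = 1\<rparr>"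

text \<open>Characters are made \<open>extensional\<close> so that equality of characters is equality on \<open>carrier G\<close>.\<close>

definition dual_group :: "('g, 'b) monoid_scheme \<Rightarrow> 'g topology \<Rightarrow> ('g \<Rightarrow> complex) monoid" where
  "dual_group G T =
     \<lparr>carrier = {\<xi> \<in> hom G circle_group. \<xi> \<in> extensional (carrier G) \<and> continuous_map T euclidean \<xi>},
      mult = (\<lambda>\<xi> \<psi>. restrict (\<lambda>x. \<xi> x * \<psi> x) (carrier G)),
      one = restrict (\<lambda>x. 1) (carrier G)\<rparr>"

text \<open>The compact-open topology.\<close>

definition dual_topology :: "('g, 'b) monoid_scheme \<Rightarrow> 'g topology \<Rightarrow> ('g \<Rightarrow> complex) topology" where
  "dual_topology G T = topology_generated_by
     {{\<xi> \<in> carrier (dual_group G T). \<xi> ` K \<subseteq> V} | K V. compactin T K \<and> open V}"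

definition annihilator :: "('g, 'b) monoid_scheme \<Rightarrow> ('g \<Rightarrow> complex) set \<Rightarrow> 'g set" where
  "annihilator G \<Lambda> = {x \<in> carrier G. \<forall>\<xi>\<in>\<Lambda>. \<xi> x = 1}"

text \<open>The quotient topology on \<open>G Mod H\<close>: the preimage of a set of cosets is its union.\<close>

definition quotient_topology :: "('g, 'b) monoid_scheme \<Rightarrow> 'g topology \<Rightarrow> 'g set \<Rightarrow> 'g set topology" where
  "quotient_topology G T H = topology (\<lambda>\<U>. \<U> \<subseteq> carrier (G Mod H) \<and> openin T (\<Union>\<U>))"

lemma (in group) openin_quotient_topology:
  assumes "subgroup H G"
  shows "openin (quotient_topology G T H) \<U> \<longleftrightarrow> \<U> \<subseteq> carrier (G Mod H) \<and> openin T (\<Union>\<U>)"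
proof -
  have cosets_meet: "\<Union>(\<U> \<inter> \<V>) = \<Union>\<U> \<inter> \<Union>\<V>"
    if "\<U> \<subseteq> rcosets H" "\<V> \<subseteq> rcosets H" for \<U> \<V>
  proof
    show "\<Union>\<U> \<inter> \<Union>\<V> \<subseteq> \<Union>(\<U> \<inter> \<V>)"
    proof
      fix x assume "x \<in> \<Union>\<U> \<inter> \<Union>\<V>"
      then obtain A B where AB: "x \<in> A" "A \<in> \<U>" "x \<in> B" "B \<in> \<V>" by blast
      then have "A = B"
        using rcos_disjoint[OF assms] that unfolding pairwise_def disjnt_def by blast
      then show "x \<in> \<Union>(\<U> \<inter> \<V>)" using AB by blast
    qed
  qed blast
  have "istopology (\<lambda>\<U>. \<U> \<subseteq> carrier (G Mod H) \<and> openin T (\<Union>\<U>))"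
    unfolding istopology_def
  proof (intro conjI allI impI)
    fix \<U> \<V>
    assume U: "\<U> \<subseteq> carrier (G Mod H) \<and> openin T (\<Union>\<U>)"
      and V: "\<V> \<subseteq> carrier (G Mod H) \<and> openin T (\<Union>\<V>)"
    then show "\<U> \<inter> \<V> \<subseteq> carrier (G Mod H)" by blast
    have "\<Union>(\<U> \<inter> \<V>) = \<Union>\<U> \<inter> \<Union>\<V>"
      using cosets_meet U V by (simp add: FactGroup_def)
    then show "openin T (\<Union>(\<U> \<inter> \<V>))" using U V by (simp add: openin_Int)
  next
    fix \<K>
    assume K: "\<forall>\<U>\<in>\<K>. \<U> \<subseteq> carrier (G Mod H) \<and> openin T (\<Union>\<U>)"
    then show "\<Union>\<K> \<subseteq> carrier (G Mod H)" by blast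
    have "\<Union>(\<Union>\<K>) = \<Union>(Union ` \<K>)" by blast
    then show "openin T (\<Union>(\<Union>\<K>))" 
      unfolding \<open>\<Union>(\<Union>\<K>) = \<Union>(Union ` \<K>)\<close> using K by (intro openin_Union) auto
  qed
  then show ?thesis by (simp add: quotient_topology_def topology_inverse')
qed

text \<open>
  Regularity need not be required: all groups below are locally compact and second countable, where
  Borel measures that are finite on compact sets are regular.
\<close>

definition haar_measure :: "('g, 'b) monoid_scheme \<Rightarrow> 'g topology \<Rightarrow> 'g measure \<Rightarrow> bool" where
  "haar_measure G T \<mu> \<longleftrightarrow>
     sets \<mu> = sets (borel_of T) \<and>
     (\<forall>g\<in>carrier G. \<forall>B\<in>sets \<mu>. emeasure \<mu> (g <#\<^bsub>G\<^esub> B) = emeasure \<mu> B) \<and>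
     (\<forall>K. compactin T K \<longrightarrow> emeasure \<mu> K < \<infinity>) \<and>
     (\<forall>U. openin T U \<and> U \<noteq> {} \<longrightarrow> emeasure \<mu> U > 0)"

definition borel_section :: "('g, 'b) monoid_scheme \<Rightarrow> 'g topology \<Rightarrow> 'g set \<Rightarrow> 'g set \<Rightarrow> bool" where
  "borel_section G T H S \<longleftrightarrow>
     S \<in> sets (borel_of T) \<and> (\<forall>C\<in>carrier (G Mod H). \<exists>!x. x \<in> S \<inter> C)"

text \<open>
  The measure on a Borel section \<open>S\<close> that corresponds to a Haar measure on \<open>G Mod H\<close> under the
  bijection \<open>x \<mapsto> H #> x\<close>.
\<close>

definition section_measure ::
  "('g, 'b) monoid_scheme \<Rightarrow> 'g topology \<Rightarrow> 'g set \<Rightarrow> 'g set \<Rightarrow> 'g measure \<Rightarrow> bool" where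
  "section_measure G T H S m \<longleftrightarrow>
     sets m = sets (restrict_space (borel_of T) S) \<and>
     haar_measure (G Mod H) (quotient_topology G T H)
       (distr m (borel_of (quotient_topology G T H)) (\<lambda>x. H #>\<^bsub>G\<^esub> x))"

subsection \<open>Fourier and Zak transforms\<close>

definition modulation :: "('g \<Rightarrow> complex) \<Rightarrow> ('g \<Rightarrow> complex) \<Rightarrow> 'g \<Rightarrow> complex" where
  "modulation \<xi> f = (\<lambda>x. \<xi> x * f x)"

definition translation :: "('g, 'b) monoid_scheme \<Rightarrow> 'g \<Rightarrow> ('g \<Rightarrow> complex) \<Rightarrow> 'g \<Rightarrow> complex" where
  "translation G g f = (\<lambda>x. f (x \<otimes>\<^bsub>G\<^esub> inv\<^bsub>G\<^esub> g))"

text \<open>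
  The Fourier transform is determined up to \<open>heq\<close> by its values on \<open>L\<^sup>1 \<inter> L\<^sup>2\<close>; that it is unitary
  fixes the normalization of the Haar measure \<open>\<nu>\<close> of the dual group relative to \<open>\<mu>\<close>.
\<close>

definition fourier_transform ::
  "'g measure \<Rightarrow> ('g \<Rightarrow> complex) measure \<Rightarrow> (('g \<Rightarrow> complex) \<Rightarrow> ('g \<Rightarrow> complex) \<Rightarrow> complex) \<Rightarrow> bool" where
  "fourier_transform \<mu> \<nu> F \<longleftrightarrow>
     isometric_iso (L2 \<mu>) (L2 \<nu>) F \<and>
     (\<forall>f\<in>hcarrier (L2 \<mu>). integrable \<mu> f \<longrightarrow>
        (AE \<xi> in \<nu>. F f \<xi> = (LINT x|\<mu>. f x * cnj (\<xi> x))))"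

text \<open>
  \<open>Z \<phi> x \<omega> = \<integral>\<^sub>\<Lambda> \<phi> (\<omega> \<lambda>) \<lambda>(x) d\<lambda>\<close>, where \<open>\<tau>\<close> is the Haar measure of \<open>\<Lambda>\<close>; \<open>\<Gamma>\<close> with topology \<open>T'\<close> is the
  dual group.  The formula on continuous functions with compact support determines \<open>Z\<close> up to
  \<open>heq\<close>, and that \<open>Z\<close> is isometric expresses the compatibility of the Haar measures involved.
  The sign in the integral is the one for which translation by \<open>\<lambda>\<close> becomes multiplication by
  \<open>\<lambda>(x)\<close> rather than by its conjugate.
\<close>

definition zak_transform ::
  "('g \<Rightarrow> complex) monoid \<Rightarrow> ('g \<Rightarrow> complex) topology \<Rightarrow> ('g \<Rightarrow> complex) set \<Rightarrow>
   ('g \<Rightarrow> complex) measure \<Rightarrow> ('g \<Rightarrow> complex) measure \<Rightarrow> 'g measure \<Rightarrow> ('g \<Rightarrow> complex) measure \<Rightarrow>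
   ((('g \<Rightarrow> complex) \<Rightarrow> complex) \<Rightarrow> 'g \<Rightarrow> ('g \<Rightarrow> complex) \<Rightarrow> complex) \<Rightarrow> bool" where
  "zak_transform \<Gamma> T' \<Lambda> \<nu> \<tau> mP mD Z \<longleftrightarrow>
     isometric_iso (L2 \<nu>) (L2_vec mP (L2 mD)) Z \<and>
     (\<forall>\<phi>\<in>hcarrier (L2 \<nu>). continuous_map T' euclidean \<phi> \<and>
          (\<exists>K. compactin T' K \<and> (\<forall>\<omega>\<in>carrier \<Gamma> - K. \<phi> \<omega> = 0)) \<longrightarrow>
        (AE x in mP. AE \<omega> in mD. Z \<phi> x \<omega> = (LINT l|\<tau>. \<phi> (\<omega> \<otimes>\<^bsub>\<Gamma>\<^esub> l) * l x))) \<and>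
     (\<forall>l\<in>\<Lambda>. \<forall>\<phi>\<in>hcarrier (L2 \<nu>).
        heq (L2_vec mP (L2 mD)) (Z (translation \<Gamma> l \<phi>)) (\<lambda>x. cscale (l x) (Z \<phi> x)))"

subsection \<open>Range functions and range operators\<close>

definition modulation_invariant :: "'g measure \<Rightarrow> ('g \<Rightarrow> complex) set \<Rightarrow> ('g \<Rightarrow> complex) set \<Rightarrow> bool" where
  "modulation_invariant \<mu> \<Lambda> W \<longleftrightarrow>
     closed_subspace (L2 \<mu>) W \<and> (\<forall>l\<in>\<Lambda>. \<forall>f\<in>W. modulation l f \<in> W)"

definition modulation_preserving ::
  "'g measure \<Rightarrow> ('g \<Rightarrow> complex) set \<Rightarrow> ('g \<Rightarrow> complex) set \<Rightarrow>
   (('g \<Rightarrow> complex) \<Rightarrow> 'g \<Rightarrow> complex) \<Rightarrow> bool" where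
  "modulation_preserving \<mu> \<Lambda> W U \<longleftrightarrow>
     bounded_op (subspace_of W (L2 \<mu>)) (L2 \<mu>) U \<and>
     (\<forall>l\<in>\<Lambda>. \<forall>f\<in>W. heq (L2 \<mu>) (U (modulation l f)) (modulation l (U f)))"

definition measurable_range_function ::
  "'a measure \<Rightarrow> ('v::complex_vec) hspace \<Rightarrow> ('a \<Rightarrow> 'v set) \<Rightarrow> bool" where
  "measurable_range_function m H J \<longleftrightarrow>
     (\<forall>x\<in>space m. closed_subspace H (J x)) \<and>
     (\<forall>a\<in>hcarrier H. \<forall>b\<in>hcarrier H.
        (\<lambda>x. hinner H (orth_proj H (J x) a) b) \<in> borel_measurable m)"

text \<open>In the next two definitions \<open>Zt\<close> is the composition of the Zak and the Fourier transform.\<close>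

definition range_function_of ::
  "'v hspace \<Rightarrow> 'a measure \<Rightarrow> ('w::complex_vec) hspace \<Rightarrow> ('v \<Rightarrow> 'a \<Rightarrow> 'w) \<Rightarrow>
   'v set \<Rightarrow> ('a \<Rightarrow> 'w set) \<Rightarrow> bool" where
  "range_function_of L m H Zt W J \<longleftrightarrow>
     measurable_range_function m H J \<and>
     W = {f \<in> hcarrier L. AE x in m. Zt f x \<in> J x}"

text \<open>
  The value of a range operator at \<open>x\<close> is a pair: a closed subspace and an operator
  on it (whose values off this subspace are junk).  The expression
  \<open>\<langle>R(x) P\<^sub>J(x) a, b\<rangle>\<close> is meaningful only where the domain of \<open>R(x)\<close> is \<open>J(x)\<close>, hence measurability is
  required of an almost everywhere equal function.
\<close>

definition measurable_range_operator ::
  "'a measure \<Rightarrow> ('v::complex_vec) hspace \<Rightarrow> ('a \<Rightarrow> 'v set) \<Rightarrow>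
   ('a \<Rightarrow> 'v set \<times> ('v \<Rightarrow> 'v)) \<Rightarrow> bool" where
  "measurable_range_operator m H J R \<longleftrightarrow>
     (\<forall>x\<in>space m. closed_subspace H (fst (R x)) \<and>
        bounded_op (subspace_of (fst (R x)) H) H (snd (R x))) \<and>
     (AE x in m. fst (R x) = J x) \<and>
     (\<forall>a\<in>hcarrier H. \<forall>b\<in>hcarrier H. \<exists>g\<in>borel_measurable m.
        AE x in m. hinner H (snd (R x) (orth_proj H (J x) a)) b = g x)"

definition range_operator_of ::
  "'a measure \<Rightarrow> ('w::complex_vec) hspace \<Rightarrow> ('v \<Rightarrow> 'a \<Rightarrow> 'w) \<Rightarrow> 'v set \<Rightarrow>
   ('a \<Rightarrow> 'w set) \<Rightarrow> ('v \<Rightarrow> 'v) \<Rightarrow> ('a \<Rightarrow> 'w set \<times> ('w \<Rightarrow> 'w)) \<Rightarrow> bool" where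
  "range_operator_of m H Zt W J U R \<longleftrightarrow>
     measurable_range_operator m H J R \<and>
     (\<forall>f\<in>W. AE x in m. heq H (Zt (U f) x) (snd (R x) (Zt f x)))"

end

theory Submission
  imports Defs
begin

text \<open>
  The assertion about \<open>U\<close> becomes one about traces of positive forms: \<open>U\<close> is Hilbert-Schmidt if the
  form \<open>\<beta>(f, g) = \<langle>U f, U g\<rangle>\<close> on \<open>W\<close> has finite trace, and a positive \<open>U\<close> has finite trace if
  \<open>\<beta>(f, g) = \<langle>U f, g\<rangle>\<close> has.  In both cases \<open>\<beta>\<close> decomposes as \<open>\<beta>(f, g) = \<integral> \<beta>\<^sub>x(f(x), g(x)) dx\<close>, where
  \<open>f(x)\<close> is the fibre at \<open>x\<close> of the transform of \<open>f\<close> and \<open>\<beta>\<^sub>x\<close> is the same form built from \<open>R(x)\<close>.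

  Let \<open>d\<^sub>n\<close> be an orthonormal basis of \<open>L\<^sup>2(D)\<close> and \<open>h > 0\<close> a square integrable function on \<open>\<Pi>\<close>.  The
  functions \<open>x \<mapsto> h(x) P\<^sub>J(x) d\<^sub>n\<close> are the transforms of some \<open>a\<^sub>n \<in> W\<close>.  The operator that takes \<open>d\<^sub>n\<close> to
  \<open>a\<^sub>n\<close> has norm at most \<open>\<parallel>h\<parallel>\<close>, hence \<open>\<Sum>\<^sub>n \<beta>(a\<^sub>n, a\<^sub>n) \<le> \<parallel>h\<parallel>\<^sup>2 tr \<beta>\<close> (\<open>trace_le_of_Bessel_family\<close>,
  \<open>sections_Bessel\<close>).  The left-hand side is \<open>\<integral> h(x)\<^sup>2 \<Sum>\<^sub>n \<beta>\<^sub>x(P\<^sub>J(x) d\<^sub>n, P\<^sub>J(x) d\<^sub>n) dx\<close>, so the inner sum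
  is finite for almost every \<open>x\<close> (\<open>fibre_trace_finite\<close>).  The vectors \<open>P\<^sub>J(x) d\<^sub>n\<close> need not be
  orthogonal, but they satisfy Parseval's identity in \<open>J(x)\<close>, and this is enough to bound the trace of
  \<open>\<beta>\<^sub>x\<close> over any orthonormal basis of \<open>J(x)\<close> (\<open>trace_summable_orthonormal\<close>).

  That \<open>R(x)\<close> maps \<open>J(x)\<close> to itself, and is positive if \<open>U\<close> is, follows on the vectors \<open>P\<^sub>J(x) c\<close> with \<open>c\<close>
  in a countable dense set, because only countably many null sets are involved, and extends to \<open>J(x)\<close> by
  continuity (\<open>fibre_invariant\<close>, \<open>fibre_positive\<close>).  Positivity at almost every \<open>x\<close> comes from testing \<open>U\<close> on
  sections cut down to an arbitrary measurable subset of \<open>\<Pi>\<close>.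

  Two facts about the groups enter.  The measure of \<open>\<Pi>\<close> is \<open>\<sigma>\<close>-finite, which gives \<open>h\<close>; and \<open>L\<^sup>2(D)\<close> is
  separable, which gives the sequence \<open>d\<^sub>n\<close> and makes weak and norm measurability of \<open>L\<^sup>2(D)\<close>-valued
  functions agree.  Both hold since \<open>G\<close> and its dual are second countable and \<open>\<sigma>\<close>-compact.  For the dual,
  a set of characters that are close to 1 on a fixed neighbourhood of the identity is equicontinuous,
  because squaring roughly doubles the distance from 1; so it is compact by Tychonoff's theorem, and
  countably many such sets cover the dual.
\<close>

section \<open>Semi-inner product spaces\<close>

lemma cscale_zero_left [simp]: "cscale 0 (a::'v::complex_vec) = 0"
  using cscale_add_left[of 0 0 a] by simp

lemma cscale_zero_right [simp]: "cscale c (0::'v::complex_vec) = 0"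
  using cscale_add_right[of c 0 0] by simp

lemma cscale_minus_one: "cscale (- 1) (a::'v::complex_vec) = - a"
proof -
  have "cscale (- 1) a + a = cscale (-1 + 1) a"
    unfolding cscale_add_left cscale_one ..
  then show ?thesis by (simp add: eq_neg_iff_add_eq_0)
qed

lemma cscale_diff_right: "cscale c (a - b::'v::complex_vec) = cscale c a - cscale c b"
  by (metis add_diff_cancel cscale_add_right diff_add_cancel)

lemma cscale_diff_left: "cscale (c - d) (a::'v::complex_vec) = cscale c a - cscale d a"
  by (metis add_diff_cancel cscale_add_left diff_add_cancel)

definition linear_subset :: "'v::complex_vec set \<Rightarrow> bool" where
  "linear_subset N \<longleftrightarrow> 0 \<in> N \<and> (\<forall>a\<in>N. \<forall>b\<in>N. a + b \<in> N) \<and> (\<forall>c. \<forall>a\<in>N. cscale c a \<in> N)"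

lemma linear_subset_sum:
  assumes "linear_subset N" "\<And>i. i \<in> I \<Longrightarrow> f i \<in> N"
  shows "(\<Sum>i\<in>I. f i) \<in> N"
  using assms(2) by (induction I rule: infinite_finite_induct)
    (use assms(1) in \<open>auto simp: linear_subset_def\<close>)

lemma linear_subset_diff:
  assumes "linear_subset N" "a \<in> N" "b \<in> N"
  shows "a - b \<in> N"
proof -
  have "a + cscale (- 1) b \<in> N" using assms by (auto simp: linear_subset_def)
  then show ?thesis by (simp add: cscale_minus_one)
qed

text \<open>
  For small \<open>t > 0\<close> the linear term dominates the quadratic one.
\<close>

lemma vanishing_coefficient:
  fixes A b :: real
  assumes "\<And>t. 0 \<le> - 2 * t * A + t\<^sup>2 * A * b" "A \<ge> 0" "b \<ge> 0"
  shows "A = 0"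
proof (rule ccontr)
  assume "A \<noteq> 0"
  then have A: "A > 0" using assms by simp
  define t where "t = 1 / (b + 1)"
  have t: "t > 0" "t * b < 2" using assms(3) by (auto simp: t_def field_simps)
  have "- 2 * t * A + t\<^sup>2 * A * b = t * A * (t * b - 2)"
    by (simp add: power2_eq_square algebra_simps)
  also have "\<dots> < 0" using t A by (simp add: mult_pos_neg)
  finally show False using assms(1)[of t] by simp
qed

locale pre_hilbert =
  fixes H :: "'v::complex_vec hspace"
  assumes lin: "linear_subset (hcarrier H)"
    and inner_add_left: "\<lbrakk>a \<in> hcarrier H; b \<in> hcarrier H; c \<in> hcarrier H\<rbrakk> \<Longrightarrow>
      hinner H (a + b) c = hinner H a c + hinner H b c"
    and inner_scale_left: "\<lbrakk>a \<in> hcarrier H; c \<in> hcarrier H\<rbrakk> \<Longrightarrow>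
      hinner H (cscale k a) c = k * hinner H a c"
    and inner_cnj: "\<lbrakk>a \<in> hcarrier H; b \<in> hcarrier H\<rbrakk> \<Longrightarrow> hinner H b a = cnj (hinner H a b)"
    and inner_nonneg: "a \<in> hcarrier H \<Longrightarrow> 0 \<le> Re (hinner H a a)"
begin

lemma zero_in [simp, intro]: "0 \<in> hcarrier H"
  and add_in [simp, intro]: "a \<in> hcarrier H \<Longrightarrow> b \<in> hcarrier H \<Longrightarrow> a + b \<in> hcarrier H"
  and scale_in [simp, intro]: "a \<in> hcarrier H \<Longrightarrow> cscale k a \<in> hcarrier H"
  using lin by (auto simp: linear_subset_def)

lemma diff_in [simp, intro]: "a \<in> hcarrier H \<Longrightarrow> b \<in> hcarrier H \<Longrightarrow> a - b \<in> hcarrier H"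
  using linear_subset_diff[OF lin] .

lemma sum_in [intro]: "(\<And>i. i \<in> I \<Longrightarrow> f i \<in> hcarrier H) \<Longrightarrow> (\<Sum>i\<in>I. f i) \<in> hcarrier H"
  using linear_subset_sum[OF lin] .

lemma inner_zero_left [simp]: "c \<in> hcarrier H \<Longrightarrow> hinner H 0 c = 0"
  using inner_add_left[of 0 0 c] by simp

lemma inner_zero_right [simp]: "c \<in> hcarrier H \<Longrightarrow> hinner H c 0 = 0"
  using inner_cnj[of 0 c] by simp

lemma inner_diff_left: "\<lbrakk>a \<in> hcarrier H; b \<in> hcarrier H; c \<in> hcarrier H\<rbrakk> \<Longrightarrow>
    hinner H (a - b) c = hinner H a c - hinner H b c"
  using inner_add_left[of "a - b" b c] by simp

lemma inner_add_right: "\<lbrakk>a \<in> hcarrier H; b \<in> hcarrier H; c \<in> hcarrier H\<rbrakk> \<Longrightarrow>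
    hinner H c (a + b) = hinner H c a + hinner H c b"
  by (metis add_in complex_cnj_add inner_add_left inner_cnj)

lemma inner_diff_right: "\<lbrakk>a \<in> hcarrier H; b \<in> hcarrier H; c \<in> hcarrier H\<rbrakk> \<Longrightarrow>
    hinner H c (a - b) = hinner H c a - hinner H c b"
  by (metis diff_in complex_cnj_diff inner_diff_left inner_cnj)

lemma inner_scale_right: "\<lbrakk>a \<in> hcarrier H; c \<in> hcarrier H\<rbrakk> \<Longrightarrow>
    hinner H c (cscale k a) = cnj k * hinner H c a"
  by (metis scale_in complex_cnj_mult inner_scale_left inner_cnj)

lemma inner_sum_left:
  assumes "\<And>i. i \<in> I \<Longrightarrow> f i \<in> hcarrier H" "c \<in> hcarrier H"
  shows "hinner H (\<Sum>i\<in>I. f i) c = (\<Sum>i\<in>I. hinner H (f i) c)"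
  using assms by (induction I rule: infinite_finite_induct) (auto simp: inner_add_left sum_in)

lemma inner_self: "a \<in> hcarrier H \<Longrightarrow> hinner H a a = complex_of_real ((hnorm H a)\<^sup>2)"
proof -
  assume a: "a \<in> hcarrier H"
  have "Im (hinner H a a) = 0" using inner_cnj[OF a a] by (simp add: complex_eq_iff)
  then show ?thesis using inner_nonneg[OF a] by (simp add: hnorm_def complex_eq_iff)
qed

lemma hnorm_nonneg [simp]: "a \<in> hcarrier H \<Longrightarrow> 0 \<le> hnorm H a"
  using inner_nonneg by (simp add: hnorm_def)

lemma hnorm_sq: "a \<in> hcarrier H \<Longrightarrow> (hnorm H a)\<^sup>2 = Re (hinner H a a)"
  using inner_nonneg by (simp add: hnorm_def)

lemma hnorm_zero [simp]: "hnorm H 0 = 0"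
  by (simp add: hnorm_def)

lemma hnorm_scale [simp]: "a \<in> hcarrier H \<Longrightarrow> hnorm H (cscale k a) = cmod k * hnorm H a"
proof -
  assume a: "a \<in> hcarrier H"
  have "hinner H (cscale k a) (cscale k a) = (k * cnj k) * hinner H a a"
    using a by (simp add: inner_scale_left inner_scale_right)
  also have "\<dots> = complex_of_real ((cmod k)\<^sup>2 * (hnorm H a)\<^sup>2)"
    using inner_self[OF a] by (simp only: complex_norm_square[symmetric] of_real_mult)
  finally have "hnorm H (cscale k a) = sqrt ((cmod k * hnorm H a)\<^sup>2)"
    unfolding hnorm_def by (simp add: power_mult_distrib)
  then show ?thesis using a by simp
qed

lemma hnorm_uminus: "a \<in> hcarrier H \<Longrightarrow> hnorm H (- a) = hnorm H a"
  using hnorm_scale[of a "-1"] by (simp add: cscale_minus_one)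

lemma hnorm_minus_commute: "\<lbrakk>a \<in> hcarrier H; b \<in> hcarrier H\<rbrakk> \<Longrightarrow> hnorm H (a - b) = hnorm H (b - a)"
  using hnorm_uminus[of "a - b"] by simp

lemma hnorm_add_sq: "\<lbrakk>a \<in> hcarrier H; b \<in> hcarrier H\<rbrakk> \<Longrightarrow>
    (hnorm H (a + b))\<^sup>2 = (hnorm H a)\<^sup>2 + 2 * Re (hinner H a b) + (hnorm H b)\<^sup>2"
  using inner_cnj[of a b] by (simp add: hnorm_sq inner_add_left inner_add_right)

lemma hnorm_diff_sq: "\<lbrakk>a \<in> hcarrier H; b \<in> hcarrier H\<rbrakk> \<Longrightarrow>
    (hnorm H (a - b))\<^sup>2 = (hnorm H a)\<^sup>2 - 2 * Re (hinner H a b) + (hnorm H b)\<^sup>2"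
  using inner_cnj[of a b] by (simp add: hnorm_sq inner_diff_left inner_diff_right)

text \<open>
  With the coefficient \<open>\<langle>a, b\<rangle>\<close> the cross term is real, so a single real parameter \<open>t\<close>
  yields the Cauchy-Schwarz inequality and the orthogonality of residues of best approximations.
\<close>

lemma hnorm_diff_scaled_sq:
  assumes "a \<in> hcarrier H" "b \<in> hcarrier H"
  shows "(hnorm H (a - cscale (complex_of_real t * hinner H a b) b))\<^sup>2 =
    (hnorm H a)\<^sup>2 + (- 2 * t * (cmod (hinner H a b))\<^sup>2 + t\<^sup>2 * (cmod (hinner H a b))\<^sup>2 * (hnorm H b)\<^sup>2)"
proof -
  have "Re (hinner H a (cscale (complex_of_real t * hinner H a b) b)) = t * (cmod (hinner H a b))\<^sup>2"
    using assms by (simp add: inner_scale_right cmod_power2) (simp add: power2_eq_square algebra_simps)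
  then show ?thesis using assms
    by (subst hnorm_diff_sq) (auto simp: norm_mult power_mult_distrib algebra_simps)
qed

lemma Cauchy_Schwarz:
  assumes "a \<in> hcarrier H" "b \<in> hcarrier H"
  shows "cmod (hinner H a b) \<le> hnorm H a * hnorm H b"
proof -
  define A where "A = (cmod (hinner H a b))\<^sup>2"
  have le: "0 \<le> (hnorm H a)\<^sup>2 + (- 2 * t * A + t\<^sup>2 * A * (hnorm H b)\<^sup>2)" for t
    unfolding A_def hnorm_diff_scaled_sq[OF assms, symmetric] by simp
  have "A \<le> (hnorm H a)\<^sup>2 * (hnorm H b)\<^sup>2"
  proof (cases "hnorm H b = 0")
    case True
    have "A = 0"
    proof (rule ccontr)
      assume "A \<noteq> 0"
      \<comment> \<open>The bound is affine in \<open>t\<close>, so a large \<open>t\<close> makes it negative.\<close>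
      then show False using le[of "((hnorm H a)\<^sup>2 + 1) / A"] True
          zero_le_power2[of "hnorm H a"] by simp
    qed
    then show ?thesis by simp
  next
    case False
    then have b: "(hnorm H b)\<^sup>2 > 0" by simp
    have "0 \<le> (hnorm H a)\<^sup>2 - A / (hnorm H b)\<^sup>2"
    proof -
      have "- 2 * (1 / (hnorm H b)\<^sup>2) * A + (1 / (hnorm H b)\<^sup>2)\<^sup>2 * A * (hnorm H b)\<^sup>2 = - (A / (hnorm H b)\<^sup>2)"
        using b by (simp add: power2_eq_square)
      then show ?thesis using le[of "1 / (hnorm H b)\<^sup>2"] by simp
    qed
    then show ?thesis using b by (simp add: field_simps)
  qed
  then have "(cmod (hinner H a b))\<^sup>2 \<le> (hnorm H a * hnorm H b)\<^sup>2"
    by (simp add: A_def power_mult_distrib)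
  then show ?thesis using assms by (meson power2_le_imp_le hnorm_nonneg mult_nonneg_nonneg)
qed

lemma hnorm_triangle:
  assumes "a \<in> hcarrier H" "b \<in> hcarrier H"
  shows "hnorm H (a + b) \<le> hnorm H a + hnorm H b"
proof -
  have "Re (hinner H a b) \<le> hnorm H a * hnorm H b"
    using Cauchy_Schwarz[OF assms] complex_Re_le_cmod order_trans by blast
  then have "(hnorm H (a + b))\<^sup>2 \<le> (hnorm H a + hnorm H b)\<^sup>2"
    using hnorm_add_sq[OF assms] by (simp add: power2_sum)
  then show ?thesis using assms by (meson power2_le_imp_le hnorm_nonneg add_nonneg_nonneg)
qed

lemma hnorm_triangle_diff:
  assumes "a \<in> hcarrier H" "b \<in> hcarrier H" "c \<in> hcarrier H"
  shows "hnorm H (a - c) \<le> hnorm H (a - b) + hnorm H (b - c)"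
  using hnorm_triangle[of "a - b" "b - c"] assms by simp

lemma hnorm_diff_abs:
  assumes "a \<in> hcarrier H" "b \<in> hcarrier H"
  shows "\<bar>hnorm H a - hnorm H b\<bar> \<le> hnorm H (a - b)"
  using hnorm_triangle[of "a - b" b] hnorm_triangle[of "b - a" a] assms hnorm_minus_commute[OF assms]
  by simp

lemma hnorm_sum_le:
  assumes "\<And>i. i \<in> I \<Longrightarrow> f i \<in> hcarrier H"
  shows "hnorm H (\<Sum>i\<in>I. f i) \<le> (\<Sum>i\<in>I. hnorm H (f i))"
  using assms
proof (induction I rule: infinite_finite_induct)
  case (insert x F)
  then have "hnorm H (f x + (\<Sum>i\<in>F. f i)) \<le> hnorm H (f x) + hnorm H (\<Sum>i\<in>F. f i)"
    by (intro hnorm_triangle sum_in) auto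
  with insert show ?case by simp
qed auto

lemma heq_sym: "\<lbrakk>heq H a b; a \<in> hcarrier H; b \<in> hcarrier H\<rbrakk> \<Longrightarrow> heq H b a"
  by (simp add: heq_def hnorm_minus_commute)

lemma heq_trans:
  "\<lbrakk>heq H a b; heq H b c; a \<in> hcarrier H; b \<in> hcarrier H; c \<in> hcarrier H\<rbrakk> \<Longrightarrow> heq H a c"
  using hnorm_triangle_diff[of a b c] hnorm_nonneg[of "a - c"] diff_in[of a c] unfolding heq_def by linarith

lemma heq_hnorm: "\<lbrakk>heq H a b; a \<in> hcarrier H; b \<in> hcarrier H\<rbrakk> \<Longrightarrow> hnorm H a = hnorm H b"
  using hnorm_diff_abs[of a b] by (simp add: heq_def)

lemma heq_inner_left:
  "\<lbrakk>heq H a b; a \<in> hcarrier H; b \<in> hcarrier H; c \<in> hcarrier H\<rbrakk> \<Longrightarrow> hinner H a c = hinner H b c"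
  using Cauchy_Schwarz[of "a - b" c] by (simp add: heq_def inner_diff_left)

lemma heq_inner_right:
  "\<lbrakk>heq H a b; a \<in> hcarrier H; b \<in> hcarrier H; c \<in> hcarrier H\<rbrakk> \<Longrightarrow> hinner H c a = hinner H c b"
  by (metis heq_inner_left inner_cnj)

lemma tendsto_hnorm:
  assumes "\<And>n. s n \<in> hcarrier H" "l \<in> hcarrier H" "(\<lambda>n. hnorm H (s n - l)) \<longlonglongrightarrow> 0"
  shows "(\<lambda>n. hnorm H (s n)) \<longlonglongrightarrow> hnorm H l"
proof (rule LIM_zero_cancel, rule Lim_null_comparison[OF _ assms(3)])
  show "\<forall>\<^sub>F n in sequentially. norm (hnorm H (s n) - hnorm H l) \<le> hnorm H (s n - l)"
    using hnorm_diff_abs assms by simp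
qed

lemma tendsto_inner_left:
  assumes "\<And>n. s n \<in> hcarrier H" "l \<in> hcarrier H" "(\<lambda>n. hnorm H (s n - l)) \<longlonglongrightarrow> 0"
    "c \<in> hcarrier H"
  shows "(\<lambda>n. hinner H (s n) c) \<longlonglongrightarrow> hinner H l c"
proof (rule LIM_zero_cancel, rule Lim_null_comparison)
  show "\<forall>\<^sub>F n in sequentially. norm (hinner H (s n) c - hinner H l c) \<le> hnorm H (s n - l) * hnorm H c"
    using Cauchy_Schwarz[of "s _ - l" c] assms by (simp add: inner_diff_left)
  show "(\<lambda>n. hnorm H (s n - l) * hnorm H c) \<longlonglongrightarrow> 0"
    using tendsto_mult_left_zero[OF assms(3)] .
qed

lemma tendsto_inner:
  assumes s: "\<And>n. s n \<in> hcarrier H" "l \<in> hcarrier H" "(\<lambda>n. hnorm H (s n - l)) \<longlonglongrightarrow> 0"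
    and t: "\<And>n. t n \<in> hcarrier H" "c \<in> hcarrier H" "(\<lambda>n. hnorm H (t n - c)) \<longlonglongrightarrow> 0"
  shows "(\<lambda>n. hinner H (s n) (t n)) \<longlonglongrightarrow> hinner H l c"
proof -
  have "(\<lambda>n. hinner H (s n) (t n - c)) \<longlonglongrightarrow> 0"
  proof (rule Lim_null_comparison)
    show "\<forall>\<^sub>F n in sequentially. norm (hinner H (s n) (t n - c)) \<le> hnorm H (s n) * hnorm H (t n - c)"
      using Cauchy_Schwarz s t by simp
    show "(\<lambda>n. hnorm H (s n) * hnorm H (t n - c)) \<longlonglongrightarrow> 0"
      using tendsto_mult[OF tendsto_hnorm[OF s] t(3)] by simp
  qed
  from tendsto_add[OF this tendsto_inner_left[OF s t(2)]]
  show ?thesis using s t by (simp add: inner_diff_right)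
qed

subsection \<open>Orthonormal sets\<close>

definition orthonormal :: "'v set \<Rightarrow> bool" where
  "orthonormal E \<longleftrightarrow> E \<subseteq> hcarrier H \<and> (\<forall>e\<in>E. \<forall>e'\<in>E. hinner H e e' = (if e = e' then 1 else 0))"

text \<open>
  The residue \<open>a - p\<close> is orthogonal to the span of \<open>F\<close>; Pythagoras applied to \<open>a = (a - p) + p\<close> and to
  \<open>a - v = (a - p) + (p - v)\<close> gives Bessel's identity and the optimality of \<open>p\<close>.
\<close>

lemma orthonormal_projection:
  assumes "orthonormal F" "finite F" "a \<in> hcarrier H"
  defines "p \<equiv> \<Sum>e\<in>F. cscale (hinner H a e) e"
  shows "p \<in> hcarrier H" and "\<And>e. e \<in> F \<Longrightarrow> hinner H (a - p) e = 0"
    and "(hnorm H a)\<^sup>2 = (hnorm H (a - p))\<^sup>2 + (\<Sum>e\<in>F. (cmod (hinner H a e))\<^sup>2)"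
    and "\<And>c. (hnorm H (a - p))\<^sup>2 \<le> (hnorm H (a - (\<Sum>e\<in>F. cscale (c e) e)))\<^sup>2"
proof -
  have F: "F \<subseteq> hcarrier H" using assms by (simp add: orthonormal_def)
  show p: "p \<in> hcarrier H" unfolding p_def using F by auto
  have inner_comb: "hinner H (\<Sum>e\<in>F. cscale (c e) e) e' = c e'" if "e' \<in> F" for c e'
  proof -
    have "hinner H (\<Sum>e\<in>F. cscale (c e) e) e' = (\<Sum>e\<in>F. c e * (if e = e' then 1 else 0))"
      using F that assms(1)
      by (subst inner_sum_left) (auto intro!: sum.cong simp: inner_scale_left orthonormal_def subset_iff)
    also have "\<dots> = c e'" using that assms(2) by (simp add: if_distrib sum.delta cong: if_cong)
    finally show ?thesis .
  qed
  show orth: "hinner H (a - p) e = 0" if "e \<in> F" for e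
    using inner_comb[OF that] that F p assms(3) by (auto simp: inner_diff_left p_def subset_iff)
  have orth_comb: "hinner H (\<Sum>e\<in>F. cscale (c e) e) (a - p) = 0" for c
  proof (subst inner_sum_left)
    have "hinner H (cscale (c e) e) (a - p) = 0" if "e \<in> F" for e
      using orth[OF that] inner_cnj[of "a - p" e] that F p assms(3)
      by (auto simp: inner_scale_left subset_iff)
    then show "(\<Sum>e\<in>F. hinner H (cscale (c e) e) (a - p)) = 0" by simp
  qed (use F p assms(3) in auto)
  have "hinner H p p = (\<Sum>e\<in>F. complex_of_real ((cmod (hinner H a e))\<^sup>2))"
  proof -
    have "hinner H (\<Sum>e\<in>F. cscale (hinner H a e) e) p = (\<Sum>e\<in>F. hinner H a e * hinner H e p)"
      using F p by (subst inner_sum_left) (auto intro!: sum.cong simp: inner_scale_left)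
    then have "hinner H p p = (\<Sum>e\<in>F. hinner H a e * hinner H e p)"
      by (simp only: p_def[symmetric])
    also have "\<dots> = (\<Sum>e\<in>F. complex_of_real ((cmod (hinner H a e))\<^sup>2))"
    proof (rule sum.cong[OF refl])
      fix e assume e: "e \<in> F"
      then have "hinner H e p = cnj (hinner H a e)"
        using inner_comb[OF e] inner_cnj[of p e] p F by (auto simp: p_def)
      then show "hinner H a e * hinner H e p = complex_of_real ((cmod (hinner H a e))\<^sup>2)"
        using complex_norm_square[of "hinner H a e"] by simp
    qed
    finally show ?thesis .
  qed
  then have pp: "(hnorm H p)\<^sup>2 = (\<Sum>e\<in>F. (cmod (hinner H a e))\<^sup>2)"
    using p by (simp add: hnorm_sq)
  show "(hnorm H a)\<^sup>2 = (hnorm H (a - p))\<^sup>2 + (\<Sum>e\<in>F. (cmod (hinner H a e))\<^sup>2)"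
    using hnorm_add_sq[of p "a - p"] orth_comb[of "hinner H a"] p assms(3) pp
    by (simp add: p_def[symmetric])
  fix c
  let ?v = "\<Sum>e\<in>F. cscale (c e) e"
  have v: "?v \<in> hcarrier H" using F by auto
  have "p - ?v = (\<Sum>e\<in>F. cscale (hinner H a e - c e) e)"
    by (simp add: p_def cscale_diff_left sum_subtractf)
  then have "hinner H (p - ?v) (a - p) = 0" using orth_comb by simp
  then show "(hnorm H (a - p))\<^sup>2 \<le> (hnorm H (a - ?v))\<^sup>2"
    using hnorm_add_sq[of "p - ?v" "a - p"] p v assms(3) by simp
qed

lemma Bessel:
  assumes "orthonormal F" "finite F" "a \<in> hcarrier H"
  shows "(\<Sum>e\<in>F. (cmod (hinner H a e))\<^sup>2) \<le> (hnorm H a)\<^sup>2"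
  using orthonormal_projection(3)[OF assms] by simp

lemma orthonormal_subset: "orthonormal E \<Longrightarrow> F \<subseteq> E \<Longrightarrow> orthonormal F"
  unfolding orthonormal_def by blast

lemma orthonormal_insert:
  assumes "orthonormal F" "r \<in> hcarrier H" "hnorm H r \<noteq> 0" "\<And>e. e \<in> F \<Longrightarrow> hinner H r e = 0"
  defines "u \<equiv> cscale (complex_of_real (1 / hnorm H r)) r"
  shows "orthonormal (insert u F)" "u \<notin> F"
proof -
  have u: "u \<in> hcarrier H" using assms by (simp add: u_def)
  have "hnorm H u = 1" unfolding u_def using assms(2,3) by (subst hnorm_scale) (auto simp: norm_divide)
  then have uu: "hinner H u u = 1" using inner_self[OF u] by simp
  have ue: "hinner H u e = 0" "hinner H e u = 0" if "e \<in> F" for e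
  proof -
    have e: "e \<in> hcarrier H" using that assms(1) by (auto simp: orthonormal_def)
    show "hinner H u e = 0" using assms(2) assms(4)[OF that] e by (simp add: u_def inner_scale_left)
    then show "hinner H e u = 0" using inner_cnj[OF u e] by simp
  qed
  show un: "u \<notin> F" using ue uu by force
  show "orthonormal (insert u F)" unfolding orthonormal_def
    using u uu ue un assms(1) by (auto simp: orthonormal_def)
qed

text \<open>
  Gram-Schmidt, adding one vector of \<open>A\<close> at a time.  The form may be degenerate: a vector whose residue
  has norm zero enlarges \<open>A\<close> but not \<open>F\<close>, which is why the conclusion speaks of norms and coefficients
  and not of spans.
\<close>

lemma finite_orthonormalization:
  assumes "finite A" "A \<subseteq> hcarrier H"
  shows "\<exists>F. finite F \<and> orthonormal F \<and> (\<forall>a\<in>A. (hnorm H a)\<^sup>2 = (\<Sum>e\<in>F. (cmod (hinner H a e))\<^sup>2))"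
  using assms
proof (induction A)
  case empty
  show ?case by (rule exI[of _ "{}"]) (simp add: orthonormal_def)
next
  case (insert a A)
  then obtain F where F: "finite F" "orthonormal F"
    "\<And>b. b \<in> A \<Longrightarrow> (hnorm H b)\<^sup>2 = (\<Sum>e\<in>F. (cmod (hinner H b e))\<^sup>2)" by auto
  have a: "a \<in> hcarrier H" using insert by simp
  define p where "p = (\<Sum>e\<in>F. cscale (hinner H a e) e)"
  note proj = orthonormal_projection[OF F(2,1) a, folded p_def]
  show ?case
  proof (cases "hnorm H (a - p) = 0")
    case True
    then show ?thesis using F proj(3) by (intro exI[of _ F]) auto
  next
    case False
    define u where "u = cscale (complex_of_real (1 / hnorm H (a - p))) (a - p)"
    have ap: "a - p \<in> hcarrier H" using a proj by simp
    note ins = orthonormal_insert[OF F(2) ap False proj(2), folded u_def]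
    have u: "u \<in> hcarrier H" using ins by (simp add: orthonormal_def)
    have "hinner H (a - p) p = 0"
    proof -
      have Fc: "F \<subseteq> hcarrier H" using F by (simp add: orthonormal_def)
      have "hinner H p (a - p) = 0" unfolding p_def
      proof (subst inner_sum_left, goal_cases)
        case 3
        show ?case
        proof (intro sum.neutral ballI)
          fix e assume e: "e \<in> F"
          then show "hinner H (cscale (hinner H a e) e) (a - (\<Sum>e\<in>F. cscale (hinner H a e) e)) = 0"
            using proj(2)[OF e] inner_cnj[of "a - p" e] ap Fc
            by (auto simp: inner_scale_left p_def[symmetric] subset_iff)
        qed
      qed (use Fc ap in \<open>auto simp: p_def\<close>)
      then show ?thesis using inner_cnj[of p "a - p"] ap proj(1) by simp
    qed
    then have "hinner H p (a - p) = 0" using inner_cnj[of "a - p" p] ap proj(1) by simp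
    then have "hinner H a (a - p) = hinner H (a - p) (a - p)"
      using inner_diff_left[of a p "a - p"] a ap proj(1) by simp
    then have "hinner H a u = complex_of_real (hnorm H (a - p))"
      using inner_self[OF ap] False a ap unfolding u_def
      by (simp add: inner_scale_right power2_eq_square)
    then have 1: "(hnorm H a)\<^sup>2 = (\<Sum>e\<in>insert u F. (cmod (hinner H a e))\<^sup>2)"
      using proj(3) F(1) ins(2) by simp
    have 2: "(hnorm H b)\<^sup>2 = (\<Sum>e\<in>insert u F. (cmod (hinner H b e))\<^sup>2)" if "b \<in> A" for b
    proof (rule antisym)
      show "(hnorm H b)\<^sup>2 \<le> (\<Sum>e\<in>insert u F. (cmod (hinner H b e))\<^sup>2)"
        using F(1) F(3)[OF that] ins(2) by simp
      show "(\<Sum>e\<in>insert u F. (cmod (hinner H b e))\<^sup>2) \<le> (hnorm H b)\<^sup>2"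
        using Bessel[OF ins(1), of b] F(1) that insert.prems by auto
    qed
    show ?thesis using ins F(1) 1 2 by (intro exI[of _ "insert u F"]) auto
  qed
qed

text \<open>
  By Zorn's lemma there is a maximal orthonormal set; a vector of nonzero norm that is orthogonal to it
  could be normalized and added.
\<close>

lemma orthonormal_basis_exists: "\<exists>E. orthonormal_basis H E"
proof -
  have "\<exists>M\<in>Collect orthonormal. \<forall>X\<in>Collect orthonormal. M \<subseteq> X \<longrightarrow> X = M"
  proof (rule subset_Zorn_nonempty)
    show "Collect orthonormal \<noteq> {}" by (auto simp: orthonormal_def)
    fix \<C> assume C: "\<C> \<noteq> {}" "subset.chain (Collect orthonormal) \<C>"
    have C_on: "orthonormal X" if "X \<in> \<C>" for X
      using C(2) that unfolding subset_chain_def by blast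
    have common: "\<exists>X\<in>\<C>. e \<in> X \<and> e' \<in> X" if "e \<in> \<Union>\<C>" "e' \<in> \<Union>\<C>" for e e'
    proof -
      obtain X Y where XY: "X \<in> \<C>" "Y \<in> \<C>" "e \<in> X" "e' \<in> Y" using \<open>e \<in> \<Union>\<C>\<close> \<open>e' \<in> \<Union>\<C>\<close> by auto
      then have "X \<subseteq> Y \<or> Y \<subseteq> X" using C(2) unfolding subset_chain_def by simp
      then show ?thesis using XY by auto
    qed
    have "hinner H e e' = (if e = e' then 1 else 0)" if "e \<in> \<Union>\<C>" "e' \<in> \<Union>\<C>" for e e'
    proof -
      obtain X where "X \<in> \<C>" "e \<in> X" "e' \<in> X" using common \<open>e \<in> \<Union>\<C>\<close> \<open>e' \<in> \<Union>\<C>\<close> by meson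
      then show ?thesis using C_on[of X] unfolding orthonormal_def by simp
    qed
    moreover have "\<Union>\<C> \<subseteq> hcarrier H" using C_on unfolding orthonormal_def by (meson Sup_least)
    ultimately show "\<Union>\<C> \<in> Collect orthonormal" unfolding orthonormal_def by simp
  qed
  then obtain E where E: "orthonormal E" "\<And>X. orthonormal X \<Longrightarrow> E \<subseteq> X \<Longrightarrow> X = E" by auto
  have "hnorm H a = 0" if "a \<in> hcarrier H" "\<forall>e\<in>E. hinner H a e = 0" for a
  proof (rule ccontr)
    assume "hnorm H a \<noteq> 0"
    note ins = orthonormal_insert[OF E(1) that(1) this bspec[OF that(2)]]
    show False using ins(2) E(2)[OF ins(1) subset_insertI] by blast
  qed
  then show ?thesis using E(1) unfolding orthonormal_basis_def orthonormal_def by blast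
qed

lemma orthonormal_basis_imp_orthonormal: "orthonormal_basis H E \<Longrightarrow> orthonormal E"
  by (simp add: orthonormal_basis_def orthonormal_def)

text \<open>Bessel's inequality makes the squared coefficients of \<open>a\<close> summable.\<close>

lemma countable_nonorthogonal:
  assumes "orthonormal E" "a \<in> hcarrier H"
  shows "countable {e\<in>E. hinner H a e \<noteq> 0}"
proof -
  have "(\<lambda>e. (cmod (hinner H a e))\<^sup>2) summable_on E"
  proof (rule nonneg_bdd_above_summable_on)
    show "bdd_above (sum (\<lambda>e. (cmod (hinner H a e))\<^sup>2) ` {F. F \<subseteq> E \<and> finite F})"
      using Bessel[OF orthonormal_subset[OF assms(1)] _ assms(2)] by (intro bdd_aboveI2) auto
  qed simp
  then have "countable {e\<in>E. (cmod (hinner H a e))\<^sup>2 \<noteq> 0}"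
    by (rule summable_countable_real)
  then show ?thesis by simp
qed

text \<open>
  Each member of \<open>E\<close> fails to be orthogonal to some member of the countable total set.
\<close>

lemma orthonormal_countable:
  assumes "orthonormal E" "countable S" "S \<subseteq> hcarrier H"
    and total: "\<And>a. a \<in> hcarrier H \<Longrightarrow> (\<And>s. s \<in> S \<Longrightarrow> hinner H s a = 0) \<Longrightarrow> hnorm H a = 0"
  shows "countable E"
proof -
  have "E \<subseteq> (\<Union>s\<in>S. {e\<in>E. hinner H s e \<noteq> 0})"
  proof
    fix e assume e: "e \<in> E"
    then have "hinner H e e = 1" "e \<in> hcarrier H" using assms(1) by (auto simp: orthonormal_def)
    then have "\<exists>s\<in>S. hinner H s e \<noteq> 0" using total[of e] by (auto simp: hnorm_def)
    then show "e \<in> (\<Union>s\<in>S. {e\<in>E. hinner H s e \<noteq> 0})" using e by blast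
  qed
  moreover have "countable (\<Union>s\<in>S. {e\<in>E. hinner H s e \<noteq> 0})"
    using assms countable_nonorthogonal[OF assms(1)] by (intro countable_UN) auto
  ultimately show ?thesis using countable_subset by blast
qed

subsection \<open>Complete spaces\<close>

text \<open>
  Besides orthonormal bases this covers enumerations padded with zeros and the projections of an
  orthonormal basis to a closed subspace, whose members are in general not orthogonal.
\<close>

definition parseval_family :: "'i set \<Rightarrow> ('i \<Rightarrow> 'v) \<Rightarrow> bool" where
  "parseval_family I g \<longleftrightarrow> (\<forall>i\<in>I. g i \<in> hcarrier H) \<and>
     (\<forall>a\<in>hcarrier H. ((\<lambda>i. (cmod (hinner H a (g i)))\<^sup>2) has_sum (hnorm H a)\<^sup>2) I)"

end

locale hilbert = pre_hilbert +
  assumes complete: "\<And>s::nat \<Rightarrow> 'a. \<lbrakk>\<And>n. s n \<in> hcarrier H;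
      \<And>\<epsilon>. 0 < \<epsilon> \<Longrightarrow> \<exists>N. \<forall>m\<ge>N. \<forall>n\<ge>N. hnorm H (s m - s n) < \<epsilon>\<rbrakk> \<Longrightarrow>
      \<exists>l\<in>hcarrier H. (\<lambda>n. hnorm H (s n - l)) \<longlonglongrightarrow> 0"
begin

text \<open>
  The midpoint of \<open>s m\<close> and \<open>s n\<close> lies in \<open>N\<close>, hence is no closer to \<open>u\<close> than the infimum; by the
  parallelogram law \<open>s m\<close> and \<open>s n\<close> are close to each other.
\<close>

lemma minimizing_sequence_converges:
  assumes N: "linear_subset N" "N \<subseteq> hcarrier H" and u: "u \<in> hcarrier H"
    and le: "\<And>v. v \<in> N \<Longrightarrow> d \<le> (hnorm H (u - v))\<^sup>2"
    and s: "\<And>n. s n \<in> N" "\<And>n. (hnorm H (u - s n))\<^sup>2 < d + 1 / (real n + 1)"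
  shows "\<exists>l\<in>hcarrier H. (\<lambda>n. hnorm H (s n - l)) \<longlonglongrightarrow> 0"
proof (rule complete)
  have sH: "s n \<in> hcarrier H" for n using s N by auto
  then show "s n \<in> hcarrier H" for n .
  have parallelogram: "(hnorm H (s m - s n))\<^sup>2 \<le> 2 / (real m + 1) + 2 / (real n + 1)" for m n
  proof -
    let ?w = "cscale (1/2) (s m + s n)"
    have w: "?w \<in> N" using s(1) N(1) by (auto simp: linear_subset_def)
    then have wH: "?w \<in> hcarrier H" using N(2) by auto
    have two: "cscale 2 (u - ?w) = (u - s m) + (u - s n)"
    proof -
      have "cscale 2 ?w = s m + s n" by (simp add: cscale_cscale cscale_one)
      moreover have "cscale 2 u = u + u"
        using cscale_add_left[of 1 1 u] by (simp add: cscale_one)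
      ultimately show ?thesis by (simp add: cscale_diff_right algebra_simps)
    qed
    have "(hnorm H (s m - s n))\<^sup>2 = (hnorm H ((u - s n) - (u - s m)))\<^sup>2" by simp
    also have "\<dots> = 2 * (hnorm H (u - s n))\<^sup>2 + 2 * (hnorm H (u - s m))\<^sup>2 - (hnorm H ((u - s m) + (u - s n)))\<^sup>2"
      using hnorm_diff_sq[of "u - s n" "u - s m"] hnorm_add_sq[of "u - s n" "u - s m"] sH u
      by (simp add: add.commute)
    also have "(hnorm H ((u - s m) + (u - s n)))\<^sup>2 = 4 * (hnorm H (u - ?w))\<^sup>2"
      using u wH by (simp add: two[symmetric] power_mult_distrib)
    also have "2 * (hnorm H (u - s n))\<^sup>2 + 2 * (hnorm H (u - s m))\<^sup>2 - 4 * (hnorm H (u - ?w))\<^sup>2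
        \<le> 2 * (1 / (real n + 1)) + 2 * (1 / (real m + 1))"
    proof -
      have "2 * x + 2 * y - 4 * w \<le> 2 * p + 2 * q"
        if "d \<le> w" "x < d + p" "y < d + q" for x y w p q :: real
        using that by linarith
      from this[OF le[OF w] s(2)[of n] s(2)[of m]] show ?thesis .
    qed
    finally show ?thesis by (simp add: add.commute)
  qed
  fix \<epsilon> :: real assume e: "0 < \<epsilon>"
  obtain N0 :: nat where N0: "4 / \<epsilon>\<^sup>2 < real N0" using reals_Archimedean2 by blast
  show "\<exists>N. \<forall>m\<ge>N. \<forall>n\<ge>N. hnorm H (s m - s n) < \<epsilon>"
  proof (intro exI[of _ N0] allI impI)
    fix m n assume mn: "N0 \<le> m" "N0 \<le> n"
    have N0p: "real N0 > 0" using N0 e by (smt (verit) divide_nonneg_nonneg zero_le_power2)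
    have "2 / (real m + 1) \<le> 2 / real N0" "2 / (real n + 1) \<le> 2 / real N0"
      using mn N0p by (auto intro!: divide_left_mono mult_pos_pos)
    then have "(hnorm H (s m - s n))\<^sup>2 \<le> 4 / real N0" using parallelogram[of m n] by simp
    also have "\<dots> < \<epsilon>\<^sup>2" using N0 N0p e by (simp add: field_simps)
    finally show "hnorm H (s m - s n) < \<epsilon>"
      using e by (meson power2_less_imp_less less_imp_le)
  qed
qed

text \<open>
  The limit \<open>p\<close> of a minimizing sequence lies in the closure of \<open>N\<close>.  This form serves the projection onto
  a closed subspace and the density of spans alike.
\<close>

lemma projection_on_closure:
  assumes N: "linear_subset N" "N \<subseteq> hcarrier H" and u: "u \<in> hcarrier H"
  obtains p s where "p \<in> hcarrier H" "\<And>n. s n \<in> N" "(\<lambda>n. hnorm H (s n - p)) \<longlonglongrightarrow> 0"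
    "\<And>v. v \<in> N \<Longrightarrow> hinner H (u - p) v = 0"
proof -
  define d where "d = (INF v\<in>N. (hnorm H (u - v))\<^sup>2)"
  have N0: "N \<noteq> {}" using N by (auto simp: linear_subset_def)
  have bdd: "bdd_below ((\<lambda>v. (hnorm H (u - v))\<^sup>2) ` N)" by (intro bdd_belowI2[of _ 0]) simp
  have le: "d \<le> (hnorm H (u - v))\<^sup>2" if "v \<in> N" for v
    unfolding d_def using bdd that by (rule cINF_lower)
  have "\<exists>v\<in>N. (hnorm H (u - v))\<^sup>2 < d + 1 / (real n + 1)" for n
    using cINF_less_iff[OF N0 bdd, of "d + 1 / (real n + 1)"] by (simp add: d_def)
  then obtain s where s: "\<And>n. s n \<in> N" "\<And>n. (hnorm H (u - s n))\<^sup>2 < d + 1 / (real n + 1)" by metis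
  from minimizing_sequence_converges[OF N u le s] obtain p where p: "p \<in> hcarrier H"
    "(\<lambda>n. hnorm H (s n - p)) \<longlonglongrightarrow> 0" by auto
  have sH: "s n \<in> hcarrier H" for n using s N by auto
  have lim: "(\<lambda>n. (hnorm H (u - s n - v))\<^sup>2) \<longlonglongrightarrow> (hnorm H (u - p - v))\<^sup>2" if "v \<in> hcarrier H" for v
  proof (intro tendsto_power tendsto_hnorm)
    have "u - s n - v - (u - p - v) = - (s n - p)" for n by simp
    then have "hnorm H (u - s n - v - (u - p - v)) = hnorm H (s n - p)" for n
      using hnorm_uminus[of "s n - p"] sH p by simp
    then show "(\<lambda>n. hnorm H (u - s n - v - (u - p - v))) \<longlonglongrightarrow> 0" using p(2) by simp
  qed (use u sH p that in auto)
  have "(\<lambda>n. d + 1 / (real n + 1)) \<longlonglongrightarrow> d + 0"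
    using LIMSEQ_inverse_real_of_nat by (intro tendsto_add tendsto_const) (simp add: inverse_eq_divide add.commute)
  then have up: "(hnorm H (u - p))\<^sup>2 \<le> d"
    using lim[of 0] s(2) by (intro LIMSEQ_le[of "\<lambda>n. (hnorm H (u - s n))\<^sup>2"]) (auto intro: less_imp_le)
  have "hinner H (u - p) v = 0" if v: "v \<in> N" for v
  proof -
    have vH: "v \<in> hcarrier H" using v N by auto
    have "d \<le> (hnorm H (u - p - cscale c v))\<^sup>2" for c
    proof (rule LIMSEQ_le_const[OF lim])
      have "s n + cscale c v \<in> N" for n using s(1) v N by (auto simp: linear_subset_def)
      then show "\<exists>N. \<forall>n\<ge>N. d \<le> (hnorm H (u - s n - cscale c v))\<^sup>2"
        using le by (metis diff_diff_eq)
    qed (use vH in auto)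
    then have dt: "d \<le> (hnorm H (u - p))\<^sup>2 + (- 2 * t * (cmod (hinner H (u - p) v))\<^sup>2
        + t\<^sup>2 * (cmod (hinner H (u - p) v))\<^sup>2 * (hnorm H v)\<^sup>2)" for t
      unfolding hnorm_diff_scaled_sq[OF diff_in[OF u p(1)] vH, symmetric] .
    then have "0 \<le> - 2 * t * (cmod (hinner H (u - p) v))\<^sup>2
        + t\<^sup>2 * (cmod (hinner H (u - p) v))\<^sup>2 * (hnorm H v)\<^sup>2" for t
      using dt[of t] up by linarith
    from vanishing_coefficient[OF this] show ?thesis by simp
  qed
  then show ?thesis by (rule that[OF p(1) s(1) p(2)])
qed

lemma closed_subspace_linear: "closed_subspace H V \<Longrightarrow> linear_subset V"
  by (simp add: closed_subspace_def linear_subset_def)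

lemma closed_subspace_limit:
  fixes s :: "nat \<Rightarrow> 'a"
  assumes "closed_subspace H V" "\<And>n. s n \<in> V" "l \<in> hcarrier H" "(\<lambda>n. hnorm H (s n - l)) \<longlonglongrightarrow> 0"
  shows "l \<in> V"
  using assms(1) unfolding closed_subspace_def using assms(2-4) by blast

lemma closed_subspace_heq:
  assumes "closed_subspace H V" "a \<in> V" "b \<in> hcarrier H" "heq H a b"
  shows "b \<in> V"
proof (rule closed_subspace_limit[OF assms(1) _ assms(3), of "\<lambda>_. a"])
  show "(\<lambda>n::nat. hnorm H (a - b)) \<longlonglongrightarrow> 0" using assms(4) by (simp add: heq_def)
qed (rule assms(2))

text \<open>
  The choice that defines \<open>orth_proj\<close> is from a nonempty set.
\<close>

lemma orth_proj:
  assumes V: "closed_subspace H V" and a: "a \<in> hcarrier H"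
  shows "orth_proj H V a \<in> V" "\<And>v. v \<in> V \<Longrightarrow> hinner H (a - orth_proj H V a) v = 0"
proof -
  have VH: "V \<subseteq> hcarrier H" using V by (simp add: closed_subspace_def)
  from projection_on_closure[OF closed_subspace_linear[OF V] VH a]
  obtain p s where p: "p \<in> hcarrier H" "\<And>n. s n \<in> V" "(\<lambda>n. hnorm H (s n - p)) \<longlonglongrightarrow> 0"
    "\<And>v. v \<in> V \<Longrightarrow> hinner H (a - p) v = 0" by metis
  have "p \<in> V" by (rule closed_subspace_limit[OF V p(2,1,3)])
  then have "\<exists>p. p \<in> V \<and> (\<forall>v\<in>V. hinner H (a - p) v = 0)" using p by blast
  from someI_ex[OF this] show "orth_proj H V a \<in> V"
    "\<And>v. v \<in> V \<Longrightarrow> hinner H (a - orth_proj H V a) v = 0"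
    unfolding orth_proj_def by auto
qed

lemma closed_subspace_hilbert:
  assumes V: "closed_subspace H V"
  shows "hilbert (subspace_of V H)"
proof -
  have VH: "V \<subseteq> hcarrier H" using V by (simp add: closed_subspace_def)
  have hn: "hnorm (subspace_of V H) = hnorm H" by (simp add: hnorm_def subspace_of_def fun_eq_iff)
  have "pre_hilbert (subspace_of V H)"
  proof (rule pre_hilbert.intro)
    show "linear_subset (hcarrier (subspace_of V H))"
      using closed_subspace_linear[OF V] by (simp add: subspace_of_def)
  qed (simp_all add: subspace_of_def inner_add_left inner_scale_left inner_nonneg subsetD[OF VH],
      meson VH inner_cnj subsetD)
  moreover have "hilbert_axioms (subspace_of V H)"
  proof
    fix s :: "nat \<Rightarrow> 'a"
    assume s: "\<And>n. s n \<in> hcarrier (subspace_of V H)" and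
      c: "\<And>\<epsilon>. 0 < \<epsilon> \<Longrightarrow> \<exists>N. \<forall>m\<ge>N. \<forall>n\<ge>N. hnorm (subspace_of V H) (s m - s n) < \<epsilon>"
    have sV: "s n \<in> V" for n using s by (simp add: subspace_of_def)
    have "\<exists>l\<in>hcarrier H. (\<lambda>n. hnorm H (s n - l)) \<longlonglongrightarrow> 0"
      using sV VH c by (intro complete) (auto simp: hn)
    then obtain l where l: "l \<in> hcarrier H" "(\<lambda>n. hnorm H (s n - l)) \<longlonglongrightarrow> 0" by blast
    from closed_subspace_limit[OF V sV l] have "l \<in> V" .
    then show "\<exists>l\<in>hcarrier (subspace_of V H). (\<lambda>n. hnorm (subspace_of V H) (s n - l)) \<longlonglongrightarrow> 0"
      using l(2) unfolding hn by (intro bexI[of _ l]) (simp_all add: subspace_of_def)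
  qed
  ultimately show ?thesis by (rule hilbert.intro)
qed

text \<open>
  A multiple of the residue of \<open>u\<close> after projection to the kernel of \<open>\<phi>\<close>; by boundedness \<open>\<phi>\<close> also
  vanishes on the closure of its kernel.
\<close>

lemma Riesz_representation:
  assumes add: "\<And>a b. \<lbrakk>a \<in> hcarrier H; b \<in> hcarrier H\<rbrakk> \<Longrightarrow> \<phi> (a + b) = \<phi> a + \<phi> b"
    and scale: "\<And>k a. a \<in> hcarrier H \<Longrightarrow> \<phi> (cscale k a) = k * \<phi> a"
    and bounded: "\<And>a. a \<in> hcarrier H \<Longrightarrow> cmod (\<phi> a) \<le> C * hnorm H a"
  shows "\<exists>w\<in>hcarrier H. \<forall>a\<in>hcarrier H. \<phi> a = hinner H a w"
proof (cases "\<forall>a\<in>hcarrier H. \<phi> a = 0")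
  case True
  then show ?thesis by (intro bexI[of _ 0]) auto
next
  case False
  then obtain u where u: "u \<in> hcarrier H" "\<phi> u \<noteq> 0" by auto
  have diff: "\<phi> (a - b) = \<phi> a - \<phi> b" if "a \<in> hcarrier H" "b \<in> hcarrier H" for a b
    using add[of "a - b" b] that by simp
  define N where "N = {a \<in> hcarrier H. \<phi> a = 0}"
  have "\<phi> 0 = 0" using scale[of 0 0] by simp
  then have N: "linear_subset N" "N \<subseteq> hcarrier H" using add scale by (auto simp: N_def linear_subset_def)
  from projection_on_closure[OF N u(1)]
  obtain p s where p: "p \<in> hcarrier H" "\<And>n. s n \<in> N" "(\<lambda>n. hnorm H (s n - p)) \<longlonglongrightarrow> 0"
    "\<And>v. v \<in> N \<Longrightarrow> hinner H (u - p) v = 0" by metis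
  have "cmod (\<phi> p) \<le> C * hnorm H (s n - p)" for n
    using bounded[of "s n - p"] p(1) p(2)[of n] diff[of "s n" p] by (auto simp: N_def)
  then have "cmod (\<phi> p) \<le> C * 0"
    using tendsto_mult_left[OF p(3), of C] by (intro LIMSEQ_le_const) auto
  then have "\<phi> p = 0" by simp
  define z where "z = u - p"
  have z: "z \<in> hcarrier H" "\<phi> z \<noteq> 0" using u p(1) diff \<open>\<phi> p = 0\<close> by (auto simp: z_def)
  have zz: "hinner H z z \<noteq> 0" using bounded[OF z(1)] z(2) by (auto simp: hnorm_def)
  have "hinner H z z \<in> \<real>" using inner_self[OF z(1)] by simp
  define w where "w = cscale (cnj (\<phi> z / hinner H z z)) z"
  have "\<phi> a = hinner H a w" if a: "a \<in> hcarrier H" for a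
  proof -
    let ?v = "a - cscale (\<phi> a / \<phi> z) z"
    have "?v \<in> N" using a z by (simp add: N_def diff scale)
    then have "hinner H z ?v = 0" using p(4) by (simp add: z_def)
    then have "hinner H ?v z = 0" using inner_cnj[of z ?v] a z by simp
    then have "hinner H a z = \<phi> a / \<phi> z * hinner H z z"
      using a z by (simp add: inner_diff_left inner_scale_left)
    then show ?thesis using z zz a by (simp add: w_def inner_scale_right)
  qed
  moreover have "w \<in> hcarrier H" using z(1) by (simp add: w_def)
  ultimately show ?thesis by blast
qed

end

lemma has_sum_finite_sum:
  fixes f :: "'i \<Rightarrow> 'j \<Rightarrow> 'b::topological_comm_monoid_add"
  assumes "\<And>j. j \<in> F \<Longrightarrow> ((\<lambda>i. f i j) has_sum s j) I"
  shows "((\<lambda>i. \<Sum>j\<in>F. f i j) has_sum (\<Sum>j\<in>F. s j)) I"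
  using assms by (induction F rule: infinite_finite_induct) (auto intro: has_sum_add)

context hilbert
begin

text \<open>
  The residue of \<open>a\<close> after projection to the closure of the span of \<open>E\<close> is orthogonal to \<open>E\<close>.
\<close>

lemma total_set_approx:
  assumes EH: "E \<subseteq> hcarrier H"
    and total: "\<And>a. a \<in> hcarrier H \<Longrightarrow> (\<And>e. e \<in> E \<Longrightarrow> hinner H a e = 0) \<Longrightarrow> hnorm H a = 0"
    and a: "a \<in> hcarrier H" and e: "0 < \<epsilon>"
  obtains F c where "finite F" "F \<subseteq> E" "hnorm H (a - (\<Sum>e\<in>F. cscale (c e) e)) < \<epsilon>"
proof -
  define N where "N = {(\<Sum>e\<in>F. cscale (c e) e) | F c. finite F \<and> F \<subseteq> E}"
  have N: "N \<subseteq> hcarrier H" using EH by (auto simp: N_def intro!: sum_in scale_in)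
  have lN: "linear_subset N"
    unfolding linear_subset_def
  proof (intro conjI ballI allI)
    show "0 \<in> N" unfolding N_def by (intro CollectI exI[of _ "{}"]) simp
  next
    fix x y assume "x \<in> N" "y \<in> N"
    then obtain F c F' c' where F: "finite F" "F \<subseteq> E" "x = (\<Sum>e\<in>F. cscale (c e) e)"
      "finite F'" "F' \<subseteq> E" "y = (\<Sum>e\<in>F'. cscale (c' e) e)" by (auto simp: N_def)
    have "x = (\<Sum>e\<in>F \<union> F'. cscale (if e \<in> F then c e else 0) e)"
      unfolding F(3) using F by (intro sum.mono_neutral_cong_left) auto
    moreover have "y = (\<Sum>e\<in>F \<union> F'. cscale (if e \<in> F' then c' e else 0) e)"
      unfolding F(6) using F by (intro sum.mono_neutral_cong_left) auto
    ultimately have "x + y = (\<Sum>e\<in>F \<union> F'. cscale ((if e \<in> F then c e else 0) + (if e \<in> F' then c' e else 0)) e)"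
      by (simp add: cscale_add_left sum.distrib)
    then show "x + y \<in> N" unfolding N_def using F
      by (intro CollectI exI[of _ "F \<union> F'"] exI[of _ "\<lambda>e. (if e \<in> F then c e else 0) + (if e \<in> F' then c' e else 0)"]) auto
  next
    fix k x assume "x \<in> N"
    then obtain F c where F: "finite F" "F \<subseteq> E" "x = (\<Sum>e\<in>F. cscale (c e) e)" by (auto simp: N_def)
    have "cscale k (\<Sum>e\<in>F. cscale (c e) e) = (\<Sum>e\<in>F. cscale (k * c e) e)"
      by (induction F rule: infinite_finite_induct) (auto simp: cscale_add_right cscale_cscale)
    then show "cscale k x \<in> N" unfolding N_def using F
      by (intro CollectI exI[of _ F] exI[of _ "\<lambda>e. k * c e"]) auto
  qed
  from projection_on_closure[OF lN N a]
  obtain p s where p: "p \<in> hcarrier H" "\<And>n. s n \<in> N" "(\<lambda>n. hnorm H (s n - p)) \<longlonglongrightarrow> 0"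
    "\<And>v. v \<in> N \<Longrightarrow> hinner H (a - p) v = 0" by metis
  have "b \<in> N" if "b \<in> E" for b
    unfolding N_def using that by (intro CollectI exI[of _ "{b}"] exI[of _ "\<lambda>_. 1"]) (auto simp: cscale_one)
  then have ap: "hnorm H (a - p) = 0" using p(1,4) a by (intro total) auto
  obtain n where n: "hnorm H (s n - p) < \<epsilon>"
    using order_tendstoD(2)[OF p(3) e] eventually_happens' by (metis eventually_sequentially order_refl)
  have sn: "s n \<in> hcarrier H" using p(2) N by auto
  have "hnorm H (a - s n) < \<epsilon>"
    using hnorm_triangle_diff[OF a p(1) sn] ap n hnorm_minus_commute[OF p(1) sn] by simp
  moreover obtain F c where "finite F" "F \<subseteq> E" "s n = (\<Sum>e\<in>F. cscale (c e) e)"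
    using p(2)[of n] by (auto simp: N_def)
  ultimately show ?thesis using that by metis
qed

text \<open>
  A finite combination of \<open>E\<close> close to \<open>a\<close> is no better than the projection of \<open>a\<close> to the span of the same
  finite set, so the finite sums of squares exhaust \<open>\<parallel>a\<parallel>\<^sup>2\<close>.
\<close>

lemma orthonormal_basis_parseval:
  assumes E: "orthonormal_basis H E"
  shows "parseval_family E (\<lambda>e. e)"
  unfolding parseval_family_def
proof (intro conjI ballI)
  show "e \<in> hcarrier H" if "e \<in> E" for e using that E by (auto simp: orthonormal_basis_def)
  fix a assume a: "a \<in> hcarrier H"
  note on = orthonormal_basis_imp_orthonormal[OF E]
  let ?f = "\<lambda>e. (cmod (hinner H a e))\<^sup>2"
  have bessel: "sum ?f F \<le> (hnorm H a)\<^sup>2" if "finite F" "F \<subseteq> E" for F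
    using Bessel[OF orthonormal_subset[OF on that(2)] that(1) a] .
  have sm: "?f summable_on E"
    using bessel by (intro nonneg_bdd_above_summable_on bdd_aboveI2[of _ _ "(hnorm H a)\<^sup>2"]) auto
  moreover have "infsum ?f E = (hnorm H a)\<^sup>2"
  proof (rule antisym)
    show "infsum ?f E \<le> (hnorm H a)\<^sup>2" using sm bessel by (rule infsum_le_finite_sums)
    show "(hnorm H a)\<^sup>2 \<le> infsum ?f E"
    proof (rule field_le_epsilon)
      fix \<epsilon> :: real assume e: "0 < \<epsilon>"
      obtain F c where F: "finite F" "F \<subseteq> E" "hnorm H (a - (\<Sum>e\<in>F. cscale (c e) e)) < sqrt \<epsilon>"
      proof (rule total_set_approx[of E a "sqrt \<epsilon>"])
        show "hnorm H b = 0" if "b \<in> hcarrier H" "\<And>e. e \<in> E \<Longrightarrow> hinner H b e = 0" for b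
          using E that by (simp add: orthonormal_basis_def)
      qed (use E a e in \<open>simp_all add: orthonormal_basis_def\<close>)
      note pr = orthonormal_projection[OF orthonormal_subset[OF on F(2)] F(1) a]
      have FH: "(\<Sum>e\<in>F. cscale (c e) e) \<in> hcarrier H"
        using F E by (auto simp: orthonormal_basis_def intro!: sum_in scale_in)
      have "(hnorm H (a - (\<Sum>e\<in>F. cscale (c e) e)))\<^sup>2 \<le> (sqrt \<epsilon>)\<^sup>2"
        using F(3) a FH by (intro power_mono) auto
      then have "(hnorm H a)\<^sup>2 \<le> \<epsilon> + sum ?f F" using pr(3) pr(4)[of c] e by simp
      also have "sum ?f F \<le> infsum ?f E" using F sm by (intro finite_sum_le_infsum) auto
      finally show "(hnorm H a)\<^sup>2 \<le> infsum ?f E + \<epsilon>" by simp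
    qed
  qed
  ultimately show "(?f has_sum (hnorm H a)\<^sup>2) E" by (simp add: has_sum_iff)
qed

text \<open>
  For \<open>a \<in> V\<close> the coefficients with respect to \<open>g\<close> and to its projection agree.
\<close>

lemma projected_parseval:
  assumes g: "parseval_family I g" and V: "closed_subspace H V"
  shows "pre_hilbert.parseval_family (subspace_of V H) I (\<lambda>i. orth_proj H V (g i))"
proof -
  interpret V: hilbert "subspace_of V H" using closed_subspace_hilbert[OF V] .
  have VH: "V \<subseteq> hcarrier H" using V by (simp add: closed_subspace_def)
  have eq: "hinner H a (orth_proj H V (g i)) = hinner H a (g i)" if "a \<in> V" "i \<in> I" for a i
  proof -
    have gi: "g i \<in> hcarrier H" using g that by (simp add: parseval_family_def)
    note op = orth_proj[OF V gi]
    have "hinner H a (g i - orth_proj H V (g i)) = 0"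
      using op(2)[OF that(1)] inner_cnj[of "g i - orth_proj H V (g i)" a] op(1) gi VH that(1) by auto
    then show ?thesis using gi op(1) VH that(1) by (subst (asm) inner_diff_right) auto
  qed
  show ?thesis unfolding V.parseval_family_def
  proof (intro conjI ballI)
    show "orth_proj H V (g i) \<in> hcarrier (subspace_of V H)" if "i \<in> I" for i
      using orth_proj(1)[OF V] g that by (simp add: parseval_family_def subspace_of_def)
    fix a assume "a \<in> hcarrier (subspace_of V H)"
    then have a: "a \<in> V" by (simp add: subspace_of_def)
    have "((\<lambda>i. (cmod (hinner H a (g i)))\<^sup>2) has_sum (hnorm H a)\<^sup>2) I"
      using g a VH by (auto simp: parseval_family_def)
    then have "((\<lambda>i. (cmod (hinner H a (orth_proj H V (g i))))\<^sup>2) has_sum (hnorm H a)\<^sup>2) I"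
      using eq[OF a] by (subst has_sum_cong[where g = "\<lambda>i. (cmod (hinner H a (g i)))\<^sup>2"]) auto
    then show "((\<lambda>i. (cmod (hinner (subspace_of V H) a (orth_proj H V (g i))))\<^sup>2) has_sum (hnorm (subspace_of V H) a)\<^sup>2) I"
      by (simp add: subspace_of_def hnorm_def)
  qed
qed

subsection \<open>Traces of positive forms\<close>

text \<open>
  The bound \<open>tr(A\<^sup>* B A) \<le> \<parallel>A\<parallel>\<^sup>2 tr B\<close> for the operator \<open>B\<close> of the form \<open>\<beta>\<close>, where \<open>A\<close> maps an orthonormal
  basis to the family \<open>a\<close> and \<open>\<parallel>A\<parallel>\<^sup>2 \<le> c\<close>.  Instead of a square root of \<open>B\<close> the proof uses Gram-Schmidt
  with respect to \<open>\<beta>\<close> itself: it gives finitely many \<open>f\<close>, orthonormal for \<open>\<beta>\<close>, such that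
  \<open>\<beta>(a\<^sub>n, a\<^sub>n) = \<Sum>\<^sub>f |\<beta>(a\<^sub>n, f)|\<^sup>2 = \<Sum>\<^sub>f |\<langle>a\<^sub>n, B f\<rangle>|\<^sup>2\<close>.  Summing over \<open>n\<close> leaves \<open>c \<Sum>\<^sub>f \<parallel>B f\<parallel>\<^sup>2\<close>; and
  expanding \<open>B f\<close> in the Parseval family \<open>g\<close>, Bessel's inequality for \<open>\<beta>\<close> bounds \<open>\<Sum>\<^sub>f \<parallel>B f\<parallel>\<^sup>2\<close> by \<open>t\<close>.
\<close>

lemma trace_le_of_Bessel_family:
  fixes \<beta> :: "'a \<Rightarrow> 'a \<Rightarrow> complex"
  assumes \<beta>: "pre_hilbert \<lparr>hcarrier = hcarrier H, hinner = \<beta>\<rparr>"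
    and bounded: "\<And>a. a \<in> hcarrier H \<Longrightarrow> Re (\<beta> a a) \<le> C * (hnorm H a)\<^sup>2"
    and g: "parseval_family I g" "((\<lambda>i. Re (\<beta> (g i) (g i))) has_sum t) I"
    and A: "finite A" "\<And>n. n \<in> A \<Longrightarrow> a n \<in> hcarrier H"
      "\<And>v. v \<in> hcarrier H \<Longrightarrow> (\<Sum>n\<in>A. (cmod (hinner H (a n) v))\<^sup>2) \<le> c * (hnorm H v)\<^sup>2" "0 \<le> c"
  shows "(\<Sum>n\<in>A. Re (\<beta> (a n) (a n))) \<le> c * t"
proof -
  let ?B = "\<lparr>hcarrier = hcarrier H, hinner = \<beta>\<rparr>"
  interpret B: pre_hilbert ?B by (rule \<beta>)
  have hB: "(hnorm ?B v)\<^sup>2 = Re (\<beta> v v)" if "v \<in> hcarrier H" for v using B.hnorm_sq[of v] that by simp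
  \<comment> \<open>The form is bounded, so each \<open>\<beta>(\<cdot>, f)\<close> is represented by a vector, called \<open>T f\<close> below.\<close>
  have rep: "\<exists>w\<in>hcarrier H. \<forall>v\<in>hcarrier H. \<beta> v f = hinner H v w" if f: "f \<in> hcarrier H" for f
  proof -
    have bd: "cmod (\<beta> v f) \<le> (sqrt \<bar>C\<bar> * hnorm ?B f) * hnorm H v" if v: "v \<in> hcarrier H" for v
    proof -
      have "(hnorm ?B v)\<^sup>2 \<le> \<bar>C\<bar> * (hnorm H v)\<^sup>2"
        using bounded[OF v] hB[OF v] mult_right_mono[OF abs_ge_self[of C] zero_le_power2[of "hnorm H v"]] by simp
      also have "\<dots> = (sqrt \<bar>C\<bar> * hnorm H v)\<^sup>2" by (simp add: power_mult_distrib)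
      finally have "hnorm ?B v \<le> sqrt \<bar>C\<bar> * hnorm H v"
        by (rule power2_le_imp_le) (simp add: v)
      then have "hnorm ?B v * hnorm ?B f \<le> sqrt \<bar>C\<bar> * hnorm H v * hnorm ?B f"
        using B.hnorm_nonneg[of f] f by (simp add: mult_right_mono)
      then show ?thesis using B.Cauchy_Schwarz[of v f] v f by (simp add: mult_ac)
    qed
    have add: "\<beta> (a + b) f = \<beta> a f + \<beta> b f" if "a \<in> hcarrier H" "b \<in> hcarrier H" for a b
      using B.inner_add_left[of a b f] that f by simp
    have scale: "\<beta> (cscale k a) f = k * \<beta> a f" if "a \<in> hcarrier H" for k a
      using B.inner_scale_left[of a f k] that f by simp
    show ?thesis by (rule Riesz_representation[of "\<lambda>v. \<beta> v f", OF add scale bd])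
  qed
  then obtain T where T: "\<And>f. f \<in> hcarrier H \<Longrightarrow> T f \<in> hcarrier H"
    "\<And>f v. f \<in> hcarrier H \<Longrightarrow> v \<in> hcarrier H \<Longrightarrow> \<beta> v f = hinner H v (T f)" by metis
  obtain F where F: "finite F" "B.orthonormal F"
    "\<forall>v\<in>a ` A. (hnorm ?B v)\<^sup>2 = (\<Sum>e\<in>F. (cmod (hinner ?B v e))\<^sup>2)"
    using B.finite_orthonormalization[of "a ` A"] A(1,2) by auto
  have FH: "F \<subseteq> hcarrier H" using F(2) by (simp add: B.orthonormal_def)
  have gH: "g i \<in> hcarrier H" if "i \<in> I" for i using g(1) that by (simp add: parseval_family_def)
  have "((\<lambda>i. \<Sum>f\<in>F. (cmod (hinner H (T f) (g i)))\<^sup>2) has_sum (\<Sum>f\<in>F. (hnorm H (T f))\<^sup>2)) I"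
  proof (rule has_sum_finite_sum)
    fix f assume "f \<in> F"
    then have "T f \<in> hcarrier H" using T(1) FH by blast
    then show "((\<lambda>i. (cmod (hinner H (T f) (g i)))\<^sup>2) has_sum (hnorm H (T f))\<^sup>2) I"
      using g(1) by (simp add: parseval_family_def)
  qed
  moreover have "(\<Sum>f\<in>F. (cmod (hinner H (T f) (g i)))\<^sup>2) \<le> Re (\<beta> (g i) (g i))" if "i \<in> I" for i
  proof -
    have "cmod (hinner H (T f) (g i)) = cmod (\<beta> (g i) f)" if "f \<in> F" for f
    proof -
      have f: "f \<in> hcarrier H" using that FH by blast
      have "hinner H (T f) (g i) = cnj (hinner H (g i) (T f))"
        using gH[OF \<open>i \<in> I\<close>] T(1)[OF f] by (rule inner_cnj)
      then show ?thesis using T(2)[OF f gH[OF \<open>i \<in> I\<close>]] by simp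
    qed
    then have "(\<Sum>f\<in>F. (cmod (hinner H (T f) (g i)))\<^sup>2) = (\<Sum>f\<in>F. (cmod (\<beta> (g i) f))\<^sup>2)" by simp
    also have "\<dots> \<le> Re (\<beta> (g i) (g i))"
      using B.Bessel[OF F(2,1), of "g i"] gH[OF that] hB by simp
    finally show ?thesis .
  qed
  ultimately have tr: "(\<Sum>f\<in>F. (hnorm H (T f))\<^sup>2) \<le> t" by (rule has_sum_mono[OF _ g(2)])
  have "(\<Sum>n\<in>A. Re (\<beta> (a n) (a n))) = (\<Sum>n\<in>A. \<Sum>f\<in>F. (cmod (\<beta> (a n) f))\<^sup>2)"
  proof (rule sum.cong[OF refl])
    fix n assume "n \<in> A"
    then show "Re (\<beta> (a n) (a n)) = (\<Sum>f\<in>F. (cmod (\<beta> (a n) f))\<^sup>2)"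
      using bspec[OF F(3), of "a n"] hB[OF A(2)] by simp
  qed
  also have "\<dots> = (\<Sum>n\<in>A. \<Sum>f\<in>F. (cmod (hinner H (a n) (T f)))\<^sup>2)"
  proof (intro sum.cong refl)
    fix n f assume "n \<in> A" "f \<in> F"
    then have "f \<in> hcarrier H" "a n \<in> hcarrier H" using FH A(2) by auto
    then show "(cmod (\<beta> (a n) f))\<^sup>2 = (cmod (hinner H (a n) (T f)))\<^sup>2" using T(2) by simp
  qed
  also have "\<dots> = (\<Sum>f\<in>F. \<Sum>n\<in>A. (cmod (hinner H (a n) (T f)))\<^sup>2)" by (rule sum.swap)
  also have "\<dots> \<le> (\<Sum>f\<in>F. c * (hnorm H (T f))\<^sup>2)" 
  proof (rule sum_mono)
    fix f assume "f \<in> F"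
    then have "f \<in> hcarrier H" using FH by blast
    then show "(\<Sum>n\<in>A. (cmod (hinner H (a n) (T f)))\<^sup>2) \<le> c * (hnorm H (T f))\<^sup>2"
      by (intro A(3) T(1))
  qed
  also have "\<dots> \<le> c * t" using tr A(4) by (simp add: mult_left_mono flip: sum_distrib_left)
  finally show ?thesis .
qed

text \<open>
  Finiteness of the trace does not depend on the Parseval family: a finite orthonormal set is a Bessel
  family with constant 1.
\<close>

lemma trace_summable_orthonormal:
  fixes \<beta> :: "'a \<Rightarrow> 'a \<Rightarrow> complex"
  assumes \<beta>: "pre_hilbert \<lparr>hcarrier = hcarrier H, hinner = \<beta>\<rparr>"
    and bounded: "\<And>a. a \<in> hcarrier H \<Longrightarrow> Re (\<beta> a a) \<le> C * (hnorm H a)\<^sup>2"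
    and g: "parseval_family I g" "(\<lambda>i. Re (\<beta> (g i) (g i))) summable_on I"
    and E: "orthonormal E"
  shows "(\<lambda>e. Re (\<beta> e e)) summable_on E"
proof (rule nonneg_bdd_above_summable_on)
  have EH: "E \<subseteq> hcarrier H" using E by (simp add: orthonormal_def)
  show "0 \<le> Re (\<beta> e e)" if "e \<in> E" for e using pre_hilbert.inner_nonneg[OF \<beta>, of e] that EH by auto
  have "(\<Sum>e\<in>F. Re (\<beta> e e)) \<le> 1 * infsum (\<lambda>i. Re (\<beta> (g i) (g i))) I" if F: "F \<subseteq> E" "finite F" for F
  proof (rule trace_le_of_Bessel_family[OF \<beta> bounded g(1) has_sum_infsum[OF g(2)] F(2)])
    fix v assume v: "v \<in> hcarrier H"
    have "(\<Sum>e\<in>F. (cmod (hinner H e v))\<^sup>2) = (\<Sum>e\<in>F. (cmod (hinner H v e))\<^sup>2)"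
      using F EH v inner_cnj[OF v] by (intro sum.cong) (auto simp: subset_iff)
    then show "(\<Sum>e\<in>F. (cmod (hinner H e v))\<^sup>2) \<le> 1 * (hnorm H v)\<^sup>2"
      using Bessel[OF orthonormal_subset[OF E F(1)] F(2) v] by simp
  qed (use F EH in auto)
  then show "bdd_above (sum (\<lambda>e. Re (\<beta> e e)) ` {F. F \<subseteq> E \<and> finite F})"
    by (intro bdd_aboveI2) auto
qed

end

section \<open>Square integrable functions with values in a separable space\<close>

context hilbert
begin

text \<open>
  Finite combinations of \<open>S\<close> with coefficients in a countable dense set of complex numbers.  The number 1
  is added to the coefficients so that \<open>S\<close> itself is contained in \<open>C\<close>.
\<close>

lemma countable_dense_superset:
  assumes S: "countable S" "S \<subseteq> hcarrier H"
    and total: "\<And>a. a \<in> hcarrier H \<Longrightarrow> (\<And>e. e \<in> S \<Longrightarrow> hinner H a e = 0) \<Longrightarrow> hnorm H a = 0"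
  shows "\<exists>C. countable C \<and> C \<subseteq> hcarrier H \<and> S \<subseteq> C \<and>
    (\<forall>a\<in>hcarrier H. \<forall>\<epsilon>>0. \<exists>c\<in>C. hnorm H (a - c) < \<epsilon>)"
proof -
  obtain Q0 :: "complex set" where Q0: "countable Q0" "\<And>X. open X \<Longrightarrow> X \<noteq> {} \<Longrightarrow> \<exists>q\<in>Q0. q \<in> X"
    using countable_dense_exists by blast
  define Q where "Q = insert 1 Q0"
  define comb where "comb l = sum_list (map (\<lambda>(k, e). cscale k e) l)" for l :: "(complex \<times> 'a) list"
  define C where "C = comb ` lists (Q \<times> S)"
  have comb_in: "comb l \<in> hcarrier H" if "l \<in> lists (Q \<times> S)" for l
    using that S(2) by (induction l) (auto simp: comb_def)
  show ?thesis
  proof (intro exI[of _ C] conjI ballI allI impI)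
    show "countable C" unfolding C_def using S(1) Q0(1) by (auto simp: Q_def)
    show "C \<subseteq> hcarrier H" using comb_in by (auto simp: C_def)
    show "S \<subseteq> C"
    proof
      fix e assume "e \<in> S"
      then have "[(1, e)] \<in> lists (Q \<times> S)" by (simp add: Q_def)
      moreover have "comb [(1, e)] = e" by (simp add: comb_def cscale_one)
      ultimately show "e \<in> C" unfolding C_def by (metis imageI)
    qed
    fix a and \<epsilon> :: real assume a: "a \<in> hcarrier H" and e: "0 < \<epsilon>"
    have e2: "0 < \<epsilon> / 2" using e by simp
    obtain F c where F: "finite F" "F \<subseteq> S" and ap: "hnorm H (a - (\<Sum>e\<in>F. cscale (c e) e)) < \<epsilon> / 2"
      by (rule total_set_approx[OF S(2) total a e2])
    have FH: "F \<subseteq> hcarrier H" using F S by auto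
    define N where "N = 1 + (\<Sum>e\<in>F. hnorm H e)"
    have "(\<Sum>e\<in>F. hnorm H e) \<ge> 0" using FH by (intro sum_nonneg) auto
    then have N: "N > 0" by (simp add: N_def)
    define \<delta> where "\<delta> = \<epsilon> / (2 * N)"
    have d: "\<delta> > 0" using e N by (simp add: \<delta>_def)
    have "\<exists>q\<in>Q. cmod (c e - q) < \<delta>" for e
      using Q0(2)[of "ball (c e) \<delta>"] d by (auto simp: Q_def dist_norm)
    then obtain q where q: "\<And>e. q e \<in> Q" "\<And>e. cmod (c e - q e) < \<delta>" by metis
    have cF: "(\<Sum>e\<in>F. cscale (c e) e) \<in> hcarrier H" "(\<Sum>e\<in>F. cscale (q e) e) \<in> hcarrier H"
      using FH by (auto intro!: sum_in)
    have "hnorm H ((\<Sum>e\<in>F. cscale (c e) e) - (\<Sum>e\<in>F. cscale (q e) e)) = hnorm H (\<Sum>e\<in>F. cscale (c e - q e) e)"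
      by (simp add: cscale_diff_left sum_subtractf)
    also have "\<dots> \<le> (\<Sum>e\<in>F. hnorm H (cscale (c e - q e) e))" using FH by (intro hnorm_sum_le) auto
    also have "\<dots> \<le> (\<Sum>e\<in>F. \<delta> * hnorm H e)"
    proof (rule sum_mono)
      fix e assume "e \<in> F"
      then have "e \<in> hcarrier H" using FH by auto
      then show "hnorm H (cscale (c e - q e) e) \<le> \<delta> * hnorm H e"
        using q(2)[of e] by (simp add: mult_right_mono)
    qed
    also have "\<dots> \<le> \<delta> * N" using d by (simp add: N_def flip: sum_distrib_left)
    also have "\<dots> = \<epsilon> / 2" using N by (simp add: \<delta>_def)
    finally have "hnorm H (a - (\<Sum>e\<in>F. cscale (q e) e)) < \<epsilon>"
      using hnorm_triangle_diff[OF a cF] ap by simp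
    moreover have "(\<Sum>e\<in>F. cscale (q e) e) \<in> C"
    proof -
      obtain l where l: "distinct l" "set l = F" using finite_distinct_list[OF F(1)] by auto
      then have "(\<Sum>e\<in>F. cscale (q e) e) = comb (map (\<lambda>e. (q e, e)) l)"
        using sum_list_distinct_conv_sum_set[OF l(1), of "\<lambda>e. cscale (q e) e"] by (simp add: comb_def o_def)
      moreover have "map (\<lambda>e. (q e, e)) l \<in> lists (Q \<times> S)" using l F q(1) by auto
      ultimately show ?thesis by (simp add: C_def)
    qed
    ultimately show "\<exists>c\<in>C. hnorm H (a - c) < \<epsilon>" by blast
  qed
qed

end

locale separable_hilbert = hilbert +
  fixes d :: "nat \<Rightarrow> 'a"
  assumes parseval: "parseval_family UNIV d"
begin

lemma d_in [simp]: "d n \<in> hcarrier H"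
  using parseval by (simp add: parseval_family_def)

lemma parseval_sums: "a \<in> hcarrier H \<Longrightarrow> (\<lambda>n. (cmod (hinner H a (d n)))\<^sup>2) sums (hnorm H a)\<^sup>2"
  by (rule has_sum_imp_sums) (use parseval in \<open>simp add: parseval_family_def\<close>)

lemma countable_denseuence:
  "\<exists>C. countable C \<and> C \<subseteq> hcarrier H \<and> range d \<subseteq> C \<and>
    (\<forall>a\<in>hcarrier H. \<forall>\<epsilon>>0. \<exists>c\<in>C. hnorm H (a - c) < \<epsilon>)"
proof -
  have "hnorm H a = 0" if a: "a \<in> hcarrier H" "\<And>e. e \<in> range d \<Longrightarrow> hinner H a e = 0" for a
  proof -
    have "(\<lambda>n::nat. 0) sums (hnorm H a)\<^sup>2" using parseval_sums[OF a(1)] a(2) by simp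
    then show ?thesis using sums_unique2[OF _ sums_zero] by fastforce
  qed
  then show ?thesis by (intro countable_dense_superset) auto
qed

lemma space_hborel [simp]: "space (hborel H) = hcarrier H"
  unfolding hborel_def by (rule space_measure_of) auto

lemma sets_hborelI:
  assumes "U \<subseteq> hcarrier H" "\<And>a. a \<in> U \<Longrightarrow> \<exists>r>0. \<forall>b\<in>hcarrier H. hnorm H (b - a) < r \<longrightarrow> b \<in> U"
  shows "U \<in> sets (hborel H)"
proof -
  let ?\<O> = "{U. U \<subseteq> hcarrier H \<and> (\<forall>a\<in>U. \<exists>r>0. \<forall>b\<in>hcarrier H. hnorm H (b - a) < r \<longrightarrow> b \<in> U)}"
  have "?\<O> \<subseteq> Pow (hcarrier H)" by blast
  moreover have "U \<in> sigma_sets (hcarrier H) ?\<O>"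
    by (rule sigma_sets.Basic, rule CollectI) (use assms in blast)
  ultimately show ?thesis unfolding hborel_def by simp
qed

text \<open>
  Pettis' theorem: the distance to a fixed vector is a countable sum of squares of coordinates, hence
  measurable, and every open set is a countable union of balls with centres in a countable dense set.
\<close>

lemma measurable_hborel_iff:
  "f \<in> measurable M (hborel H) \<longleftrightarrow> (\<forall>x\<in>space M. f x \<in> hcarrier H) \<and>
     (\<forall>n. (\<lambda>x. hinner H (f x) (d n)) \<in> borel_measurable M)"
proof (intro iffI conjI allI ballI; (elim conjE)?)
  assume f: "f \<in> measurable M (hborel H)"
  show "f x \<in> hcarrier H" if "x \<in> space M" for x using measurable_space[OF f that] by simp
  fix n
  have "(\<lambda>a. hinner H a (d n)) \<in> borel_measurable (hborel H)"
  proof (rule borel_measurableI)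
    fix S :: "complex set" assume S: "open S"
    show "(\<lambda>a. hinner H a (d n)) -` S \<inter> space (hborel H) \<in> sets (hborel H)"
    proof (rule sets_hborelI)
      fix a assume a: "a \<in> (\<lambda>a. hinner H a (d n)) -` S \<inter> space (hborel H)"
      then obtain r where r: "r > 0" "\<And>z. dist z (hinner H a (d n)) < r \<Longrightarrow> z \<in> S"
        using S unfolding open_dist by auto
      define r' where "r' = r / (hnorm H (d n) + 1)"
      have n0: "hnorm H (d n) + 1 > 0" by (simp add: add_nonneg_pos)
      have "hinner H b (d n) \<in> S" if b: "b \<in> hcarrier H" "hnorm H (b - a) < r'" for b
      proof (rule r(2))
        have aH: "a \<in> hcarrier H" using a by simp
        have "dist (hinner H b (d n)) (hinner H a (d n)) = cmod (hinner H (b - a) (d n))"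
          using aH b by (simp add: dist_norm inner_diff_left)
        also have "\<dots> \<le> hnorm H (b - a) * hnorm H (d n)" using Cauchy_Schwarz aH b by simp
        also have "\<dots> \<le> hnorm H (b - a) * (hnorm H (d n) + 1)" using aH b by (simp add: mult_left_mono)
        also have "\<dots> < r' * (hnorm H (d n) + 1)" using b n0 by (simp add: mult_strict_right_mono)
        also have "\<dots> = r" using n0 by (simp add: r'_def)
        finally show "dist (hinner H b (d n)) (hinner H a (d n)) < r" .
      qed
      moreover have "r' > 0" using r n0 by (simp add: r'_def)
      ultimately show "\<exists>r>0. \<forall>b\<in>hcarrier H. hnorm H (b - a) < r \<longrightarrow>
          b \<in> (\<lambda>a. hinner H a (d n)) -` S \<inter> space (hborel H)" by auto
    qed auto
  qed
  with f show "(\<lambda>x. hinner H (f x) (d n)) \<in> borel_measurable M" by (rule measurable_compose)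
next
  assume fH: "\<forall>x\<in>space M. f x \<in> hcarrier H"
    and m: "\<forall>n. (\<lambda>x. hinner H (f x) (d n)) \<in> borel_measurable M"
  have nm: "(\<lambda>x. hnorm H (f x - c)) \<in> borel_measurable M" if c: "c \<in> hcarrier H" for c
  proof -
    have [measurable]: "(\<lambda>x. hinner H (f x) (d n)) \<in> borel_measurable M" for n using m by blast
    have "(\<lambda>x. sqrt (\<Sum>n. (cmod (hinner H (f x) (d n) - hinner H c (d n)))\<^sup>2)) \<in> borel_measurable M"
      by measurable
    also have "?this \<longleftrightarrow> (\<lambda>x. hnorm H (f x - c)) \<in> borel_measurable M"
    proof (rule measurable_cong)
      fix x assume "x \<in> space M"
      then have x: "f x \<in> hcarrier H" using fH by auto
      have "(\<Sum>n. (cmod (hinner H (f x) (d n) - hinner H c (d n)))\<^sup>2) = (hnorm H (f x - c))\<^sup>2"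
        using parseval_sums[of "f x - c"] x c by (simp add: inner_diff_left sums_iff)
      then show "sqrt (\<Sum>n. (cmod (hinner H (f x) (d n) - hinner H c (d n)))\<^sup>2) = hnorm H (f x - c)"
        using x c by simp
    qed
    finally show ?thesis .
  qed
  obtain C where C: "countable C" "C \<subseteq> hcarrier H"
    "\<And>a \<epsilon>. a \<in> hcarrier H \<Longrightarrow> 0 < \<epsilon> \<Longrightarrow> \<exists>c\<in>C. hnorm H (a - c) < \<epsilon>" using countable_denseuence by metis
  show "f \<in> measurable M (hborel H)"
    unfolding hborel_def
  proof (rule measurable_measure_of)
    fix U assume U: "U \<in> {U. U \<subseteq> hcarrier H \<and> (\<forall>a\<in>U. \<exists>r>0. \<forall>b\<in>hcarrier H. hnorm H (b - a) < r \<longrightarrow> b \<in> U)}"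
    define I where "I = {(c, q). c \<in> C \<and> q \<in> \<rat> \<and> (\<forall>b\<in>hcarrier H. hnorm H (b - c) < q \<longrightarrow> b \<in> U)}"
    have "I \<subseteq> C \<times> \<rat>" by (auto simp: I_def)
    then have I: "countable I" using C(1) countable_rat by (meson countable_SIGMA countable_subset)
    have "f -` U \<inter> space M = (\<Union>(c, q)\<in>I. {x\<in>space M. hnorm H (f x - c) < q})"
    proof (intro equalityI subsetI)
      fix x assume x: "x \<in> f -` U \<inter> space M"
      then obtain r where r: "r > 0" "\<And>b. b \<in> hcarrier H \<Longrightarrow> hnorm H (b - f x) < r \<Longrightarrow> b \<in> U"
        using U by auto
      obtain q where q: "q \<in> \<rat>" "0 < q" "q < r / 2" using Rats_dense_in_real[of 0 "r / 2"] r by auto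
      have fx: "f x \<in> hcarrier H" using x fH by auto
      obtain c where c: "c \<in> C" "hnorm H (f x - c) < q" using C(3)[OF fx q(2)] by auto
      have cH: "c \<in> hcarrier H" using c C by auto
      have "b \<in> U" if "b \<in> hcarrier H" "hnorm H (b - c) < q" for b
        using r(2)[OF that(1)] hnorm_triangle_diff[OF that(1) cH fx] that(2) c(2) q(3)
          hnorm_minus_commute[OF cH fx] by simp
      then have "(c, q) \<in> I" using c q by (auto simp: I_def)
      then show "x \<in> (\<Union>(c, q)\<in>I. {x\<in>space M. hnorm H (f x - c) < q})" using c x by auto
    next
      fix x assume "x \<in> (\<Union>(c, q)\<in>I. {x\<in>space M. hnorm H (f x - c) < q})"
      then show "x \<in> f -` U \<inter> space M" using fH by (auto simp: I_def)
    qed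
    also have "\<dots> \<in> sets M"
    proof (rule sets.countable_UN''[OF I])
      fix i assume "i \<in> I"
      then obtain c q where cq: "i = (c, q)" "c \<in> hcarrier H" using C(2) by (auto simp: I_def)
      have [measurable]: "(\<lambda>x. hnorm H (f x - c)) \<in> borel_measurable M" using nm[OF cq(2)] .
      show "(case i of (c, q) \<Rightarrow> {x\<in>space M. hnorm H (f x - c) < q}) \<in> sets M" by (simp add: cq(1))
    qed
    finally show "f -` U \<inter> space M \<in> sets M" .
  qed (use fH in auto)
qed

lemma measurable_hborel_in: "f \<in> measurable M (hborel H) \<Longrightarrow> x \<in> space M \<Longrightarrow> f x \<in> hcarrier H"
  by (simp add: measurable_hborel_iff)

lemma measurable_hinner_d: "f \<in> measurable M (hborel H) \<Longrightarrow> (\<lambda>x. hinner H (f x) (d n)) \<in> borel_measurable M"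
  by (simp add: measurable_hborel_iff)

lemma measurable_hborelI:
  assumes "\<And>x. x \<in> space M \<Longrightarrow> f x \<in> hcarrier H" "\<And>n. (\<lambda>x. hinner H (f x) (d n)) \<in> borel_measurable M"
  shows "f \<in> measurable M (hborel H)"
  by (rule iffD2[OF measurable_hborel_iff]) (intro conjI ballI allI assms)

lemma measurable_hborel_add:
  assumes f: "f \<in> measurable M (hborel H)" and g: "g \<in> measurable M (hborel H)"
  shows "(\<lambda>x. f x + g x) \<in> measurable M (hborel H)"
proof (rule measurable_hborelI)
  note fg = measurable_hborel_in[OF f] measurable_hborel_in[OF g]
  show "f x + g x \<in> hcarrier H" if "x \<in> space M" for x using fg[OF that] by (rule add_in)
  fix n
  have "(\<lambda>x. hinner H (f x) (d n) + hinner H (g x) (d n)) \<in> borel_measurable M"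
    by (intro borel_measurable_add measurable_hinner_d f g)
  also have "?this \<longleftrightarrow> (\<lambda>x. hinner H (f x + g x) (d n)) \<in> borel_measurable M"
    by (rule measurable_cong) (simp add: inner_add_left fg)
  finally show "(\<lambda>x. hinner H (f x + g x) (d n)) \<in> borel_measurable M" .
qed

lemma measurable_hborel_scale:
  assumes k: "k \<in> borel_measurable M" and f: "f \<in> measurable M (hborel H)"
  shows "(\<lambda>x. cscale (k x) (f x)) \<in> measurable M (hborel H)"
proof (rule measurable_hborelI)
  note fH = measurable_hborel_in[OF f]
  show "cscale (k x) (f x) \<in> hcarrier H" if "x \<in> space M" for x using fH[OF that] by (rule scale_in)
  fix n
  have "(\<lambda>x. k x * hinner H (f x) (d n)) \<in> borel_measurable M"
    by (intro borel_measurable_times measurable_hinner_d f k)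
  also have "?this \<longleftrightarrow> (\<lambda>x. hinner H (cscale (k x) (f x)) (d n)) \<in> borel_measurable M"
    by (rule measurable_cong) (simp add: inner_scale_left fH)
  finally show "(\<lambda>x. hinner H (cscale (k x) (f x)) (d n)) \<in> borel_measurable M" .
qed

lemma measurable_hnorm:
  assumes "f \<in> measurable M (hborel H)"
  shows "(\<lambda>x. hnorm H (f x)) \<in> borel_measurable M"
proof -
  have [measurable]: "(\<lambda>x. hinner H (f x) (d n)) \<in> borel_measurable M" for n
    by (rule measurable_hinner_d[OF assms])
  have "(\<lambda>x. sqrt (\<Sum>n. (cmod (hinner H (f x) (d n)))\<^sup>2)) \<in> borel_measurable M"
    by measurable
  also have "?this \<longleftrightarrow> (\<lambda>x. hnorm H (f x)) \<in> borel_measurable M"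
  proof (rule measurable_cong)
    fix x assume "x \<in> space M"
    with assms have x: "f x \<in> hcarrier H" by (rule measurable_hborel_in)
    show "sqrt (\<Sum>n. (cmod (hinner H (f x) (d n)))\<^sup>2) = hnorm H (f x)"
      using sums_unique[OF parseval_sums[OF x], symmetric] x by simp
  qed
  finally show ?thesis .
qed

text \<open>
  Polarization reduces the inner product to norms of sums.
\<close>

lemma measurable_hinner:
  assumes f: "f \<in> measurable M (hborel H)" and g: "g \<in> measurable M (hborel H)"
  shows "(\<lambda>x. hinner H (f x) (g x)) \<in> borel_measurable M"
proof -
  have re: "(\<lambda>x. Re (hinner H (f x) (h x))) \<in> borel_measurable M" if h: "h \<in> measurable M (hborel H)" for h
  proof -
    have "(\<lambda>x. ((hnorm H (f x + h x))\<^sup>2 - (hnorm H (f x))\<^sup>2 - (hnorm H (h x))\<^sup>2) / 2) \<in> borel_measurable M"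
      by (intro borel_measurable_divide borel_measurable_diff borel_measurable_power borel_measurable_const
          measurable_hnorm measurable_hborel_add f h)
    also have "?this \<longleftrightarrow> (\<lambda>x. Re (hinner H (f x) (h x))) \<in> borel_measurable M"
      by (rule measurable_cong) (simp add: hnorm_add_sq measurable_hborel_in[OF f] measurable_hborel_in[OF h])
    finally show ?thesis .
  qed
  have "(\<lambda>x. cscale \<i> (g x)) \<in> measurable M (hborel H)"
    by (rule measurable_hborel_scale[OF _ g]) simp
  from re[OF this] have "(\<lambda>x. Re (hinner H (f x) (cscale \<i> (g x)))) \<in> borel_measurable M" .
  also have "?this \<longleftrightarrow> (\<lambda>x. Im (hinner H (f x) (g x))) \<in> borel_measurable M"
    by (rule measurable_cong)
      (simp add: inner_scale_right measurable_hborel_in[OF f] measurable_hborel_in[OF g])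
  finally have "(\<lambda>x. Im (hinner H (f x) (g x))) \<in> borel_measurable M" .
  then show ?thesis using re[OF g] by (simp add: borel_measurable_complex_iff)
qed

end

lemma AE_zero_of_integral_sq_zero:
  fixes f :: "'a \<Rightarrow> real"
  assumes "integrable M (\<lambda>x. (f x)\<^sup>2)" "(LINT x|M. (f x)\<^sup>2) = 0"
  shows "AE x in M. f x = 0"
  using integral_nonneg_eq_0_iff_AE[OF assms(1)] assms(2) by simp

context separable_hilbert
begin

lemma L2_vec_carrier: "f \<in> hcarrier (L2_vec M H) \<longleftrightarrow>
    f \<in> measurable M (hborel H) \<and> integrable M (\<lambda>x. (hnorm H (f x))\<^sup>2)"
  by (simp add: L2_vec_def)

lemma L2_vec_integrable_hinner:
  assumes f: "f \<in> hcarrier (L2_vec M H)" and g: "g \<in> hcarrier (L2_vec M H)"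
  shows "integrable M (\<lambda>x. hinner H (f x) (g x))"
proof (rule Bochner_Integration.integrable_bound)
  have fm: "f \<in> measurable M (hborel H)" and gm: "g \<in> measurable M (hborel H)"
    using f g by (simp_all add: L2_vec_carrier)
  show "integrable M (\<lambda>x. (hnorm H (f x))\<^sup>2 + (hnorm H (g x))\<^sup>2)"
    using f g by (simp add: L2_vec_carrier)
  show "(\<lambda>x. hinner H (f x) (g x)) \<in> borel_measurable M" using fm gm by (rule measurable_hinner)
  show "AE x in M. norm (hinner H (f x) (g x)) \<le> norm ((hnorm H (f x))\<^sup>2 + (hnorm H (g x))\<^sup>2)"
  proof (rule AE_I2)
    fix x assume "x \<in> space M"
    then have x: "f x \<in> hcarrier H" "g x \<in> hcarrier H"
      using measurable_hborel_in[OF fm] measurable_hborel_in[OF gm] by auto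
    have "cmod (hinner H (f x) (g x)) \<le> hnorm H (f x) * hnorm H (g x)"
      using x by (rule Cauchy_Schwarz)
    also have "\<dots> \<le> (hnorm H (f x))\<^sup>2 + (hnorm H (g x))\<^sup>2"
      using sum_squares_bound[of "hnorm H (f x)" "hnorm H (g x)"]
        mult_nonneg_nonneg[OF hnorm_nonneg[OF x(1)] hnorm_nonneg[OF x(2)]] by linarith
    finally show "norm (hinner H (f x) (g x)) \<le> norm ((hnorm H (f x))\<^sup>2 + (hnorm H (g x))\<^sup>2)" by simp
  qed
qed

text \<open>
  The sum of two measurable functions is measurable because \<open>H\<close> is separable; the parallelogram law
  bounds its norm.
\<close>

lemma L2_vec_add:
  assumes f: "f \<in> hcarrier (L2_vec M H)" and g: "g \<in> hcarrier (L2_vec M H)"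
  shows "f + g \<in> hcarrier (L2_vec M H)"
  unfolding L2_vec_carrier
proof
  have fm: "f \<in> measurable M (hborel H)" and gm: "g \<in> measurable M (hborel H)"
    using f g by (simp_all add: L2_vec_carrier)
  show m: "f + g \<in> measurable M (hborel H)"
    using measurable_hborel_add[OF fm gm] by (simp add: plus_fun_def)
  show "integrable M (\<lambda>x. (hnorm H ((f + g) x))\<^sup>2)"
  proof (rule Bochner_Integration.integrable_bound)
    show "integrable M (\<lambda>x. 2 * (hnorm H (f x))\<^sup>2 + 2 * (hnorm H (g x))\<^sup>2)"
      using f g by (simp add: L2_vec_carrier)
    show "(\<lambda>x. (hnorm H ((f + g) x))\<^sup>2) \<in> borel_measurable M"
      using measurable_hnorm[OF m] by measurable
    show "AE x in M. norm ((hnorm H ((f + g) x))\<^sup>2) \<le> norm (2 * (hnorm H (f x))\<^sup>2 + 2 * (hnorm H (g x))\<^sup>2)"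
    proof (rule AE_I2)
      fix x assume "x \<in> space M"
      then have x: "f x \<in> hcarrier H" "g x \<in> hcarrier H"
        using measurable_hborel_in[OF fm] measurable_hborel_in[OF gm] by auto
      have "(hnorm H (f x + g x))\<^sup>2 + (hnorm H (f x - g x))\<^sup>2 = 2 * (hnorm H (f x))\<^sup>2 + 2 * (hnorm H (g x))\<^sup>2"
        using x by (simp add: hnorm_add_sq hnorm_diff_sq)
      then have "(hnorm H (f x + g x))\<^sup>2 \<le> 2 * (hnorm H (f x))\<^sup>2 + 2 * (hnorm H (g x))\<^sup>2"
        using zero_le_power2[of "hnorm H (f x - g x)"] by linarith
      then show "norm ((hnorm H ((f + g) x))\<^sup>2) \<le> norm (2 * (hnorm H (f x))\<^sup>2 + 2 * (hnorm H (g x))\<^sup>2)"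
        by simp
    qed
  qed
qed

lemma L2_vec_scale:
  assumes f: "f \<in> hcarrier (L2_vec M H)"
  shows "cscale k f \<in> hcarrier (L2_vec M H)"
  unfolding L2_vec_carrier
proof
  have fm: "f \<in> measurable M (hborel H)" using f by (simp add: L2_vec_carrier)
  show "cscale k f \<in> measurable M (hborel H)"
    using measurable_hborel_scale[of "\<lambda>_. k", OF _ fm] by (simp add: cscale_fun_def)
  have "integrable M (\<lambda>x. (cmod k)\<^sup>2 * (hnorm H (f x))\<^sup>2)" using f by (simp add: L2_vec_carrier)
  also have "?this \<longleftrightarrow> integrable M (\<lambda>x. (hnorm H (cscale k f x))\<^sup>2)"
    using measurable_hborel_in[OF fm]
    by (intro Bochner_Integration.integrable_cong) (auto simp: cscale_fun_def power_mult_distrib)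
  finally show "integrable M (\<lambda>x. (hnorm H (cscale k f x))\<^sup>2)" .
qed

lemma L2_vec_pre_hilbert: "pre_hilbert (L2_vec M H)"
proof (rule pre_hilbert.intro)
  have zero: "0 \<in> hcarrier (L2_vec M H)"
    by (simp add: L2_vec_carrier zero_fun_def measurable_const)
  show "linear_subset (hcarrier (L2_vec M H))"
    using L2_vec_add L2_vec_scale zero unfolding linear_subset_def by blast
  have L2in: "f x \<in> hcarrier H" if "f \<in> hcarrier (L2_vec M H)" "x \<in> space M" for f x
    using that measurable_hborel_in by (auto simp: L2_vec_carrier)
  have inner: "hinner (L2_vec M H) f g = (LINT x|M. hinner H (f x) (g x))" for f g
    by (simp add: L2_vec_def)
  fix f g h k
  assume f: "f \<in> hcarrier (L2_vec M H)"
  {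
    assume h: "h \<in> hcarrier (L2_vec M H)"
    have "(LINT x|M. hinner H (cscale k f x) (h x)) = (LINT x|M. k * hinner H (f x) (h x))"
      using L2in[OF f] L2in[OF h]
      by (intro Bochner_Integration.integral_cong) (auto simp: cscale_fun_def inner_scale_left)
    then show "hinner (L2_vec M H) (cscale k f) h = k * hinner (L2_vec M H) f h"
      unfolding inner by simp
  next
    assume g: "g \<in> hcarrier (L2_vec M H)" and h: "h \<in> hcarrier (L2_vec M H)"
    have "(LINT x|M. hinner H ((f + g) x) (h x)) = (LINT x|M. hinner H (f x) (h x) + hinner H (g x) (h x))"
      using L2in[OF f] L2in[OF g] L2in[OF h]
      by (intro Bochner_Integration.integral_cong) (auto simp: inner_add_left)
    then show "hinner (L2_vec M H) (f + g) h = hinner (L2_vec M H) f h + hinner (L2_vec M H) g h"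
      unfolding inner using L2_vec_integrable_hinner[OF f h] L2_vec_integrable_hinner[OF g h] by simp
  next
    assume g: "g \<in> hcarrier (L2_vec M H)"
    have "(LINT x|M. hinner H (g x) (f x)) = (LINT x|M. cnj (hinner H (f x) (g x)))"
      by (intro Bochner_Integration.integral_cong refl inner_cnj L2in[OF f] L2in[OF g])
    then show "hinner (L2_vec M H) g f = cnj (hinner (L2_vec M H) f g)"
      unfolding inner by simp
  next
    have "(LINT x|M. hinner H (f x) (f x)) = (LINT x|M. complex_of_real ((hnorm H (f x))\<^sup>2))"
      by (intro Bochner_Integration.integral_cong refl inner_self L2in[OF f])
    then show "0 \<le> Re (hinner (L2_vec M H) f f)" unfolding inner by (simp del: of_real_power)
  }
qed

lemma L2_vec_in: "f \<in> hcarrier (L2_vec M H) \<Longrightarrow> x \<in> space M \<Longrightarrow> f x \<in> hcarrier H"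
  using measurable_hborel_in by (auto simp: L2_vec_carrier)

lemma L2_vec_hnorm_sq:
  assumes f: "f \<in> hcarrier (L2_vec M H)"
  shows "(hnorm (L2_vec M H) f)\<^sup>2 = (LINT x|M. (hnorm H (f x))\<^sup>2)"
proof -
  have "hinner (L2_vec M H) f f = (LINT x|M. hinner H (f x) (f x))" by (simp add: L2_vec_def)
  also have "\<dots> = (LINT x|M. complex_of_real ((hnorm H (f x))\<^sup>2))"
    by (intro Bochner_Integration.integral_cong refl inner_self L2_vec_in[OF f])
  also have "\<dots> = complex_of_real (LINT x|M. (hnorm H (f x))\<^sup>2)" by (rule integral_complex_of_real)
  finally show ?thesis by (simp add: hnorm_def[of "L2_vec M H"])
qed

lemma L2_vec_heq_AE:
  assumes f: "f \<in> hcarrier (L2_vec M H)" and g: "g \<in> hcarrier (L2_vec M H)"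
    and eq: "heq (L2_vec M H) f g"
  shows "AE x in M. heq H (f x) (g x)"
proof -
  interpret L: pre_hilbert "L2_vec M H" by (rule L2_vec_pre_hilbert)
  have fg: "f - g \<in> hcarrier (L2_vec M H)" using f g by simp
  have "(LINT x|M. (hnorm H ((f - g) x))\<^sup>2) = 0"
    using eq L2_vec_hnorm_sq[OF fg] by (simp add: heq_def)
  with fg have "AE x in M. hnorm H ((f - g) x) = 0"
    by (intro AE_zero_of_integral_sq_zero) (auto simp: L2_vec_carrier)
  then show ?thesis by (simp add: heq_def)
qed

end

subsection \<open>Scalar functions\<close>

lemma hinner_complex: "hinner complex_hspace z w = z * cnj w"
  by (simp add: complex_hspace_def)

lemma hcarrier_complex: "hcarrier complex_hspace = UNIV"
  by (simp add: complex_hspace_def)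

lemma hnorm_complex: "hnorm complex_hspace z = cmod z"
  unfolding hnorm_def hinner_complex complex_norm_square[symmetric] by simp

lemma complex_separable_hilbert: "separable_hilbert complex_hspace (\<lambda>n. if n = 0 then 1 else 0)"
proof -
  interpret pre_hilbert complex_hspace
    by standard (auto simp: hinner_complex hcarrier_complex linear_subset_def cscale_complex_def algebra_simps)
  have par: "parseval_family UNIV (\<lambda>n::nat. if n = 0 then 1 else 0)"
    unfolding parseval_family_def
  proof (intro conjI ballI)
    fix a :: complex
    have "((\<lambda>i::nat. (cmod (hinner complex_hspace a (if i = 0 then 1 else 0)))\<^sup>2) has_sum
        (\<Sum>i\<in>{0::nat}. (cmod (hinner complex_hspace a (if i = 0 then 1 else 0)))\<^sup>2)) {0}"
      by (rule has_sum_finite) simp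
    also have "?this \<longleftrightarrow> ((\<lambda>i::nat. (cmod (hinner complex_hspace a (if i = 0 then 1 else 0)))\<^sup>2) has_sum
        (\<Sum>i\<in>{0::nat}. (cmod (hinner complex_hspace a (if i = 0 then 1 else 0)))\<^sup>2)) UNIV"
      by (rule has_sum_cong_neutral) (auto simp: hinner_complex)
    finally show "((\<lambda>i::nat. (cmod (hinner complex_hspace a (if i = 0 then 1 else 0)))\<^sup>2) has_sum
        (hnorm complex_hspace a)\<^sup>2) UNIV"
      by (simp add: hinner_complex hnorm_complex)
  qed (simp add: hcarrier_complex)
  have "hilbert_axioms complex_hspace"
  proof
    fix s :: "nat \<Rightarrow> complex"
    assume c: "\<And>\<epsilon>. 0 < \<epsilon> \<Longrightarrow> \<exists>N. \<forall>m\<ge>N. \<forall>n\<ge>N. hnorm complex_hspace (s m - s n) < \<epsilon>"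
    then have "Cauchy s" by (simp add: Cauchy_def dist_norm hnorm_complex)
    then obtain l where "s \<longlonglongrightarrow> l" using Cauchy_convergent convergentD by blast
    then have "(\<lambda>n. cmod (s n - l)) \<longlonglongrightarrow> 0" by (simp add: LIM_zero_iff tendsto_norm_zero_iff)
    then show "\<exists>l\<in>hcarrier complex_hspace. (\<lambda>n. hnorm complex_hspace (s n - l)) \<longlonglongrightarrow> 0"
      by (auto simp: hcarrier_complex hnorm_complex)
  qed
  then show ?thesis
    using par pre_hilbert_axioms
    by (intro separable_hilbert.intro hilbert.intro separable_hilbert_axioms.intro)
qed

interpretation scalar: separable_hilbert complex_hspace "\<lambda>n. if n = 0 then 1 else 0"
  by (rule complex_separable_hilbert)

lemma L2_carrier: "f \<in> hcarrier (L2 M) \<longleftrightarrow> f \<in> borel_measurable M \<and> integrable M (\<lambda>x. (cmod (f x))\<^sup>2)"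
proof -
  have "f \<in> measurable M (hborel complex_hspace) \<longleftrightarrow> f \<in> borel_measurable M"
  proof
    assume "f \<in> measurable M (hborel complex_hspace)"
    then have "\<forall>n::nat. (\<lambda>x. hinner complex_hspace (f x) (if n = 0 then 1 else 0)) \<in> borel_measurable M"
      unfolding scalar.measurable_hborel_iff by blast
    from spec[OF this, of 0] show "f \<in> borel_measurable M" by (simp add: hinner_complex)
  next
    assume "f \<in> borel_measurable M"
    then show "f \<in> measurable M (hborel complex_hspace)"
      unfolding scalar.measurable_hborel_iff by (auto simp: hcarrier_complex hinner_complex)
  qed
  then show ?thesis by (simp add: L2_vec_def hnorm_complex)
qed

lemma L2_hnorm: "f \<in> hcarrier (L2 M) \<Longrightarrow> (hnorm (L2 M) f)\<^sup>2 = (LINT x|M. (cmod (f x))\<^sup>2)"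
  using scalar.L2_vec_hnorm_sq by (simp add: hnorm_complex)

lemma L2_hinner: "hinner (L2 M) f g = (LINT x|M. f x * cnj (g x))"
  by (simp add: L2_vec_def hinner_complex)

lemma L2_nn_integral:
  assumes "f \<in> borel_measurable M"
  shows "f \<in> hcarrier (L2 M) \<longleftrightarrow> (\<integral>\<^sup>+x. ennreal ((cmod (f x))\<^sup>2) \<partial>M) < \<infinity>"
  using assms by (simp add: L2_carrier integrable_iff_bounded)

lemma L2_hnorm_nn:
  assumes "f \<in> hcarrier (L2 M)"
  shows "(\<integral>\<^sup>+x. ennreal ((cmod (f x))\<^sup>2) \<partial>M) = ennreal ((hnorm (L2 M) f)\<^sup>2)"
  using assms by (subst nn_integral_eq_integral) (auto simp: L2_carrier L2_hnorm)

text \<open>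
  From \<open>|\<delta>| \<le> 2\<^sup>-\<^sup>k + 2\<^sup>k |\<delta>|\<^sup>2\<close>, which follows from the inequality of the means, the increments \<open>\<delta>\<^sub>k\<close> are
  absolutely summable wherever \<open>\<Sum>\<^sub>k 2\<^sup>k |\<delta>\<^sub>k|\<^sup>2\<close> is finite; and the integral of this sum is at most
  \<open>\<Sum>\<^sub>k 2\<^sup>k 4\<^sup>-\<^sup>k\<close>.
\<close>

lemma L2_fast_Cauchy_AE_convergent:
  assumes t: "\<And>n. t n \<in> hcarrier (L2 M)"
    and fast: "\<And>k. (hnorm (L2 M) (t (Suc k) - t k))\<^sup>2 \<le> (1/4) ^ k"
  shows "AE x in M. convergent (\<lambda>k. t k x)"
proof -
  interpret L: pre_hilbert "L2 M" by (rule scalar.L2_vec_pre_hilbert)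
  have [measurable]: "t n \<in> borel_measurable M" for n using t by (simp add: L2_carrier)
  define \<delta> where "\<delta> k x = (cmod (t (Suc k) x - t k x))\<^sup>2" for k x
  have dm[measurable]: "\<delta> k \<in> borel_measurable M" for k unfolding \<delta>_def by measurable
  have int: "(\<integral>\<^sup>+x. ennreal (2 ^ k * \<delta> k x) \<partial>M) \<le> ennreal ((1/2) ^ k)" for k
  proof -
    have "(\<integral>\<^sup>+x. ennreal (2 ^ k * \<delta> k x) \<partial>M) = ennreal (2 ^ k) * (\<integral>\<^sup>+x. ennreal (\<delta> k x) \<partial>M)"
      by (subst nn_integral_cmult[symmetric]) (auto simp: ennreal_mult' \<delta>_def)
    also have "(\<integral>\<^sup>+x. ennreal (\<delta> k x) \<partial>M) = ennreal ((hnorm (L2 M) (t (Suc k) - t k))\<^sup>2)"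
      using L2_hnorm_nn[of "t (Suc k) - t k" M] t by (simp add: \<delta>_def)
    also have "ennreal (2 ^ k) * \<dots> \<le> ennreal (2 ^ k) * ennreal ((1/4) ^ k)"
      using fast[of k] by (intro mult_left_mono ennreal_leI) auto
    also have "\<dots> = ennreal (2 ^ k * (1/4) ^ k)" by (rule ennreal_mult[symmetric]) auto
    also have "2 ^ k * (1/4::real) ^ k = (1/2) ^ k" by (simp flip: power_mult_distrib)
    finally show ?thesis .
  qed
  have "(\<integral>\<^sup>+x. (\<Sum>k. ennreal (2 ^ k * \<delta> k x)) \<partial>M) = (\<Sum>k. \<integral>\<^sup>+x. ennreal (2 ^ k * \<delta> k x) \<partial>M)"
    by (rule nn_integral_suminf) measurable
  also have "\<dots> \<le> (\<Sum>k. ennreal ((1/2) ^ k))" using int by (intro suminf_le) auto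
  also have "\<dots> = ennreal (\<Sum>k. (1/2) ^ k)" by (rule suminf_ennreal2) (auto intro: summable_geometric)
  also have "\<dots> < \<infinity>" by simp
  finally have "AE x in M. (\<Sum>k. ennreal (2 ^ k * \<delta> k x)) \<noteq> \<infinity>"
    by (intro nn_integral_noteq_infinite) auto
  then show ?thesis
  proof eventually_elim
    case (elim x)
    then have "summable (\<lambda>k. 2 ^ k * \<delta> k x)"
      by (intro summable_suminf_not_top) (auto simp: \<delta>_def)
    then have "summable (\<lambda>k. (1/2) ^ k + 2 ^ k * \<delta> k x)"
      by (intro summable_add summable_geometric) auto
    moreover have "cmod (t (Suc k) x - t k x) \<le> (1/2) ^ k + 2 ^ k * \<delta> k x" for k
    proof -
      define c where "c = cmod (t (Suc k) x - t k x)"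
      have "0 \<le> (1/2) ^ k * (1 - 2 ^ k * c)\<^sup>2" by simp
      also have "\<dots> = (1/2) ^ k * (1 - 2 * (2 ^ k * c) + 2 ^ k * 2 ^ k * c\<^sup>2)"
        by (simp add: power2_eq_square algebra_simps)
      also have "\<dots> = (1/2) ^ k - 2 * c * ((1/2) ^ k * 2 ^ k) + ((1/2) ^ k * 2 ^ k) * 2 ^ k * c\<^sup>2"
        by (simp add: algebra_simps)
      also have "(1/2::real) ^ k * 2 ^ k = 1" by (simp flip: power_mult_distrib)
      finally have "2 * c \<le> (1/2) ^ k + 2 ^ k * c\<^sup>2" by simp
      then show ?thesis unfolding \<delta>_def c_def[symmetric] using norm_ge_zero[of "t (Suc k) x - t k x"]
        unfolding c_def[symmetric] by linarith
    qed
    ultimately have "summable (\<lambda>k. t (Suc k) x - t k x)"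
      by (rule summable_comparison_test'[of _ 0])
    then have "convergent (\<lambda>n. t n x - t 0 x)"
      by (simp add: summable_iff_convergent sum_lessThan_telescope[of "\<lambda>n. t n x"])
    then show ?case using convergent_diff_const_right_iff by blast
  qed
qed

text \<open>
  The Riesz-Fischer theorem: a fast subsequence converges almost everywhere, and by Fatou's lemma its
  pointwise limit is the limit in square mean of the whole sequence.
\<close>

lemma L2_hilbert: "hilbert (L2 M)"
proof (rule hilbert.intro[OF scalar.L2_vec_pre_hilbert])
  interpret L: pre_hilbert "L2 M" by (rule scalar.L2_vec_pre_hilbert)
  show "hilbert_axioms (L2 M)"
  proof
    fix s :: "nat \<Rightarrow> 'a \<Rightarrow> complex"
    assume s: "\<And>n. s n \<in> hcarrier (L2 M)"
      and c: "\<And>\<epsilon>. 0 < \<epsilon> \<Longrightarrow> \<exists>N. \<forall>m\<ge>N. \<forall>n\<ge>N. hnorm (L2 M) (s m - s n) < \<epsilon>"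
    have [measurable]: "s n \<in> borel_measurable M" for n using s by (simp add: L2_carrier)
    have "\<exists>N. \<forall>m\<ge>N. \<forall>n\<ge>N. hnorm (L2 M) (s m - s n) < (1/2) ^ k" for k by (rule c) simp
    then obtain N where N: "\<And>k m n. N k \<le> m \<Longrightarrow> N k \<le> n \<Longrightarrow> hnorm (L2 M) (s m - s n) < (1/2) ^ k"
      by metis
    \<comment> \<open>Summing makes \<open>r\<close> monotone, so that \<open>r (Suc k)\<close> is also beyond \<open>N k\<close>.\<close>
    define r where "r k = (\<Sum>i\<le>k. N i)" for k
    have rN: "N k \<le> r k" "r k \<le> r (Suc k)" for k unfolding r_def by (auto intro: member_le_sum)
    have "AE x in M. convergent (\<lambda>k. s (r k) x)"
    proof (rule L2_fast_Cauchy_AE_convergent)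
      fix k
      have "hnorm (L2 M) (s (r (Suc k)) - s (r k)) \<le> (1/2) ^ k"
        using N[of k "r (Suc k)" "r k"] rN[of k] by simp
      then have "(hnorm (L2 M) (s (r (Suc k)) - s (r k)))\<^sup>2 \<le> ((1/2) ^ k)\<^sup>2"
        using s by (intro power_mono) auto
      also have "((1/2) ^ k)\<^sup>2 = (1/4::real) ^ k" by (simp add: power2_eq_square flip: power_mult_distrib)
      finally show "(hnorm (L2 M) (s (r (Suc k)) - s (r k)))\<^sup>2 \<le> (1/4) ^ k" .
    qed (rule s)
    then have lim: "AE x in M. (\<lambda>k. s (r k) x) \<longlonglongrightarrow> lim (\<lambda>k. s (r k) x)"
      by eventually_elim (simp add: convergent_LIMSEQ_iff)
    define l where "l x = lim (\<lambda>k. s (r k) x)" for x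
    have lm[measurable]: "l \<in> borel_measurable M" unfolding l_def by (rule borel_measurable_lim_metric) simp
    have bound: "(\<integral>\<^sup>+x. ennreal ((cmod (s n x - l x))\<^sup>2) \<partial>M) \<le> ennreal (((1/2) ^ k)\<^sup>2)"
      if n: "N k \<le> n" for n k
    proof -
      have "(\<integral>\<^sup>+x. ennreal ((cmod (s n x - l x))\<^sup>2) \<partial>M)
          = (\<integral>\<^sup>+x. liminf (\<lambda>j. ennreal ((cmod (s n x - s (r j) x))\<^sup>2)) \<partial>M)"
      proof (rule nn_integral_cong_AE)
        show "AE x in M. ennreal ((cmod (s n x - l x))\<^sup>2) = liminf (\<lambda>j. ennreal ((cmod (s n x - s (r j) x))\<^sup>2))"
          using lim
        proof eventually_elim
          case (elim x)
          then have "(\<lambda>j. ennreal ((cmod (s n x - s (r j) x))\<^sup>2)) \<longlonglongrightarrow> ennreal ((cmod (s n x - l x))\<^sup>2)"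
            unfolding l_def by (intro tendsto_intros)
          from lim_imp_Liminf[OF _ this] show ?case by simp
        qed
      qed
      also have "\<dots> \<le> liminf (\<lambda>j. \<integral>\<^sup>+x. ennreal ((cmod (s n x - s (r j) x))\<^sup>2) \<partial>M)"
        by (rule nn_integral_liminf) measurable
      also have "\<dots> \<le> ennreal (((1/2) ^ k)\<^sup>2)"
      proof (rule Liminf_le)
        show "\<forall>\<^sub>F j in sequentially. (\<integral>\<^sup>+x. ennreal ((cmod (s n x - s (r j) x))\<^sup>2) \<partial>M) \<le> ennreal (((1/2) ^ k)\<^sup>2)"
          using eventually_ge_at_top[of k]
        proof eventually_elim
          case (elim j)
          have "r k \<le> r j" unfolding r_def using elim by (intro sum_mono2) auto
          then have "hnorm (L2 M) (s n - s (r j)) \<le> (1/2) ^ k"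
            using N[of k n "r j"] rN(1)[of k] n by simp
          then have "(hnorm (L2 M) (s n - s (r j)))\<^sup>2 \<le> ((1/2) ^ k)\<^sup>2"
            using s by (intro power_mono) auto
          then show ?case using L2_hnorm_nn[of "s n - s (r j)" M] s by (simp add: ennreal_leI)
        qed
      qed simp
      finally show ?thesis .
    qed
    have dl: "s n - l \<in> hcarrier (L2 M)" if "N 0 \<le> n" for n
    proof -
      have "(\<integral>\<^sup>+x. ennreal ((cmod ((s n - l) x))\<^sup>2) \<partial>M) < \<infinity>"
        using bound[OF that] by (auto simp: less_top[symmetric] top_unique)
      moreover have "s n - l \<in> borel_measurable M" by (simp add: fun_diff_def)
      ultimately show ?thesis using L2_nn_integral by blast
    qed
    have "s (N 0) - (s (N 0) - l) \<in> hcarrier (L2 M)" by (rule L.diff_in[OF s dl[OF order_refl]])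
    then have l: "l \<in> hcarrier (L2 M)" by simp
    have le: "hnorm (L2 M) (s n - l) \<le> (1/2) ^ k" if "N k \<le> n" for n k
    proof (rule power2_le_imp_le)
      show "(hnorm (L2 M) (s n - l))\<^sup>2 \<le> ((1/2) ^ k)\<^sup>2"
        using bound[OF that] L2_hnorm_nn[of "s n - l" M] s l by (simp add: ennreal_le_iff)
    qed simp
    have "(\<lambda>n. hnorm (L2 M) (s n - l)) \<longlonglongrightarrow> 0"
    proof (rule LIMSEQ_I)
      fix e :: real assume "0 < e"
      then obtain k where k: "(1/2::real) ^ k < e" using real_arch_pow_inv[of e "1/2"] by auto
      have "norm (hnorm (L2 M) (s n - l) - 0) < e" if "N k \<le> n" for n
        using le[OF that] k s l by simp
      then show "\<exists>no. \<forall>n\<ge>no. norm (hnorm (L2 M) (s n - l) - 0) < e" by blast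
    qed
    then show "\<exists>l\<in>hcarrier (L2 M). (\<lambda>n. hnorm (L2 M) (s n - l)) \<longlonglongrightarrow> 0" using l by blast
  qed
qed

text \<open>
  The set where \<open>g < 0\<close> is one of the test sets.
\<close>

lemma AE_nonneg_of_set_integrals:
  fixes g :: "'a \<Rightarrow> real"
  assumes g: "integrable M g" and nonneg: "\<And>A. A \<in> sets M \<Longrightarrow> 0 \<le> (LINT x|M. indicator A x * g x)"
  shows "AE x in M. 0 \<le> g x"
proof -
  have [measurable]: "g \<in> borel_measurable M" using g by simp
  define A where "A = {x\<in>space M. g x < 0}"
  have A: "A \<in> sets M" unfolding A_def by measurable
  have int: "integrable M (\<lambda>x. - (indicator A x * g x))"
    using integrable_mult_indicator[OF A g] by simp
  have pos: "AE x in M. 0 \<le> - (indicator A x * g x)"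
    by (rule AE_I2) (simp add: A_def indicator_def)
  have "(LINT x|M. - (indicator A x * g x)) = 0"
    using nonneg[OF A] integral_nonneg_AE[OF pos] by simp
  then have "AE x in M. - (indicator A x * g x) = 0"
    using integral_nonneg_eq_0_iff_AE[OF int pos] by simp
  with AE_space show ?thesis
    by eventually_elim (simp add: A_def indicator_def split: if_splits)
qed

lemma AE_nonneg_Reals_of_set_integrals:
  fixes q :: "'a \<Rightarrow> complex"
  assumes q: "integrable M q" and nonneg: "\<And>A. A \<in> sets M \<Longrightarrow> (LINT x|M. indicator A x * q x) \<in> \<real>\<^sub>\<ge>\<^sub>0"
  shows "AE x in M. q x \<in> \<real>\<^sub>\<ge>\<^sub>0"
proof -
  have int: "integrable M (\<lambda>x. indicator A x * q x)" if "A \<in> sets M" for A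
    using integrable_mult_indicator[OF that q] by (simp add: indicator_scaleR_eq_if of_real_indicator scaleR_conv_of_real)
  have re: "(LINT x|M. indicator A x * Re (q x)) = Re (LINT x|M. indicator A x * q x)"
    and im: "(LINT x|M. indicator A x * Im (q x)) = Im (LINT x|M. indicator A x * q x)" if "A \<in> sets M" for A
  proof -
    have "(LINT x|M. Re (indicator A x * q x)) = Re (LINT x|M. indicator A x * q x)"
      using int[OF that] by (rule integral_Re)
    moreover have "Re (indicator A x * q x) = indicator A x * Re (q x)" for x by (simp add: indicator_def)
    ultimately show "(LINT x|M. indicator A x * Re (q x)) = Re (LINT x|M. indicator A x * q x)" by simp
    have "(LINT x|M. Im (indicator A x * q x)) = Im (LINT x|M. indicator A x * q x)"
      using int[OF that] by (rule integral_Im)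
    moreover have "Im (indicator A x * q x) = indicator A x * Im (q x)" for x by (simp add: indicator_def)
    ultimately show "(LINT x|M. indicator A x * Im (q x)) = Im (LINT x|M. indicator A x * q x)" by simp
  qed
  have "AE x in M. 0 \<le> Re (q x)"
    using q nonneg by (intro AE_nonneg_of_set_integrals) (auto simp: re complex_nonneg_Reals_iff)
  moreover have "AE x in M. 0 \<le> Im (q x)"
    using q nonneg by (intro AE_nonneg_of_set_integrals) (auto simp: im complex_nonneg_Reals_iff)
  moreover have "AE x in M. 0 \<le> - Im (q x)"
    using q nonneg by (intro AE_nonneg_of_set_integrals) (auto simp: im complex_nonneg_Reals_iff)
  ultimately show ?thesis
    by eventually_elim (simp add: complex_nonneg_Reals_iff)
qed

text \<open>
  The sets over which \<open>q\<close> has integral zero form a Dynkin system; so \<open>q\<close> and \<open>-q\<close> have nonnegative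
  integrals over all measurable sets.
\<close>

lemma AE_zero_of_set_integrals_on_generator:
  fixes q :: "'a \<Rightarrow> complex"
  assumes q: "integrable M q" and gen: "sets M = sigma_sets (space M) \<G>" "Int_stable \<G>" "\<G> \<subseteq> Pow (space M)"
    and zero: "\<And>A. A \<in> \<G> \<Longrightarrow> (LINT x|M. indicator A x * q x) = 0" and sp: "space M \<in> \<G>"
  shows "AE x in M. q x = 0"
proof -
  have int: "integrable M (\<lambda>x. indicator A x * q x)" if "A \<in> sets M" for A
    using integrable_mult_indicator[OF that q] by (simp add: indicator_scaleR_eq_if of_real_indicator scaleR_conv_of_real)
  have all: "(LINT x|M. indicator A x * q x) = 0" if "A \<in> sets M" for A
    using gen(2,3) that[unfolded gen(1)]
  proof (induction rule: sigma_sets_induct_disjoint)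
    case (compl A)
    have A: "A \<in> sets M" using compl gen by simp
    have "(LINT x|M. indicator (space M - A) x * q x) = (LINT x|M. indicator (space M) x * q x - indicator A x * q x)"
      by (rule Bochner_Integration.integral_cong) (auto simp: indicator_def)
    also have "\<dots> = 0" using compl zero[OF sp] int[OF A] int[OF sets.top] by simp
    finally show ?case .
  next
    case (union A)
    have A: "A i \<in> sets M" for i using union gen by auto
    have "set_lebesgue_integral M (\<Union>i. A i) q = (\<Sum>i. set_lebesgue_integral M (A i) q)"
    proof (rule lebesgue_integral_countable_add)
      show "set_integrable M (\<Union>i. A i) q"
        unfolding set_integrable_def using A by (intro integrable_mult_indicator q) auto
    qed (use A union(1) in \<open>auto simp: disjoint_family_on_def\<close>)
    moreover have "indicator B x *\<^sub>R q x = indicator B x * q x" for B x by (simp add: indicator_def)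
    ultimately show ?case using union(3) by (simp add: set_lebesgue_integral_def)
  qed (use zero in auto)
  have "AE x in M. q x \<in> \<real>\<^sub>\<ge>\<^sub>0" using q all by (intro AE_nonneg_Reals_of_set_integrals) auto
  moreover have "AE x in M. - q x \<in> \<real>\<^sub>\<ge>\<^sub>0"
    using q all by (intro AE_nonneg_Reals_of_set_integrals) auto
  ultimately show ?thesis
    by eventually_elim (simp add: complex_nonneg_Reals_iff complex_eq_iff)
qed

text \<open>
  Indicators of finite intersections of generators, cut down to pieces of finite measure.
\<close>

lemma L2_countable_total_set:
  assumes M: "sigma_finite_measure M"
    and gen: "sets M = sigma_sets (space M) \<G>" "\<G> \<subseteq> Pow (space M)" "countable \<G>"
  obtains S where "countable S" "S \<subseteq> hcarrier (L2 M)"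
    "\<And>f. f \<in> hcarrier (L2 M) \<Longrightarrow> (\<And>s. s \<in> S \<Longrightarrow> hinner (L2 M) s f = 0) \<Longrightarrow> hnorm (L2 M) f = 0"
proof -
  obtain X :: "nat \<Rightarrow> 'a set" where X: "range X \<subseteq> sets M" "(\<Union>i. X i) = space M" "\<And>i. emeasure M (X i) \<noteq> \<infinity>"
    using sigma_finite_measure.sigma_finite[OF M] by metis
  define \<H> where "\<H> = (\<lambda>\<F>. space M \<inter> \<Inter>\<F>) ` {\<F>. finite \<F> \<and> \<F> \<subseteq> \<G>}"
  have cH: "countable \<H>" unfolding \<H>_def using gen(3) by (intro countable_image countable_Collect_finite_subset)
  have HPow: "\<H> \<subseteq> Pow (space M)" by (auto simp: \<H>_def)
  have GM: "\<G> \<subseteq> sets M" using gen(1) by auto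
  have HM: "\<H> \<subseteq> sets M"
  proof
    fix A assume "A \<in> \<H>"
    then obtain \<F> where F: "finite \<F>" "\<F> \<subseteq> \<G>" "A = space M \<inter> \<Inter>\<F>" by (auto simp: \<H>_def)
    have "space M \<inter> \<Inter>\<F> \<in> sets M" using F(1,2)
    proof (induction \<F>)
      case (insert B \<F>)
      have "space M \<inter> \<Inter>(insert B \<F>) = B \<inter> (space M \<inter> \<Inter>\<F>)" by auto
      then show ?case using insert GM by auto
    qed simp
    then show "A \<in> sets M" using F by simp
  qed
  have Hgen: "sets M = sigma_sets (space M) \<H>"
  proof (rule antisym)
    have "\<G> \<subseteq> \<H>"
    proof
      fix A assume "A \<in> \<G>"
      then show "A \<in> \<H>" unfolding \<H>_def using gen(2) by (intro image_eqI[of _ _ "{A}"]) auto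
    qed
    then show "sets M \<subseteq> sigma_sets (space M) \<H>" unfolding gen(1) by (rule sigma_sets_mono')
    show "sigma_sets (space M) \<H> \<subseteq> sets M" using HM by (rule sets.sigma_sets_subset)
  qed
  have stable: "Int_stable \<H>"
  proof (rule Int_stableI)
    fix A B assume "A \<in> \<H>" "B \<in> \<H>"
    then obtain \<F> \<F>' where F: "finite \<F>" "\<F> \<subseteq> \<G>" "A = space M \<inter> \<Inter>\<F>"
      "finite \<F>'" "\<F>' \<subseteq> \<G>" "B = space M \<inter> \<Inter>\<F>'" by (auto simp: \<H>_def)
    then have "A \<inter> B = space M \<inter> \<Inter>(\<F> \<union> \<F>')" by auto
    then show "A \<inter> B \<in> \<H>" unfolding \<H>_def using F by (intro image_eqI[of _ _ "\<F> \<union> \<F>'"]) auto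
  qed
  have top: "space M \<in> \<H>" unfolding \<H>_def by (intro image_eqI[of _ _ "{}"]) auto
  have XL: "indicator (A \<inter> X i) \<in> hcarrier (L2 M)" if "A \<in> sets M" for A i
  proof -
    have Xi: "X i \<in> sets M" using X by auto
    have "emeasure M (A \<inter> X i) \<le> emeasure M (X i)" using Xi by (intro emeasure_mono) auto
    then have "emeasure M (A \<inter> X i) < \<infinity>" using X(3)[of i]
      by (metis infinity_ennreal_def le_less_trans less_top)
    then have "integrable M (indicator (A \<inter> X i) :: _ \<Rightarrow> real)" using Xi that by (intro integrable_real_indicator) auto
    moreover have "(cmod (indicator (A \<inter> X i) x))\<^sup>2 = indicator (A \<inter> X i) x" for x by (simp add: indicator_def)
    ultimately show ?thesis using Xi that by (simp add: L2_carrier)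
  qed
  show ?thesis
  proof (rule that[of "(\<lambda>(A, i). indicator (A \<inter> X i)) ` (\<H> \<times> UNIV)"])
    show "countable ((\<lambda>(A, i). indicator (A \<inter> X i)) ` (\<H> \<times> UNIV) :: ('a \<Rightarrow> complex) set)" using cH by simp
    show "(\<lambda>(A, i). indicator (A \<inter> X i)) ` (\<H> \<times> UNIV) \<subseteq> hcarrier (L2 M)" using XL HM by auto
    fix f assume f: "f \<in> hcarrier (L2 M)"
      and orth: "\<And>s. s \<in> (\<lambda>(A, i). indicator (A \<inter> X i)) ` (\<H> \<times> UNIV) \<Longrightarrow> hinner (L2 M) s f = 0"
    have "AE x in M. indicator (X i) x * cnj (f x) = 0" for i
    proof (rule AE_zero_of_set_integrals_on_generator[OF _ Hgen stable HPow _ top])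
      have "indicator (space M \<inter> X i) \<in> hcarrier (L2 M)" by (rule XL) simp
      moreover have "space M \<inter> X i = X i" using X(2) by auto
      ultimately have "indicator (X i) \<in> hcarrier (L2 M)" by simp
      from scalar.L2_vec_integrable_hinner[OF this f]
      show "integrable M (\<lambda>x. indicator (X i) x * cnj (f x))" by (simp add: hinner_complex)
      fix A assume A: "A \<in> \<H>"
      have "hinner (L2 M) (indicator (A \<inter> X i)) f = 0" by (rule orth) (use A in auto)
      then show "(LINT x|M. indicator A x * (indicator (X i) x * cnj (f x))) = 0"
        by (simp add: L2_hinner indicator_inter_arith mult.assoc)
    qed
    then have "AE x in M. \<forall>i. indicator (X i) x * cnj (f x) = 0" by (intro iffD2[OF AE_all_countable] allI)
    with AE_space have "AE x in M. (cmod (f x))\<^sup>2 = 0"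
    proof eventually_elim
      case (elim x)
      then obtain i where "x \<in> X i" using X(2) by auto
      then show ?case using elim(2) by (auto dest: spec[of _ i])
    qed
    then have "(LINT x|M. (cmod (f x))\<^sup>2) = 0" by (rule integral_eq_zero_AE)
    then show "hnorm (L2 M) f = 0" using L2_hnorm[OF f] by simp
  qed
qed

text \<open>An enumeration padded with zeros, so that a finite basis needs no separate treatment.\<close>

lemma (in hilbert) countable_basis_parseval_sequence:
  assumes E: "orthonormal_basis H E" and c: "countable E"
  obtains d :: "nat \<Rightarrow> 'a" where "parseval_family UNIV d"
proof -
  define I where "I = to_nat_on E ` E"
  define d where "d n = (if n \<in> I then from_nat_into E n else 0)" for n
  have dE: "d (to_nat_on E e) = e" if "e \<in> E" for e
    using that c by (simp add: d_def I_def)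
  have par: "parseval_family E (\<lambda>e. e)" by (rule orthonormal_basis_parseval[OF E])
  have "parseval_family UNIV d" unfolding parseval_family_def
  proof (intro conjI ballI)
    fix n
    show "d n \<in> hcarrier H"
    proof (cases "n \<in> I")
      case True
      then obtain e where "e \<in> E" "n = to_nat_on E e" by (auto simp: I_def)
      then show ?thesis using dE E by (auto simp: orthonormal_basis_def)
    qed (simp add: d_def)
  next
    fix a assume a: "a \<in> hcarrier H"
    have "((\<lambda>e. (cmod (hinner H a (d (to_nat_on E e))))\<^sup>2) has_sum (hnorm H a)\<^sup>2) E"
      using par a dE unfolding parseval_family_def
      by (subst has_sum_cong[where g = "\<lambda>e. (cmod (hinner H a e))\<^sup>2"]) auto
    then have "((\<lambda>n. (cmod (hinner H a (d n)))\<^sup>2) has_sum (hnorm H a)\<^sup>2) I"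
      unfolding I_def using c by (subst has_sum_reindex) (auto simp: o_def inj_on_to_nat_on)
    also have "?this \<longleftrightarrow> ((\<lambda>n. (cmod (hinner H a (d n)))\<^sup>2) has_sum (hnorm H a)\<^sup>2) UNIV"
      using a by (intro has_sum_cong_neutral) (auto simp: d_def)
    finally show "((\<lambda>n. (cmod (hinner H a (d n)))\<^sup>2) has_sum (hnorm H a)\<^sup>2) UNIV" .
  qed
  then show ?thesis by (rule that)
qed

lemma L2_separable_hilbert:
  assumes M: "sigma_finite_measure M"
    and gen: "sets M = sigma_sets (space M) \<G>" "\<G> \<subseteq> Pow (space M)" "countable \<G>"
  obtains d where "separable_hilbert (L2 M) d"
proof -
  interpret L: hilbert "L2 M" by (rule L2_hilbert)
  obtain E where E: "orthonormal_basis (L2 M) E" using L.orthonormal_basis_exists by blast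
  obtain S where S: "countable S" "S \<subseteq> hcarrier (L2 M)"
    "\<And>f. f \<in> hcarrier (L2 M) \<Longrightarrow> (\<And>s. s \<in> S \<Longrightarrow> hinner (L2 M) s f = 0) \<Longrightarrow> hnorm (L2 M) f = 0"
    using L2_countable_total_set[OF M gen] by metis
  have "countable E"
    by (rule L.orthonormal_countable[OF L.orthonormal_basis_imp_orthonormal[OF E] S])
  then obtain d :: "nat \<Rightarrow> 'a \<Rightarrow> complex" where "L.parseval_family UNIV d"
    by (rule L.countable_basis_parseval_sequence[OF E])
  then have "separable_hilbert (L2 M) d"
    by (intro separable_hilbert.intro separable_hilbert_axioms.intro L2_hilbert)
  then show ?thesis by (rule that)
qed

section \<open>Measures on sections of quotients by closed subgroups\<close>

lemma open_sets_Pow: "{U. openin X U} \<subseteq> Pow (topspace X)"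
  by (intro subsetI PowI, drule CollectD, erule openin_subset[THEN subsetD], assumption)

lemma sets_borel_of: "sets (borel_of X) = sigma_sets (topspace X) {U. openin X U}"
  unfolding borel_of_def by (rule sets_measure_of[OF open_sets_Pow])

lemma space_borel_of: "space (borel_of X) = topspace X"
  unfolding borel_of_def by (rule space_measure_of[OF open_sets_Pow])

lemma openin_borel_of: "openin X U \<Longrightarrow> U \<in> sets (borel_of X)"
  unfolding sets_borel_of by (rule sigma_sets.Basic) simp

lemma closedin_borel_of:
  assumes "closedin X C"
  shows "C \<in> sets (borel_of X)"
proof -
  have "topspace X - (topspace X - C) \<in> sets (borel_of X)"
    using assms sets.compl_sets[OF openin_borel_of[of X "topspace X - C"]]
    by (simp add: closedin_def space_borel_of)
  then show ?thesis using closedin_subset[OF assms] by (simp add: double_diff)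
qed

lemma second_countable_borel_of:
  assumes "second_countable X"
  obtains \<G> where "countable \<G>" "\<G> \<subseteq> Pow (topspace X)" "sets (borel_of X) = sigma_sets (topspace X) \<G>"
proof -
  obtain \<B> where B: "countable \<B>" "\<And>V. V \<in> \<B> \<Longrightarrow> openin X V"
    "\<And>U x. openin X U \<Longrightarrow> x \<in> U \<Longrightarrow> \<exists>V\<in>\<B>. x \<in> V \<and> V \<subseteq> U"
    using assms unfolding second_countable_def by metis
  have "sigma_sets (topspace X) {U. openin X U} = sigma_sets (topspace X) \<B>"
  proof (rule sigma_sets_eqI)
    fix U assume "U \<in> {U. openin X U}"
    then have U: "openin X U" by simp
    have "U = \<Union>{V\<in>\<B>. V \<subseteq> U}" using B(3)[OF U] by blast
    moreover have "\<Union>{V\<in>\<B>. V \<subseteq> U} \<in> sigma_sets (topspace X) \<B>"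
      using B(1) by (intro sigma_sets_UNION) auto
    ultimately show "U \<in> sigma_sets (topspace X) \<B>" by simp
  next
    fix V assume "V \<in> \<B>"
    then show "V \<in> sigma_sets (topspace X) {U. openin X U}" using B(2) by (intro sigma_sets.Basic) simp
  qed
  moreover have "\<B> \<subseteq> Pow (topspace X)" using B(2) openin_subset by blast
  ultimately show ?thesis using that B(1) by (simp add: sets_borel_of)
qed

lemma section_space:
  assumes "borel_section G T H S" "section_measure G T H S m"
  shows "space m = S" "S \<subseteq> topspace T"
proof -
  have "S \<in> sets (borel_of T)" using assms(1) by (simp add: borel_section_def)
  from sets.sets_into_space[OF this] show S: "S \<subseteq> topspace T" unfolding space_borel_of .
  have "space m = space (restrict_space (borel_of T) S)"
    using assms(2) by (intro sets_eq_imp_space_eq) (simp add: section_measure_def)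
  then show "space m = S" using S by (auto simp: space_restrict_space space_borel_of)
qed

lemma section_measure_countably_generated:
  assumes "second_countable T" "borel_section G T H S" "section_measure G T H S m"
  obtains \<G> where "countable \<G>" "\<G> \<subseteq> Pow (space m)" "sets m = sigma_sets (space m) \<G>"
proof -
  obtain \<G> where G: "countable \<G>" "\<G> \<subseteq> Pow (topspace T)" "sets (borel_of T) = sigma_sets (topspace T) \<G>"
    by (rule second_countable_borel_of[OF assms(1)])
  note sp = section_space[OF assms(2,3)]
  have "S \<in> sigma_sets (topspace T) \<G>" using assms(2) G(3) by (simp add: borel_section_def)
  from sigma_sets_Int[OF this sp(2)]
  have "sets m = sigma_sets (space m) ((\<inter>) S ` \<G>)"
    using assms(3) by (simp add: section_measure_def sets_restrict_space G(3) sp(1))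
  moreover have "(\<inter>) S ` \<G> \<subseteq> Pow (space m)" by (auto simp: sp(1))
  ultimately show ?thesis by (rule that[OF countable_image[OF G(1)], rotated])
qed

lemma topspace_quotient_topology:
  fixes G :: "('g, 'b) monoid_scheme" (structure)
  assumes "comm_group G" "subgroup H G" "topspace T = carrier G"
  shows "topspace (quotient_topology G T H) = rcosets\<^bsub>G\<^esub> H"
proof -
  interpret comm_group G by fact
  note op = openin_quotient_topology[OF assms(2), of T]
  have "openin (quotient_topology G T H) (rcosets H)"
    unfolding op rcosets_part_G[OF assms(2)] assms(3)[symmetric]
    by (simp only: FactGroup_def openin_topspace monoid.simps partial_object.simps subset_refl simp_thms)
  moreover have "U \<subseteq> rcosets H" if "openin (quotient_topology G T H) U" for U
    using that unfolding op by (simp add: FactGroup_def)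
  ultimately show ?thesis unfolding topspace_def by blast
qed

lemma rcoset_unique:
  fixes G :: "('g, 'b) monoid_scheme" (structure)
  assumes "comm_group G" "subgroup H G" "C \<in> rcosets\<^bsub>G\<^esub> H" "x \<in> C"
  shows "H #>\<^bsub>G\<^esub> x = C"
proof -
  interpret comm_group G by fact
  obtain y where y: "y \<in> carrier G" "C = H #> y" using assms(3) by (auto simp: RCOSETS_def)
  then show ?thesis using repr_independence[of x H y] assms(2,4) by simp
qed

lemma coset_vimage:
  fixes G :: "('g, 'b) monoid_scheme" (structure)
  assumes "comm_group G" "subgroup H G" "\<U> \<subseteq> rcosets\<^bsub>G\<^esub> H"
  shows "{x \<in> carrier G. H #>\<^bsub>G\<^esub> x \<in> \<U>} = \<Union>\<U>"
proof (intro equalityI subsetI)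
  interpret comm_group G by fact
  show "x \<in> \<Union>\<U>" if "x \<in> {x \<in> carrier G. H #> x \<in> \<U>}" for x
    using that rcos_self[OF _ assms(2)] by blast
  show "x \<in> {x \<in> carrier G. H #> x \<in> \<U>}" if "x \<in> \<Union>\<U>" for x
  proof -
    obtain C where C: "C \<in> \<U>" "x \<in> C" using \<open>x \<in> \<Union>\<U>\<close> by blast
    then have "H #> x = C" using rcoset_unique[OF assms(1,2)] assms(3) by blast
    moreover have "x \<in> carrier G" using C assms(3) rcosets_part_G[OF assms(2)] by blast
    ultimately show ?thesis using C by simp
  qed
qed

lemma coset_map_continuous:
  fixes G :: "('g, 'b) monoid_scheme" (structure)
  assumes "comm_group G" "subgroup H G" "topspace T = carrier G"
  shows "continuous_map T (quotient_topology G T H) (\<lambda>x. H #>\<^bsub>G\<^esub> x)"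
  unfolding continuous_map_def
proof (intro conjI allI impI)
  interpret comm_group G by fact
  show "(\<lambda>x. H #> x) \<in> topspace T \<rightarrow> topspace (quotient_topology G T H)"
    using rcosetsI[OF subgroup.subset[OF assms(2)]]
    by (auto simp: topspace_quotient_topology[OF assms] assms(3))
  fix U assume "openin (quotient_topology G T H) U"
  then have U: "U \<subseteq> rcosets H" "openin T (\<Union>U)"
    unfolding openin_quotient_topology[OF assms(2)] by (simp_all add: FactGroup_def)
  then show "openin T {x \<in> topspace T. H #> x \<in> U}"
    using coset_vimage[OF assms(1,2) U(1)] assms(3) by simp
qed

text \<open>The union of the cosets that meet a compact set \<open>K\<close> is the projection of a closed subset of
  \<open>K \<times> G\<close> along the compact factor.\<close>

lemma closedin_compact_coset_image:
  fixes G :: "('g, 'b) monoid_scheme" (structure)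
  assumes G: "comm_group G" and H: "subgroup H G" and T: "topspace T = carrier G"
    and cont: "continuous_map (prod_topology T T) T (\<lambda>(x, y). inv\<^bsub>G\<^esub> x \<otimes>\<^bsub>G\<^esub> y)"
    and Hc: "closedin T H" and K: "compactin T K"
  shows "closedin (quotient_topology G T H) ((\<lambda>x. H #>\<^bsub>G\<^esub> x) ` K)"
proof -
  interpret comm_group G by fact
  have KG: "K \<subseteq> carrier G" using compactin_subset_topspace[OF K] T by simp
  let ?X = "subtopology T K"
  have tX: "topspace ?X = K" using KG T by auto
  define P where "P = {z \<in> topspace (prod_topology ?X T). (case z of (x, y) \<Rightarrow> inv x \<otimes> y) \<in> H}"
  have "continuous_map (prod_topology ?X T) T (\<lambda>(x, y). inv x \<otimes> y)"
    unfolding prod_topology_subtopology(1) using cont by (rule continuous_map_from_subtopology)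
  then have "closedin (prod_topology ?X T) P"
    unfolding P_def using Hc by (rule closedin_continuous_map_preimage)
  moreover have "compact_space ?X" using K by (simp add: compact_space_subtopology)
  ultimately have "closedin T (snd ` P)"
    using closed_map_snd unfolding closed_map_def by blast
  moreover have "snd ` P = \<Union>((\<lambda>x. H #> x) ` K)"
  proof (intro equalityI subsetI)
    fix y assume "y \<in> snd ` P"
    then obtain x where x: "x \<in> K" "y \<in> carrier G" "inv x \<otimes> y \<in> H" using tX T by (auto simp: P_def)
    have xG: "x \<in> carrier G" using x(1) KG by blast
    have "x \<otimes> (inv x \<otimes> y) = y" using x(2) xG by (simp flip: m_assoc)
    then have "y = (inv x \<otimes> y) \<otimes> x" using x(2) xG by (simp add: m_comm[of x])
    then have "y \<in> H #> x" using x(3) by (auto simp: r_coset_def)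
    then show "y \<in> \<Union>((\<lambda>x. H #> x) ` K)" using x by blast
  next
    fix y assume "y \<in> \<Union>((\<lambda>x. H #> x) ` K)"
    then obtain x h where x: "x \<in> K" "h \<in> H" "y = h \<otimes> x" by (auto simp: r_coset_def)
    have c: "x \<in> carrier G" "h \<in> carrier G" using x KG subgroup.subset[OF H] by auto
    have "inv x \<otimes> (x \<otimes> h) = h" using c by (simp flip: m_assoc)
    then have "inv x \<otimes> y = h" using c by (simp add: x(3) m_comm[of h x])
    then have "(x, y) \<in> P" using x c tX T by (simp add: P_def)
    then show "y \<in> snd ` P" by force
  qed
  ultimately have c: "closedin T (\<Union>((\<lambda>x. H #> x) ` K))" by simp
  note tQ = topspace_quotient_topology[OF G H T]
  have sub: "(\<lambda>x. H #> x) ` K \<subseteq> rcosets H"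
    using KG rcosetsI[OF subgroup.subset[OF H]] by auto
  have "\<Union>(rcosets H - (\<lambda>x. H #> x) ` K) = carrier G - \<Union>((\<lambda>x. H #> x) ` K)"
  proof -
    have "\<Union>(rcosets H - (\<lambda>x. H #> x) ` K) = {x \<in> carrier G. H #> x \<in> rcosets H - (\<lambda>x. H #> x) ` K}"
      using coset_vimage[OF G H, of "rcosets H - (\<lambda>x. H #> x) ` K"] by auto
    moreover have "\<Union>((\<lambda>x. H #> x) ` K) = {x \<in> carrier G. H #> x \<in> (\<lambda>x. H #> x) ` K}"
      using coset_vimage[OF G H sub] by simp
    ultimately show ?thesis using rcosetsI[OF subgroup.subset[OF H]] by auto
  qed
  then have "openin (quotient_topology G T H) (rcosets H - (\<lambda>x. H #> x) ` K)"
    unfolding openin_quotient_topology[OF H] using c T by (auto simp: FactGroup_def closedin_def)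
  then show ?thesis using sub by (simp add: closedin_def tQ)
qed

text \<open>
  Compact sets have compact images in the quotient, which are closed and hence measurable; their Haar
  measure is finite, and countably many of them cover.
\<close>

lemma section_measure_sigma_finite:
  fixes G :: "('g, 'b) monoid_scheme" (structure)
  assumes G: "comm_group G" and H: "subgroup H G" and T: "topspace T = carrier G"
    and cont: "continuous_map (prod_topology T T) T (\<lambda>(x, y). inv\<^bsub>G\<^esub> x \<otimes>\<^bsub>G\<^esub> y)"
    and Hc: "closedin T H"
    and \<K>: "countable \<K>" "\<And>K. K \<in> \<K> \<Longrightarrow> compactin T K" "carrier G \<subseteq> \<Union>\<K>"
    and S: "borel_section G T H S" "section_measure G T H S m"
  shows "sigma_finite_measure m"
proof
  interpret comm_group G by fact
  let ?Q = "quotient_topology G T H" and ?q = "\<lambda>x. H #> x"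
  note sp = section_space[OF S]
  have sm: "sets m = sets (restrict_space (borel_of T) S)"
    and haar: "haar_measure (G Mod H) ?Q (distr m (borel_of ?Q) ?q)"
    using S(2) by (simp_all add: section_measure_def)
  have "?q \<in> measurable (borel_of T) (borel_of ?Q)"
    unfolding borel_of_def[of ?Q]
  proof (rule measurable_measure_of)
    show "{U. openin ?Q U} \<subseteq> Pow (topspace ?Q)" using openin_subset by blast
    show "?q \<in> space (borel_of T) \<rightarrow> topspace ?Q"
      using coset_map_continuous[OF G H T] by (simp add: continuous_map_def space_borel_of)
    fix U assume "U \<in> {U. openin ?Q U}"
    then have "openin T {x \<in> topspace T. ?q x \<in> U}"
      using coset_map_continuous[OF G H T] by (simp add: continuous_map_def)
    then have "{x \<in> topspace T. ?q x \<in> U} \<in> sets (borel_of T)" by (rule openin_borel_of)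
    moreover have "{x \<in> topspace T. ?q x \<in> U} = ?q -` U \<inter> space (borel_of T)"
      by (auto simp: space_borel_of)
    ultimately show "?q -` U \<inter> space (borel_of T) \<in> sets (borel_of T)" by simp
  qed
  then have "?q \<in> measurable (restrict_space (borel_of T) S) (borel_of ?Q)"
    by (rule measurable_restrict_space1)
  then have qm: "?q \<in> measurable m (borel_of ?Q)"
    by (simp cong: measurable_cong_sets add: sm)
  have qK: "?q ` K \<in> sets (borel_of ?Q)" "emeasure m (?q -` (?q ` K) \<inter> space m) < \<infinity>" if "K \<in> \<K>" for K
  proof -
    have K: "compactin T K" using \<K>(2) that .
    show b: "?q ` K \<in> sets (borel_of ?Q)"
      by (rule closedin_borel_of[OF closedin_compact_coset_image[OF G H T cont Hc K]])
    have "compactin ?Q (?q ` K)" by (rule image_compactin[OF K coset_map_continuous[OF G H T]])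
    then have "emeasure (distr m (borel_of ?Q) ?q) (?q ` K) < \<infinity>"
      using haar by (simp add: haar_measure_def)
    then show "emeasure m (?q -` (?q ` K) \<inter> space m) < \<infinity>"
      using emeasure_distr[OF qm b] by simp
  qed
  show "\<exists>A. countable A \<and> A \<subseteq> sets m \<and> \<Union>A = space m \<and> (\<forall>a\<in>A. emeasure m a \<noteq> \<infinity>)"
  proof (intro exI[of _ "(\<lambda>K. ?q -` (?q ` K) \<inter> space m) ` \<K>"] conjI)
    show "(\<lambda>K. ?q -` (?q ` K) \<inter> space m) ` \<K> \<subseteq> sets m"
      using measurable_sets[OF qm qK(1)] by auto
    show "\<Union>((\<lambda>K. ?q -` (?q ` K) \<inter> space m) ` \<K>) = space m"
    proof (intro equalityI subsetI)
      fix x assume x: "x \<in> space m"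
      then have "x \<in> carrier G" using sp T by auto
      then obtain K where "K \<in> \<K>" "x \<in> K" using \<K>(3) by auto
      then show "x \<in> \<Union>((\<lambda>K. ?q -` (?q ` K) \<inter> space m) ` \<K>)" using x by auto
    qed auto
    show "\<forall>a\<in>(\<lambda>K. ?q -` (?q ` K) \<inter> space m) ` \<K>. emeasure m a \<noteq> \<infinity>"
    proof
      fix a assume "a \<in> (\<lambda>K. ?q -` (?q ` K) \<inter> space m) ` \<K>"
      then obtain K where "K \<in> \<K>" "a = ?q -` (?q ` K) \<inter> space m" by blast
      then show "emeasure m a \<noteq> \<infinity>" using qK(2)[of K] by (metis less_irrefl)
    qed
  qed (rule countable_image[OF \<K>(1)])
qed

section \<open>The dual of a second countable locally compact abelian group\<close>

text \<open>
  Those members of a countable base that lie in some compact set still cover.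
\<close>

lemma second_countable_sigma_compact:
  assumes "second_countable X" "locally_compact_space X"
  obtains \<K> where "countable \<K>" "\<And>K. K \<in> \<K> \<Longrightarrow> compactin X K" "topspace X \<subseteq> \<Union>\<K>"
proof -
  obtain \<B> where B: "countable \<B>" "\<And>V. V \<in> \<B> \<Longrightarrow> openin X V"
    "\<And>U x. openin X U \<Longrightarrow> x \<in> U \<Longrightarrow> \<exists>V\<in>\<B>. x \<in> V \<and> V \<subseteq> U"
    using assms(1) unfolding second_countable_def by metis
  define \<B>' where "\<B>' = {V\<in>\<B>. \<exists>K. compactin X K \<and> V \<subseteq> K}"
  have "\<forall>V\<in>\<B>'. \<exists>K. compactin X K \<and> V \<subseteq> K" by (auto simp: \<B>'_def)
  then obtain k where k: "\<And>V. V \<in> \<B>' \<Longrightarrow> compactin X (k V) \<and> V \<subseteq> k V" by metis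
  have "topspace X \<subseteq> \<Union>(k ` \<B>')"
  proof
    fix x assume "x \<in> topspace X"
    then obtain U K where U: "openin X U" "compactin X K" "x \<in> U" "U \<subseteq> K"
      using assms(2) unfolding locally_compact_space_def by blast
    obtain V where V: "V \<in> \<B>" "x \<in> V" "V \<subseteq> U" using B(3)[OF U(1,3)] by blast
    then have "V \<in> \<B>'" using U by (auto simp: \<B>'_def)
    then show "x \<in> \<Union>(k ` \<B>')" using k V by blast
  qed
  moreover have "countable (k ` \<B>')" using B(1) by (simp add: \<B>'_def)
  ultimately show ?thesis using that[of "k ` \<B>'"] k by blast
qed

lemma continuous_map_complex_mult:
  fixes f g :: "'x \<Rightarrow> complex"
  shows "continuous_map X euclidean f \<Longrightarrow> continuous_map X euclidean g \<Longrightarrow> continuous_map X euclidean (\<lambda>x. f x * g x)"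
  by (simp add: continuous_map_atin tendsto_mult)

lemma continuous_map_complex_cnj:
  "continuous_map X euclidean f \<Longrightarrow> continuous_map X euclidean (\<lambda>x. cnj (f x))"
  by (simp add: continuous_map_atin tendsto_cnj)

locale lca =
  fixes G :: "('g, 'b) monoid_scheme" (structure) and T :: "'g topology"
  assumes lca: "lca_group G T" and sc: "second_countable T"
begin

sublocale comm_group G
  using lca by (simp add: lca_group_def)

lemma topspace_eq: "topspace T = carrier G"
  and mult_cont: "continuous_map (prod_topology T T) T (\<lambda>(x, y). x \<otimes> y)"
  and inv_cont: "continuous_map T T (\<lambda>x. inv x)"
  and Hausdorff: "Hausdorff_space T"
  and loc_compact: "locally_compact_space T"
  using lca by (simp_all add: lca_group_def)

abbreviation \<Gamma> where "\<Gamma> \<equiv> dual_group G T"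
abbreviation \<Theta> where "\<Theta> \<equiv> dual_topology G T"

lemma character_iff: "\<xi> \<in> carrier \<Gamma> \<longleftrightarrow> (\<forall>x\<in>carrier G. cmod (\<xi> x) = 1) \<and>
    (\<forall>x\<in>carrier G. \<forall>y\<in>carrier G. \<xi> (x \<otimes> y) = \<xi> x * \<xi> y) \<and>
    \<xi> \<in> extensional (carrier G) \<and> continuous_map T euclidean \<xi>"
  by (auto simp: dual_group_def hom_def circle_group_def)

lemma characterD:
  assumes "\<xi> \<in> carrier \<Gamma>"
  shows "x \<in> carrier G \<Longrightarrow> cmod (\<xi> x) = 1"
    and "x \<in> carrier G \<Longrightarrow> y \<in> carrier G \<Longrightarrow> \<xi> (x \<otimes> y) = \<xi> x * \<xi> y"
    and "\<xi> \<in> extensional (carrier G)" and "continuous_map T euclidean \<xi>"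
  using assms by (auto simp: character_iff)

lemma dual_mult: "\<xi> \<otimes>\<^bsub>\<Gamma>\<^esub> \<psi> = restrict (\<lambda>x. \<xi> x * \<psi> x) (carrier G)"
  and dual_one: "\<one>\<^bsub>\<Gamma>\<^esub> = restrict (\<lambda>x. 1) (carrier G)"
  by (simp_all add: dual_group_def)

lemma restrict_character:
  assumes "\<And>x. x \<in> carrier G \<Longrightarrow> cmod (f x) = 1"
    "\<And>x y. x \<in> carrier G \<Longrightarrow> y \<in> carrier G \<Longrightarrow> f (x \<otimes> y) = f x * f y" "continuous_map T euclidean f"
  shows "restrict f (carrier G) \<in> carrier \<Gamma>"
  using assms continuous_map_eq[OF assms(3), of "restrict f (carrier G)"]
  unfolding character_iff by (simp add: topspace_eq)

definition conj_character :: "('g \<Rightarrow> complex) \<Rightarrow> 'g \<Rightarrow> complex" where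
  "conj_character \<xi> = restrict (\<lambda>x. cnj (\<xi> x)) (carrier G)"

lemma conj_character_in: "\<xi> \<in> carrier \<Gamma> \<Longrightarrow> conj_character \<xi> \<in> carrier \<Gamma>"
  unfolding conj_character_def
  by (rule restrict_character) (auto simp: characterD continuous_map_complex_cnj)

lemma dual_comm_group: "comm_group \<Gamma>"
proof (rule comm_groupI)
  show "\<xi> \<otimes>\<^bsub>\<Gamma>\<^esub> \<psi> \<in> carrier \<Gamma>" if "\<xi> \<in> carrier \<Gamma>" "\<psi> \<in> carrier \<Gamma>" for \<xi> \<psi>
    unfolding dual_mult using that
    by (intro restrict_character)
      (auto simp: characterD norm_mult intro: continuous_map_complex_mult)
  show "\<one>\<^bsub>\<Gamma>\<^esub> \<in> carrier \<Gamma>" unfolding dual_one by (rule restrict_character) auto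
  show "\<one>\<^bsub>\<Gamma>\<^esub> \<otimes>\<^bsub>\<Gamma>\<^esub> \<xi> = \<xi>" if "\<xi> \<in> carrier \<Gamma>" for \<xi>
    using characterD(3)[OF that] by (auto simp: dual_mult dual_one fun_eq_iff extensional_def)
  show "\<exists>\<psi>\<in>carrier \<Gamma>. \<psi> \<otimes>\<^bsub>\<Gamma>\<^esub> \<xi> = \<one>\<^bsub>\<Gamma>\<^esub>" if xi: "\<xi> \<in> carrier \<Gamma>" for \<xi>
  proof (rule bexI[OF _ conj_character_in[OF xi]])
    have "cnj (\<xi> x) * \<xi> x = 1" if "x \<in> carrier G" for x
      using characterD(1)[OF xi that] complex_norm_square[of "\<xi> x"] by (simp add: mult.commute)
    then show "conj_character \<xi> \<otimes>\<^bsub>\<Gamma>\<^esub> \<xi> = \<one>\<^bsub>\<Gamma>\<^esub>"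
      by (auto simp: dual_mult dual_one conj_character_def fun_eq_iff)
  qed
qed (auto simp: dual_mult fun_eq_iff mult_ac)

lemma dual_inv: "\<xi> \<in> carrier \<Gamma> \<Longrightarrow> x \<in> carrier G \<Longrightarrow> (inv\<^bsub>\<Gamma>\<^esub> \<xi>) x = cnj (\<xi> x)"
proof -
  assume xi: "\<xi> \<in> carrier \<Gamma>" and x: "x \<in> carrier G"
  interpret D: comm_group \<Gamma> by (rule dual_comm_group)
  have "inv\<^bsub>\<Gamma>\<^esub> \<xi> \<otimes>\<^bsub>\<Gamma>\<^esub> \<xi> = \<one>\<^bsub>\<Gamma>\<^esub>" using xi by (rule D.l_inv)
  from fun_cong[OF this, of x] have 1: "(inv\<^bsub>\<Gamma>\<^esub> \<xi>) x * \<xi> x = 1" using x by (simp add: dual_mult dual_one)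
  have 2: "\<xi> x * cnj (\<xi> x) = 1"
    using characterD(1)[OF xi x] complex_norm_square[of "\<xi> x"] by simp
  have "(inv\<^bsub>\<Gamma>\<^esub> \<xi>) x = ((inv\<^bsub>\<Gamma>\<^esub> \<xi>) x * \<xi> x) * cnj (\<xi> x)" using 2 by (simp add: mult.assoc)
  then show ?thesis using 1 by simp
qed

subsection \<open>The compact-open topology\<close>

definition subbasic :: "'g set \<Rightarrow> complex set \<Rightarrow> ('g \<Rightarrow> complex) set" where
  "subbasic K V = {\<xi> \<in> carrier \<Gamma>. \<xi> ` K \<subseteq> V}"

lemma dual_topology_eq: "\<Theta> = topology_generated_by {subbasic K V | K V. compactin T K \<and> open V}"
  by (simp add: dual_topology_def subbasic_def)

lemma openin_subbasic: "compactin T K \<Longrightarrow> open V \<Longrightarrow> openin \<Theta> (subbasic K V)"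
  unfolding dual_topology_eq by (rule topology_generated_by_Basis) blast

lemma topspace_dual: "topspace \<Theta> = carrier \<Gamma>"
proof -
  have "subbasic {} UNIV = carrier \<Gamma>" by (simp add: subbasic_def)
  moreover have "compactin T {}" by simp
  ultimately have "carrier \<Gamma> \<in> {subbasic K V | K V. compactin T K \<and> open V}"
    by (metis (mono_tags, lifting) mem_Collect_eq open_UNIV)
  then show ?thesis unfolding dual_topology_eq topology_generated_by_topspace
    by (auto simp: subbasic_def)
qed

text \<open>
  The compact-open topology is that of uniform convergence on compact sets.  This is one direction: if the
  compact set \<open>\<xi> ` K\<close> lies in the open set \<open>V\<close>, then so does an \<open>\<epsilon>\<close>-neighbourhood of it.
\<close>

lemma dual_open_uniform_neighbourhood:
  assumes "openin \<Theta> U" "\<xi> \<in> U"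
  shows "\<exists>K \<epsilon>. compactin T K \<and> 0 < \<epsilon> \<and>
    (\<forall>\<psi>\<in>carrier \<Gamma>. (\<forall>x\<in>K. cmod (\<psi> x - \<xi> x) < \<epsilon>) \<longrightarrow> \<psi> \<in> U)"
proof -
  have "generate_topology_on {subbasic K V | K V. compactin T K \<and> open V} U"
    using assms(1) unfolding dual_topology_eq openin_topology_generated_by_iff .
  then show ?thesis using assms(2)
  proof (induction rule: generate_topology_on.induct)
    case (Int a b)
    then obtain K \<epsilon> K' \<epsilon>' where K: "compactin T K" "0 < \<epsilon>"
      "\<forall>\<psi>\<in>carrier \<Gamma>. (\<forall>x\<in>K. cmod (\<psi> x - \<xi> x) < \<epsilon>) \<longrightarrow> \<psi> \<in> a"
      and K': "compactin T K'" "0 < \<epsilon>'"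
      "\<forall>\<psi>\<in>carrier \<Gamma>. (\<forall>x\<in>K'. cmod (\<psi> x - \<xi> x) < \<epsilon>') \<longrightarrow> \<psi> \<in> b" by blast
    have "\<forall>\<psi>\<in>carrier \<Gamma>. (\<forall>x\<in>K \<union> K'. cmod (\<psi> x - \<xi> x) < min \<epsilon> \<epsilon>') \<longrightarrow> \<psi> \<in> a \<inter> b"
      using K(3) K'(3) by simp
    moreover have "compactin T (K \<union> K')" using K(1) K'(1) by (rule compactin_Un)
    ultimately show ?case using K(2) K'(2) by (metis min_less_iff_conj)
  next
    case (UN \<K>)
    then obtain k where "k \<in> \<K>" "\<xi> \<in> k" by blast
    with UN.IH[of k] show ?case by (meson UnionI)
  next
    case (Basis s)
    then obtain K V where s: "s = subbasic K V" "compactin T K" "open V" by blast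
    have xi: "\<xi> \<in> carrier \<Gamma>" "\<xi> ` K \<subseteq> V" using Basis s by (auto simp: subbasic_def)
    have "compact (\<xi> ` K)" using image_compactin[OF s(2) characterD(4)[OF xi(1)]] by simp
    then obtain \<epsilon> where e: "\<epsilon> > 0" "(\<Union>z\<in>\<xi> ` K. ball z \<epsilon>) \<subseteq> V"
      using compact_subset_open_imp_ball_epsilon_subset s(3) xi(2) by metis
    have "\<psi> \<in> s" if "\<psi> \<in> carrier \<Gamma>" "\<forall>x\<in>K. cmod (\<psi> x - \<xi> x) < \<epsilon>" for \<psi>
    proof -
      have "\<psi> x \<in> V" if "x \<in> K" for x
      proof -
        have "\<psi> x \<in> ball (\<xi> x) \<epsilon>"
          using \<open>\<forall>x\<in>K. cmod (\<psi> x - \<xi> x) < \<epsilon>\<close> that by (simp add: dist_norm norm_minus_commute)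
        then show ?thesis using e(2) that by blast
      qed
      then show ?thesis using that(1) unfolding s(1) subbasic_def by blast
    qed
    then show ?case using s(2) e(1) by blast
  qed simp
qed

definition refines_uniform :: "('g \<Rightarrow> complex) set set \<Rightarrow> bool" where
  "refines_uniform \<S> \<longleftrightarrow> (\<forall>K \<xi> \<epsilon>. compactin T K \<and> \<xi> \<in> carrier \<Gamma> \<and> 0 < \<epsilon> \<longrightarrow>
     (\<exists>\<F>. finite \<F> \<and> \<F> \<subseteq> \<S> \<and> \<xi> \<in> \<Inter>\<F> \<and>
       (\<forall>\<psi>\<in>carrier \<Gamma> \<inter> \<Inter>\<F>. \<forall>x\<in>K. cmod (\<psi> x - \<xi> x) < \<epsilon>)))"

lemma refines_uniformD:
  assumes "refines_uniform \<S>" "compactin T K" "\<xi> \<in> carrier \<Gamma>" "0 < \<epsilon>"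
  shows "\<exists>\<F>. finite \<F> \<and> \<F> \<subseteq> \<S> \<and> \<xi> \<in> \<Inter>\<F> \<and>
       (\<forall>\<psi>\<in>carrier \<Gamma> \<inter> \<Inter>\<F>. \<forall>x\<in>K. cmod (\<psi> x - \<xi> x) < \<epsilon>)"
  using assms(1)[unfolded refines_uniform_def, rule_format, of K \<xi> \<epsilon>] assms(2-4) by simp

text \<open>Countably many subbasic sets suffice: the compact sets may be taken to be the compact closures of
  members of a countable base of \<open>G\<close>, and the target sets from a countable base of the complex plane.\<close>

lemma dual_countable_subbase:
  "\<exists>\<S>. countable \<S> \<and> (\<forall>S\<in>\<S>. openin \<Theta> S) \<and> refines_uniform \<S>"
proof -
  obtain \<B> where B: "countable \<B>" "\<And>V. V \<in> \<B> \<Longrightarrow> openin T V"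
    "\<And>U x. openin T U \<Longrightarrow> x \<in> U \<Longrightarrow> \<exists>V\<in>\<B>. x \<in> V \<and> V \<subseteq> U"
    using sc unfolding second_countable_def by metis
  obtain \<V> :: "complex set set" where V: "countable \<V>" "topological_basis \<V>"
    using ex_countable_basis by blast
  define \<K> where "\<K> = {T closure_of b | b. b \<in> \<B> \<and> compactin T (T closure_of b)}"
  have "\<K> \<subseteq> (\<lambda>b. T closure_of b) ` \<B>" by (auto simp: \<K>_def)
  then have cK: "countable \<K>" using B(1) by (meson countable_image countable_subset)
  define \<S> where "\<S> = (\<lambda>(K, V). subbasic K V) ` (\<K> \<times> \<V>)"
  have cS: "countable \<S>" unfolding \<S>_def using cK V(1) by simp
  have oS: "openin \<Theta> S" if "S \<in> \<S>" for S
    using that openin_subbasic topological_basis_open[OF V(2)] by (auto simp: \<S>_def \<K>_def)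
  have "\<exists>\<F>. finite \<F> \<and> \<F> \<subseteq> \<S> \<and> \<xi> \<in> \<Inter>\<F> \<and>
      (\<forall>\<psi>\<in>carrier \<Gamma> \<inter> \<Inter>\<F>. \<forall>x\<in>K. cmod (\<psi> x - \<xi> x) < \<epsilon>)"
    if K: "compactin T K" and xi: "\<xi> \<in> carrier \<Gamma>" and e: "0 < \<epsilon>" for K \<xi> and \<epsilon> :: real
  proof -
    have KT: "K \<subseteq> topspace T" using K by (rule compactin_subset_topspace)
    have "\<exists>b v. b \<in> \<B> \<and> x \<in> b \<and> compactin T (T closure_of b) \<and> v \<in> \<V> \<and> \<xi> ` (T closure_of b) \<subseteq> v \<and>
        v \<subseteq> ball (\<xi> x) (\<epsilon> / 2)" if x: "x \<in> K" for x
    proof -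
      obtain v where v: "v \<in> \<V>" "\<xi> x \<in> v" "v \<subseteq> ball (\<xi> x) (\<epsilon> / 2)"
        using topological_basisE[OF V(2), of "ball (\<xi> x) (\<epsilon> / 2)" "\<xi> x"] e by auto
      have "openin T {y \<in> topspace T. \<xi> y \<in> v}"
        using characterD(4)[OF xi] topological_basis_open[OF V(2) v(1)] by (simp add: continuous_map_def)
      moreover have "x \<in> {y \<in> topspace T. \<xi> y \<in> v}" using x KT v by auto
      moreover have "neighbourhood_base_of (\<lambda>C. compactin T C \<and> closedin T C) T"
        using locally_compact_space_neighbourhood_base_closedin Hausdorff loc_compact by blast
      ultimately obtain O' C where C: "openin T O'" "compactin T C" "closedin T C" "x \<in> O'" "O' \<subseteq> C"
        "C \<subseteq> {y \<in> topspace T. \<xi> y \<in> v}"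
        unfolding neighbourhood_base_of by meson
      obtain b where b: "b \<in> \<B>" "x \<in> b" "b \<subseteq> O'" using B(3)[OF C(1,4)] by blast
      have cl: "T closure_of b \<subseteq> C" using b C by (intro closure_of_minimal) auto
      then have "compactin T (T closure_of b)"
        using C(2) closed_compactin closedin_closure_of by blast
      then show ?thesis using b v cl C(6) by blast
    qed
    then obtain b v where bv: "\<And>x. x \<in> K \<Longrightarrow> b x \<in> \<B> \<and> x \<in> b x \<and> compactin T (T closure_of b x) \<and>
        v x \<in> \<V> \<and> \<xi> ` (T closure_of b x) \<subseteq> v x \<and> v x \<subseteq> ball (\<xi> x) (\<epsilon> / 2)" by metis
    have "(\<forall>U\<in>b ` K. openin T U) \<and> K \<subseteq> \<Union>(b ` K)" using bv B(2) by blast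
    then obtain \<U> where "finite \<U>" "\<U> \<subseteq> b ` K" "K \<subseteq> \<Union>\<U>"
      using K unfolding compactin_def by meson
    then obtain X where X: "finite X" "X \<subseteq> K" "K \<subseteq> \<Union>(b ` X)"
      by (metis finite_subset_image)
    define \<F> where "\<F> = (\<lambda>x. subbasic (T closure_of b x) (v x)) ` X"
    have "finite \<F>" using X by (simp add: \<F>_def)
    moreover have "\<F> \<subseteq> \<S>"
    proof
      fix S assume "S \<in> \<F>"
      then obtain x where x: "x \<in> X" "S = subbasic (T closure_of b x) (v x)" by (auto simp: \<F>_def)
      then have "(T closure_of b x, v x) \<in> \<K> \<times> \<V>" using bv[of x] X(2) unfolding \<K>_def by blast
      then show "S \<in> \<S>" unfolding \<S>_def x(2) by force
    qed
    moreover have "\<xi> \<in> \<Inter>\<F>" using bv X(2) xi by (auto simp: \<F>_def subbasic_def)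
    moreover have "cmod (\<psi> y - \<xi> y) < \<epsilon>" if psi: "\<psi> \<in> carrier \<Gamma> \<inter> \<Inter>\<F>" and y: "y \<in> K" for \<psi> y
    proof -
      obtain x where x: "x \<in> X" "y \<in> b x" using X(3) y by blast
      have xK: "x \<in> K" using x X by blast
      have "y \<in> T closure_of b x" using x(2) bv[OF xK] B(2) closure_of_subset openin_subset by (metis subsetD)
      moreover have "\<psi> \<in> subbasic (T closure_of b x) (v x)" using psi x(1) by (auto simp: \<F>_def)
      ultimately have "\<psi> y \<in> v x" "\<xi> y \<in> v x" using bv[OF xK] unfolding subbasic_def by blast+
      then have "\<psi> y \<in> ball (\<xi> x) (\<epsilon> / 2)" "\<xi> y \<in> ball (\<xi> x) (\<epsilon> / 2)"
        using bv[OF xK] by blast+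
      then show ?thesis using dist_triangle_half_r[of "\<xi> x" "\<psi> y" \<epsilon> "\<xi> y"]
        by (simp add: dist_norm)
    qed
    ultimately show ?thesis by (intro exI[of _ \<F>] conjI ballI) blast+
  qed
  then have "refines_uniform \<S>" unfolding refines_uniform_def by simp
  with cS oS show ?thesis by (intro exI[of _ \<S>] conjI ballI)
qed

text \<open>
  The other direction: every uniform neighbourhood on a compact set contains an open neighbourhood.
\<close>

lemma uniform_neighbourhood_open:
  assumes "compactin T K" "\<xi> \<in> carrier \<Gamma>" "0 < \<epsilon>"
  obtains O' where "openin \<Theta> O'" "\<xi> \<in> O'" "\<forall>\<psi>\<in>O'. \<forall>x\<in>K. cmod (\<psi> x - \<xi> x) < \<epsilon>"
proof -
  obtain \<S> where S: "\<forall>S\<in>\<S>. openin \<Theta> S" "refines_uniform \<S>"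
    using dual_countable_subbase by blast
  obtain \<F> where F: "finite \<F>" "\<F> \<subseteq> \<S>" "\<xi> \<in> \<Inter>\<F>"
    "\<forall>\<psi>\<in>carrier \<Gamma> \<inter> \<Inter>\<F>. \<forall>x\<in>K. cmod (\<psi> x - \<xi> x) < \<epsilon>"
    using refines_uniformD[OF S(2) assms] by blast
  have "openin \<Theta> (topspace \<Theta> \<inter> \<Inter>\<F>)" using F(1,2) S(1) by (intro openin_Int_Inter) blast+
  then have "openin \<Theta> (carrier \<Gamma> \<inter> \<Inter>\<F>)" unfolding topspace_dual .
  moreover have "\<xi> \<in> carrier \<Gamma> \<inter> \<Inter>\<F>" using F(3) assms(2) by blast
  ultimately show ?thesis using F(4) by (rule that)
qed

lemma dual_second_countable: "second_countable \<Theta>"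
proof -
  obtain \<S> where S: "countable \<S>" "\<forall>S\<in>\<S>. openin \<Theta> S" "refines_uniform \<S>"
    using dual_countable_subbase by blast
  define \<B> where "\<B> = (\<lambda>\<F>. topspace \<Theta> \<inter> \<Inter>\<F>) ` {\<F>. finite \<F> \<and> \<F> \<subseteq> \<S>}"
  show ?thesis unfolding second_countable_def
  proof (intro exI[of _ \<B>] conjI ballI allI impI)
    show "countable \<B>" unfolding \<B>_def using S(1) by (intro countable_image countable_Collect_finite_subset)
    show "openin \<Theta> V" if V: "V \<in> \<B>" for V
    proof -
      obtain \<F> where "finite \<F>" "\<F> \<subseteq> \<S>" "V = topspace \<Theta> \<inter> \<Inter>\<F>" using V by (auto simp: \<B>_def)
      then show ?thesis using S(2) by (simp, intro openin_Int_Inter) blast+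
    qed
    fix U \<xi> assume U: "openin \<Theta> U \<and> \<xi> \<in> U"
    then have xi: "\<xi> \<in> carrier \<Gamma>" using openin_subset[of \<Theta> U] unfolding topspace_dual by blast
    obtain K \<epsilon> where K: "compactin T K" "0 < \<epsilon>"
      "\<forall>\<psi>\<in>carrier \<Gamma>. (\<forall>x\<in>K. cmod (\<psi> x - \<xi> x) < \<epsilon>) \<longrightarrow> \<psi> \<in> U"
      using dual_open_uniform_neighbourhood U by meson
    obtain \<F> where F: "finite \<F>" "\<F> \<subseteq> \<S>" "\<xi> \<in> \<Inter>\<F>"
      "\<forall>\<psi>\<in>carrier \<Gamma> \<inter> \<Inter>\<F>. \<forall>x\<in>K. cmod (\<psi> x - \<xi> x) < \<epsilon>"
      using refines_uniformD[OF S(3) K(1) xi K(2)] by blast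
    have "topspace \<Theta> \<inter> \<Inter>\<F> \<in> \<B>" using F(1,2) unfolding \<B>_def by blast
    moreover have "\<xi> \<in> topspace \<Theta> \<inter> \<Inter>\<F>" using F(3) xi unfolding topspace_dual by blast
    moreover have "topspace \<Theta> \<inter> \<Inter>\<F> \<subseteq> U" using F(4) K(3) unfolding topspace_dual by blast
    ultimately show "\<exists>V\<in>\<B>. \<xi> \<in> V \<and> V \<subseteq> U" by blast
  qed
qed

text \<open>
  Characters have modulus 1, so the errors of the two factors add up.
\<close>

lemma dual_quotient_continuous:
  "continuous_map (prod_topology \<Theta> \<Theta>) \<Theta> (\<lambda>(\<xi>, \<psi>). inv\<^bsub>\<Gamma>\<^esub> \<xi> \<otimes>\<^bsub>\<Gamma>\<^esub> \<psi>)"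
  unfolding continuous_map_def
proof (intro conjI allI impI)
  interpret D: comm_group \<Gamma> by (rule dual_comm_group)
  show "(\<lambda>(\<xi>, \<psi>). inv\<^bsub>\<Gamma>\<^esub> \<xi> \<otimes>\<^bsub>\<Gamma>\<^esub> \<psi>) \<in> topspace (prod_topology \<Theta> \<Theta>) \<rightarrow> topspace \<Theta>"
    by (auto simp: topspace_dual)
  fix U assume U: "openin \<Theta> U"
  show "openin (prod_topology \<Theta> \<Theta>)
      {z \<in> topspace (prod_topology \<Theta> \<Theta>). (case z of (\<xi>, \<psi>) \<Rightarrow> inv\<^bsub>\<Gamma>\<^esub> \<xi> \<otimes>\<^bsub>\<Gamma>\<^esub> \<psi>) \<in> U}"
    (is "openin _ ?S")
    unfolding openin_prod_topology_alt
  proof (intro allI impI)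
    fix \<xi> \<psi> assume "(\<xi>, \<psi>) \<in> ?S"
    then have c: "\<xi> \<in> carrier \<Gamma>" "\<psi> \<in> carrier \<Gamma>" and in_U: "inv\<^bsub>\<Gamma>\<^esub> \<xi> \<otimes>\<^bsub>\<Gamma>\<^esub> \<psi> \<in> U"
      by (auto simp: topspace_dual)
    obtain K \<epsilon> where K: "compactin T K" "0 < \<epsilon>"
      "\<forall>\<eta>\<in>carrier \<Gamma>. (\<forall>x\<in>K. cmod (\<eta> x - (inv\<^bsub>\<Gamma>\<^esub> \<xi> \<otimes>\<^bsub>\<Gamma>\<^esub> \<psi>) x) < \<epsilon>) \<longrightarrow> \<eta> \<in> U"
      using dual_open_uniform_neighbourhood[OF U in_U] by meson
    have KG: "K \<subseteq> carrier G" using compactin_subset_topspace[OF K(1)] topspace_eq by simp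
    have e2: "0 < \<epsilon> / 2" using K(2) by simp
    obtain A where A: "openin \<Theta> A" "\<xi> \<in> A" "\<forall>\<xi>'\<in>A. \<forall>x\<in>K. cmod (\<xi>' x - \<xi> x) < \<epsilon> / 2"
      using uniform_neighbourhood_open[OF K(1) c(1) e2] by metis
    obtain B where B: "openin \<Theta> B" "\<psi> \<in> B" "\<forall>\<psi>'\<in>B. \<forall>x\<in>K. cmod (\<psi>' x - \<psi> x) < \<epsilon> / 2"
      using uniform_neighbourhood_open[OF K(1) c(2) e2] by metis
    have "A \<times> B \<subseteq> ?S"
    proof
      fix z assume z: "z \<in> A \<times> B"
      obtain \<xi>' \<psi>' where z': "z = (\<xi>', \<psi>')" "\<xi>' \<in> A" "\<psi>' \<in> B" using z by auto
      have c': "\<xi>' \<in> carrier \<Gamma>" "\<psi>' \<in> carrier \<Gamma>"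
        using z'(2,3) openin_subset[OF A(1)] openin_subset[OF B(1)] unfolding topspace_dual by blast+
      have "cmod ((inv\<^bsub>\<Gamma>\<^esub> \<xi>' \<otimes>\<^bsub>\<Gamma>\<^esub> \<psi>') x - (inv\<^bsub>\<Gamma>\<^esub> \<xi> \<otimes>\<^bsub>\<Gamma>\<^esub> \<psi>) x) < \<epsilon>" if x: "x \<in> K" for x
      proof -
        have xG: "x \<in> carrier G" using x KG by blast
        have "(inv\<^bsub>\<Gamma>\<^esub> \<xi>' \<otimes>\<^bsub>\<Gamma>\<^esub> \<psi>') x - (inv\<^bsub>\<Gamma>\<^esub> \<xi> \<otimes>\<^bsub>\<Gamma>\<^esub> \<psi>) x
            = cnj (\<xi>' x) * (\<psi>' x - \<psi> x) + cnj (\<xi>' x - \<xi> x) * \<psi> x"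
          using xG c c' by (simp add: dual_mult dual_inv algebra_simps)
        also have "cmod \<dots> \<le> cmod (cnj (\<xi>' x) * (\<psi>' x - \<psi> x)) + cmod (cnj (\<xi>' x - \<xi> x) * \<psi> x)"
          by (rule norm_triangle_ineq)
        also have "\<dots> = cmod (\<psi>' x - \<psi> x) + cmod (\<xi>' x - \<xi> x)"
          unfolding norm_mult complex_mod_cnj using characterD(1)[OF c'(1) xG] characterD(1)[OF c(2) xG] by simp
        also have "\<dots> < \<epsilon>"
          using bspec[OF bspec[OF A(3) z'(2)] x] bspec[OF bspec[OF B(3) z'(3)] x] by simp
        finally show ?thesis .
      qed
      then have "inv\<^bsub>\<Gamma>\<^esub> \<xi>' \<otimes>\<^bsub>\<Gamma>\<^esub> \<psi>' \<in> U" using K(3) c' by simp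
      then show "z \<in> ?S" using c' by (simp add: z'(1) topspace_dual)
    qed
    then show "\<exists>A B. openin \<Theta> A \<and> openin \<Theta> B \<and> \<xi> \<in> A \<and> \<psi> \<in> B \<and> A \<times> B \<subseteq> ?S"
      using A B by blast
  qed
qed

end

text \<open>
  \<open>|z\<^sup>2 - 1| = |z - 1| |z + 1|\<close>, and the hypotheses force \<open>Re z \<ge> 1/2\<close>, hence \<open>|z + 1| \<ge> 3/2\<close>.
\<close>

lemma unimodular_square_expands:
  assumes "cmod z = 1" "cmod (z - 1) \<le> 1"
  shows "cmod (z - 1) \<le> 2 / 3 * cmod (z * z - 1)"
proof -
  have "(cmod (z - 1))\<^sup>2 = (cmod z)\<^sup>2 + 1 - 2 * Re z"
    by (simp add: cmod_power2) (simp add: power2_eq_square algebra_simps)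
  moreover have "(cmod (z - 1))\<^sup>2 \<le> 1" using assms(2) by (simp add: power_le_one)
  ultimately have "1 / 2 \<le> Re z" using assms(1) by simp
  then have "3 / 2 \<le> cmod (z + 1)" using complex_Re_le_cmod[of "z + 1"] by simp
  then have "3 / 2 * cmod (z - 1) \<le> cmod (z + 1) * cmod (z - 1)" by (rule mult_right_mono) simp
  also have "\<dots> = cmod (z * z - 1)" unfolding norm_mult[symmetric] by (simp add: algebra_simps)
  finally show ?thesis by simp
qed

context lca
begin

lemma right_translation_continuous:
  assumes "y \<in> carrier G"
  shows "continuous_map T T (\<lambda>x. x \<otimes> y)"
proof -
  have "continuous_map T (prod_topology T T) (\<lambda>x. (x, y))"
    using assms by (intro continuous_map_pairedI) (auto simp: topspace_eq)
  from continuous_map_compose[OF this mult_cont] show ?thesis by (simp add: o_def)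
qed

text \<open>Homomorphisms into the circle that are close to 1 on a neighbourhood of the identity.  The
  constant 1 is small enough for the values at \<open>x\<close>, \<open>x\<^sup>2\<close>, \<open>x\<^sup>4\<close>, ... to control each other, which makes
  continuity automatic and uniform.\<close>

definition almost_trivial :: "'g set \<Rightarrow> ('g \<Rightarrow> complex) set" where
  "almost_trivial N = {\<xi> \<in> PiE (carrier G) (\<lambda>_. sphere 0 1).
     (\<forall>x\<in>carrier G. \<forall>y\<in>carrier G. \<xi> (x \<otimes> y) = \<xi> x * \<xi> y) \<and> (\<forall>x\<in>N. cmod (\<xi> x - 1) \<le> 1)}"

lemma almost_trivialD:
  assumes "\<xi> \<in> almost_trivial N"
  shows "x \<in> carrier G \<Longrightarrow> cmod (\<xi> x) = 1"
    and "x \<in> carrier G \<Longrightarrow> y \<in> carrier G \<Longrightarrow> \<xi> (x \<otimes> y) = \<xi> x * \<xi> y"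
    and "x \<in> N \<Longrightarrow> cmod (\<xi> x - 1) \<le> 1" and "\<xi> \<in> extensional (carrier G)"
  using assms by (auto simp: almost_trivial_def PiE_def Pi_def)

text \<open>
  Let \<open>M\<close> be the neighbourhood for \<open>n\<close>.  If \<open>x\<close> and \<open>x \<otimes> x\<close> lie in \<open>M\<close>, the value at \<open>x \<otimes> x\<close> is within
  \<open>(2/3)\<^sup>n\<close> of 1, and taking the square root gains another factor \<open>2/3\<close>.
\<close>

lemma almost_trivial_small:
  assumes N: "openin T N" "\<one> \<in> N"
  shows "\<exists>M. openin T M \<and> \<one> \<in> M \<and> (\<forall>\<xi>\<in>almost_trivial N. \<forall>x\<in>M. cmod (\<xi> x - 1) \<le> (2/3) ^ n)"
proof (induction n)
  case 0
  show ?case using N almost_trivialD(3) by (intro exI[of _ N]) simp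
next
  case (Suc n)
  then obtain M where M: "openin T M" "\<one> \<in> M"
    "\<forall>\<xi>\<in>almost_trivial N. \<forall>x\<in>M. cmod (\<xi> x - 1) \<le> (2/3) ^ n" by blast
  have "openin (prod_topology T T) {z \<in> topspace (prod_topology T T). (case z of (x, y) \<Rightarrow> x \<otimes> y) \<in> M}"
    (is "openin _ ?S") using mult_cont M(1) unfolding continuous_map_def by blast
  moreover have "(\<one>, \<one>) \<in> ?S" using M(2) by (simp add: topspace_eq)
  ultimately obtain A B where AB: "openin T A" "openin T B" "\<one> \<in> A" "\<one> \<in> B" "A \<times> B \<subseteq> ?S"
    unfolding openin_prod_topology_alt by meson
  have "cmod (\<xi> x - 1) \<le> (2/3) ^ Suc n" if xi: "\<xi> \<in> almost_trivial N" and x: "x \<in> A \<inter> B" for \<xi> x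
  proof -
    have xG: "x \<in> carrier G" using x openin_subset[OF AB(1)] topspace_eq by blast
    have "(x, x) \<in> ?S" "(x, \<one>) \<in> ?S" using AB(4,5) x by blast+
    then have "x \<otimes> x \<in> M" "x \<in> M" using xG by auto
    then have "cmod (\<xi> (x \<otimes> x) - 1) \<le> (2/3) ^ n" "cmod (\<xi> x - 1) \<le> (2/3) ^ n" using M(3) xi by auto
    moreover have "(2/3::real) ^ n \<le> 1" by (simp add: power_le_one)
    ultimately show ?thesis
      using unimodular_square_expands[of "\<xi> x"] almost_trivialD(1,2)[OF xi] xG by simp
  qed
  then show ?case using AB by (intro exI[of _ "A \<inter> B"]) auto
qed

lemma almost_trivial_equicontinuous:
  assumes N: "openin T N" "\<one> \<in> N" and y: "y \<in> carrier G" and e: "0 < \<epsilon>"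
  shows "\<exists>M. openin T M \<and> y \<in> M \<and> (\<forall>\<xi>\<in>almost_trivial N. \<forall>x\<in>M. cmod (\<xi> x - \<xi> y) < \<epsilon>)"
proof -
  obtain n where n: "(2/3::real) ^ n < \<epsilon>" using real_arch_pow_inv[OF e, of "2/3"] by auto
  obtain M where M: "openin T M" "\<one> \<in> M"
    "\<forall>\<xi>\<in>almost_trivial N. \<forall>x\<in>M. cmod (\<xi> x - 1) \<le> (2/3) ^ n" using almost_trivial_small[OF N] by blast
  define M' where "M' = {x \<in> topspace T. x \<otimes> inv y \<in> M}"
  have "openin T M'" using right_translation_continuous[of "inv y"] M(1) y
    unfolding continuous_map_def M'_def by simp
  moreover have "y \<in> M'" using y M(2) by (simp add: M'_def topspace_eq)
  moreover have "cmod (\<xi> x - \<xi> y) < \<epsilon>" if xi: "\<xi> \<in> almost_trivial N" and x: "x \<in> M'" for \<xi> x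
  proof -
    have xG: "x \<in> carrier G" "x \<otimes> inv y \<in> M" using x by (auto simp: M'_def topspace_eq)
    have "\<xi> x = \<xi> (x \<otimes> inv y) * \<xi> y"
      using almost_trivialD(2)[OF xi, of "x \<otimes> inv y" y] xG y by (simp add: m_assoc)
    then have "\<xi> x - \<xi> y = (\<xi> (x \<otimes> inv y) - 1) * \<xi> y" by (simp add: algebra_simps)
    then have "cmod (\<xi> x - \<xi> y) = cmod (\<xi> (x \<otimes> inv y) - 1)"
      using almost_trivialD(1)[OF xi y] by (simp add: norm_mult)
    also have "\<dots> \<le> (2/3) ^ n" using M(3) xi xG(2) by blast
    finally show ?thesis using n by simp
  qed
  ultimately show ?thesis by blast
qed

lemma almost_trivial_continuous:
  assumes N: "openin T N" "\<one> \<in> N" and xi: "\<xi> \<in> almost_trivial N"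
  shows "continuous_map T euclidean \<xi>"
  unfolding continuous_map_def
proof (intro conjI allI impI)
  fix U :: "complex set" assume "openin euclidean U"
  then have U: "open U" by simp
  show "openin T {x \<in> topspace T. \<xi> x \<in> U}"
  proof (subst openin_subopen, intro ballI)
    fix y assume "y \<in> {x \<in> topspace T. \<xi> x \<in> U}"
    then have y: "y \<in> carrier G" "\<xi> y \<in> U" by (auto simp: topspace_eq)
    obtain \<epsilon> where e: "0 < \<epsilon>" "ball (\<xi> y) \<epsilon> \<subseteq> U" using U y(2) open_contains_ball by blast
    obtain M where M: "openin T M" "y \<in> M" "\<forall>\<xi>\<in>almost_trivial N. \<forall>x\<in>M. cmod (\<xi> x - \<xi> y) < \<epsilon>"
      using almost_trivial_equicontinuous[OF N y(1) e(1)] by blast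
    have "M \<subseteq> {x \<in> topspace T. \<xi> x \<in> U}"
    proof
      fix x assume x: "x \<in> M"
      then have "\<xi> x \<in> ball (\<xi> y) \<epsilon>" using M(3) xi by (simp add: dist_norm norm_minus_commute)
      then show "x \<in> {x \<in> topspace T. \<xi> x \<in> U}" using e(2) x openin_subset[OF M(1)] by blast
    qed
    then show "\<exists>M. openin T M \<and> y \<in> M \<and> M \<subseteq> {x \<in> topspace T. \<xi> x \<in> U}" using M by blast
  qed
qed simp

lemma almost_trivial_eq:
  assumes N: "openin T N" "\<one> \<in> N"
  shows "almost_trivial N = {\<xi> \<in> carrier \<Gamma>. \<forall>x\<in>N. cmod (\<xi> x - 1) \<le> 1}"
proof (intro equalityI subsetI)
  fix \<xi> assume xi: "\<xi> \<in> almost_trivial N"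
  then show "\<xi> \<in> {\<xi> \<in> carrier \<Gamma>. \<forall>x\<in>N. cmod (\<xi> x - 1) \<le> 1}"
    using almost_trivialD[OF xi] almost_trivial_continuous[OF N xi] by (simp add: character_iff)
next
  fix \<xi> assume "\<xi> \<in> {\<xi> \<in> carrier \<Gamma>. \<forall>x\<in>N. cmod (\<xi> x - 1) \<le> 1}"
  then show "\<xi> \<in> almost_trivial N" by (simp add: character_iff almost_trivial_def PiE_def Pi_def)
qed

abbreviation pointwise :: "('g \<Rightarrow> complex) topology" where
  "pointwise \<equiv> product_topology (\<lambda>_. top_of_set (sphere 0 1)) (carrier G)"

lemma evaluation_continuous:
  assumes "x \<in> carrier G"
  shows "continuous_map pointwise euclidean (\<lambda>\<xi>. \<xi> x)"
  using continuous_map_product_projection[OF assms, of "\<lambda>_. top_of_set (sphere (0::complex) 1)"]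
  by (simp add: continuous_map_in_subtopology)

text \<open>
  A closed subset of a product of circles.  Continuity of the homomorphisms is not part of the definition
  of \<open>almost_trivial\<close>, which is what makes the set closed for pointwise convergence.
\<close>

lemma almost_trivial_pointwise_compact:
  assumes "N \<subseteq> carrier G"
  shows "compactin pointwise (almost_trivial N)"
proof (rule closedin_compact_space)
  show "compact_space pointwise"
    by (simp add: compact_space_product_topology compact_space_subtopology)
  have tp: "topspace pointwise = PiE (carrier G) (\<lambda>_. sphere 0 1)" by simp
  define \<C> where "\<C> = insert (topspace pointwise)
    ((\<lambda>(x, y). {\<xi> \<in> topspace pointwise. \<xi> (x \<otimes> y) = \<xi> x * \<xi> y}) ` (carrier G \<times> carrier G) \<union>
     (\<lambda>x. {\<xi> \<in> topspace pointwise. \<xi> x \<in> cball 1 1}) ` N)"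
  have "closedin pointwise (\<Inter>\<C>)"
  proof (rule closedin_Inter)
    fix S assume "S \<in> \<C>"
    then consider "S = topspace pointwise"
      | x y where "x \<in> carrier G" "y \<in> carrier G" "S = {\<xi> \<in> topspace pointwise. \<xi> (x \<otimes> y) = \<xi> x * \<xi> y}"
      | x where "x \<in> N" "S = {\<xi> \<in> topspace pointwise. \<xi> x \<in> cball 1 1}"
      unfolding \<C>_def by blast
    then show "closedin pointwise S"
    proof cases
      case 1
      then show ?thesis by (simp only: closedin_topspace)
    next
      case 2
      show ?thesis unfolding 2(3)
        by (rule closedin_continuous_maps_eq[of euclidean])
          (use 2(1,2) in \<open>auto intro: evaluation_continuous continuous_map_complex_mult\<close>)
    next
      case 3
      then have "x \<in> carrier G" using assms by blast
      then show ?thesis unfolding 3(2)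
        by (intro closedin_continuous_map_preimage[OF evaluation_continuous]) simp_all
    qed
  qed (simp add: \<C>_def)
  moreover have "\<Inter>\<C> = almost_trivial N"
  proof (intro equalityI subsetI)
    fix \<xi> assume xi: "\<xi> \<in> \<Inter>\<C>"
    then have 1: "\<xi> \<in> topspace pointwise" by (simp add: \<C>_def)
    have 2: "\<xi> (x \<otimes> y) = \<xi> x * \<xi> y" if "x \<in> carrier G" "y \<in> carrier G" for x y
    proof -
      have "{\<xi> \<in> topspace pointwise. \<xi> (x \<otimes> y) = \<xi> x * \<xi> y} \<in> \<C>" unfolding \<C>_def using that by blast
      then show ?thesis using xi by blast
    qed
    have 3: "\<xi> x \<in> cball 1 1" if "x \<in> N" for x
    proof -
      have "{\<xi> \<in> topspace pointwise. \<xi> x \<in> cball 1 1} \<in> \<C>" unfolding \<C>_def using that by blast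
      then show ?thesis using xi by blast
    qed
    show "\<xi> \<in> almost_trivial N"
      using 1[unfolded tp] 2 3 unfolding almost_trivial_def by (simp add: dist_norm norm_minus_commute)
  next
    fix \<xi> assume xi: "\<xi> \<in> almost_trivial N"
    then have 1: "\<xi> \<in> topspace pointwise" unfolding tp almost_trivial_def by blast
    show "\<xi> \<in> \<Inter>\<C>"
    proof
      fix S assume "S \<in> \<C>"
      then show "\<xi> \<in> S"
        using 1 almost_trivialD(2,3)[OF xi] unfolding \<C>_def
        by (auto simp: dist_norm norm_minus_commute simp del: topspace_product_topology)
    qed
  qed
  ultimately show "closedin pointwise (almost_trivial N)" by simp
qed

text \<open>By equicontinuity pointwise convergence is uniform on compact sets.\<close>

lemma almost_trivial_compact:
  assumes N: "openin T N" "\<one> \<in> N"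
  shows "compactin \<Theta> (almost_trivial N)"
proof -
  let ?X = "subtopology pointwise (almost_trivial N)"
  have NG: "N \<subseteq> carrier G" using openin_subset[OF N(1)] topspace_eq by simp
  have sub: "almost_trivial N \<subseteq> topspace pointwise" by (auto simp: almost_trivial_def)
  then have tX: "topspace ?X = almost_trivial N" by (simp only: topspace_subtopology) blast
  have "continuous_map ?X \<Theta> id" unfolding continuous_map_def
  proof (intro conjI allI impI)
    show "id \<in> topspace ?X \<rightarrow> topspace \<Theta>" unfolding tX topspace_dual almost_trivial_eq[OF N] by auto
    fix U assume U: "openin \<Theta> U"
    show "openin ?X {\<xi> \<in> topspace ?X. id \<xi> \<in> U}" unfolding tX
    proof (subst openin_subopen, intro ballI)
      fix \<xi> assume "\<xi> \<in> {\<xi> \<in> almost_trivial N. id \<xi> \<in> U}"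
      then have xi: "\<xi> \<in> almost_trivial N" "\<xi> \<in> U" by auto
      obtain K \<epsilon> where K: "compactin T K" "0 < \<epsilon>"
        "\<forall>\<psi>\<in>carrier \<Gamma>. (\<forall>x\<in>K. cmod (\<psi> x - \<xi> x) < \<epsilon>) \<longrightarrow> \<psi> \<in> U"
        using dual_open_uniform_neighbourhood[OF U xi(2)] by meson
      have KG: "K \<subseteq> carrier G" using compactin_subset_topspace[OF K(1)] topspace_eq by simp
      have e3: "0 < \<epsilon> / 3" using K(2) by simp
      have "\<forall>y\<in>K. \<exists>M. openin T M \<and> y \<in> M \<and> (\<forall>\<xi>\<in>almost_trivial N. \<forall>x\<in>M. cmod (\<xi> x - \<xi> y) < \<epsilon> / 3)"
        using almost_trivial_equicontinuous[OF N _ e3] KG by blast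
      then obtain M where M: "\<And>y. y \<in> K \<Longrightarrow> openin T (M y) \<and> y \<in> M y \<and>
          (\<forall>\<xi>\<in>almost_trivial N. \<forall>x\<in>M y. cmod (\<xi> x - \<xi> y) < \<epsilon> / 3)" by metis
      have "(\<forall>U\<in>M ` K. openin T U) \<and> K \<subseteq> \<Union>(M ` K)" using M by blast
      then obtain \<U> where "finite \<U>" "\<U> \<subseteq> M ` K" "K \<subseteq> \<Union>\<U>"
        using K(1) unfolding compactin_def by meson
      then obtain Y where Y: "finite Y" "Y \<subseteq> K" "K \<subseteq> \<Union>(M ` Y)" by (metis finite_subset_image)
      define O' where "O' = almost_trivial N \<inter> \<Inter>((\<lambda>y. {\<psi> \<in> topspace pointwise. \<psi> y \<in> ball (\<xi> y) (\<epsilon> / 3)}) ` Y)"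
      have open_y: "openin pointwise {\<psi> \<in> topspace pointwise. \<psi> y \<in> ball (\<xi> y) (\<epsilon> / 3)}" if "y \<in> Y" for y
      proof -
        have "y \<in> carrier G" using that Y(2) KG by blast
        then show ?thesis by (intro openin_continuous_map_preimage[OF evaluation_continuous]) simp_all
      qed
      have "openin pointwise (topspace pointwise \<inter> \<Inter>((\<lambda>y. {\<psi> \<in> topspace pointwise. \<psi> y \<in> ball (\<xi> y) (\<epsilon> / 3)}) ` Y))"
        by (rule openin_Int_Inter[OF finite_imageI[OF Y(1)] openin_topspace]) (elim imageE, use open_y in blast)
      moreover have "O' = (topspace pointwise \<inter> \<Inter>((\<lambda>y. {\<psi> \<in> topspace pointwise. \<psi> y \<in> ball (\<xi> y) (\<epsilon> / 3)}) ` Y)) \<inter> almost_trivial N"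
        using sub unfolding O'_def by blast
      ultimately have "openin ?X O'" unfolding openin_subtopology by blast
      moreover have "\<xi> \<in> O'"
      proof -
        have "\<xi> y \<in> ball (\<xi> y) (\<epsilon> / 3)" for y using e3 by simp
        then show ?thesis using xi(1) sub unfolding O'_def by blast
      qed
      moreover have "O' \<subseteq> {\<xi> \<in> almost_trivial N. id \<xi> \<in> U}"
      proof
        fix \<psi> assume psi: "\<psi> \<in> O'"
        then have pN: "\<psi> \<in> almost_trivial N" by (simp add: O'_def)
        have "cmod (\<psi> x - \<xi> x) < \<epsilon>" if x: "x \<in> K" for x
        proof -
          obtain y where y: "y \<in> Y" "x \<in> M y" using Y(3) x by blast
          have yK: "y \<in> K" using y Y by blast
          have "\<psi> y \<in> ball (\<xi> y) (\<epsilon> / 3)" using psi y(1) unfolding O'_def by blast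
          then have 1: "cmod (\<psi> y - \<xi> y) < \<epsilon> / 3" by (simp add: dist_norm norm_minus_commute)
          have 2: "cmod (\<psi> x - \<psi> y) < \<epsilon> / 3" "cmod (\<xi> x - \<xi> y) < \<epsilon> / 3"
            using M[OF yK] pN xi(1) y(2) by blast+
          have eq: "\<psi> x - \<xi> x = (\<psi> x - \<psi> y) + (\<psi> y - \<xi> y) - (\<xi> x - \<xi> y)" by simp
          have "cmod (\<psi> x - \<xi> x) \<le> cmod ((\<psi> x - \<psi> y) + (\<psi> y - \<xi> y)) + cmod (\<xi> x - \<xi> y)"
            unfolding eq by (rule norm_triangle_ineq4)
          also have "\<dots> \<le> cmod (\<psi> x - \<psi> y) + cmod (\<psi> y - \<xi> y) + cmod (\<xi> x - \<xi> y)"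
            by (rule add_right_mono[OF norm_triangle_ineq])
          also have "\<dots> < \<epsilon>" using 1 2 by simp
          finally show ?thesis .
        qed
        moreover have "\<psi> \<in> carrier \<Gamma>" using pN almost_trivial_eq[OF N] by blast
        ultimately show "\<psi> \<in> {\<xi> \<in> almost_trivial N. id \<xi> \<in> U}" using K(3) pN by simp
      qed
      ultimately show "\<exists>O'. openin ?X O' \<and> \<xi> \<in> O' \<and> O' \<subseteq> {\<xi> \<in> almost_trivial N. id \<xi> \<in> U}" by blast
    qed
  qed
  moreover have "compactin ?X (almost_trivial N)"
    using almost_trivial_pointwise_compact[OF NG] by (simp add: compactin_subtopology)
  ultimately have "compactin \<Theta> (id ` almost_trivial N)" by (rule image_compactin[rotated])
  then show ?thesis by simp
qed

text \<open>
  A character is continuous at the identity, hence within distance 1 of the value 1 on some member of a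
  countable base.
\<close>

lemma dual_sigma_compact:
  obtains \<K> where "countable \<K>" "\<And>K. K \<in> \<K> \<Longrightarrow> compactin \<Theta> K" "carrier \<Gamma> \<subseteq> \<Union>\<K>"
proof -
  obtain \<B> where B: "countable \<B>" "\<And>V. V \<in> \<B> \<Longrightarrow> openin T V"
    "\<And>U x. openin T U \<Longrightarrow> x \<in> U \<Longrightarrow> \<exists>V\<in>\<B>. x \<in> V \<and> V \<subseteq> U"
    using sc unfolding second_countable_def by metis
  define \<K> where "\<K> = almost_trivial ` {N\<in>\<B>. \<one> \<in> N}"
  have "countable \<K>" using B(1) by (simp add: \<K>_def)
  moreover have "compactin \<Theta> K" if "K \<in> \<K>" for K
    using that almost_trivial_compact B(2) by (auto simp: \<K>_def)
  moreover have "carrier \<Gamma> \<subseteq> \<Union>\<K>"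
  proof
    fix \<xi> assume xi: "\<xi> \<in> carrier \<Gamma>"
    have "\<xi> \<one> * \<xi> \<one> = \<xi> \<one>" "\<xi> \<one> \<noteq> 0"
      using characterD(2)[OF xi, of \<one> \<one>] characterD(1)[OF xi, of \<one>] by auto
    then have one: "\<xi> \<one> = 1" by simp
    have "openin T {x \<in> topspace T. \<xi> x \<in> ball 1 1}"
      using characterD(4)[OF xi] by (rule openin_continuous_map_preimage) simp
    moreover have "\<one> \<in> {x \<in> topspace T. \<xi> x \<in> ball 1 1}" by (simp add: one topspace_eq)
    ultimately obtain N where N: "N \<in> \<B>" "\<one> \<in> N" "N \<subseteq> {x \<in> topspace T. \<xi> x \<in> ball 1 1}"
      using B(3) by meson
    have "cmod (\<xi> x - 1) \<le> 1" if "x \<in> N" for x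
    proof -
      have "\<xi> x \<in> ball 1 1" using N(3) that by blast
      then show ?thesis by (simp add: dist_norm norm_minus_commute)
    qed
    then have "\<xi> \<in> almost_trivial N" using almost_trivial_eq[OF B(2)[OF N(1)] N(2)] xi by simp
    then show "\<xi> \<in> \<Union>\<K>" using N by (auto simp: \<K>_def)
  qed
  ultimately show ?thesis by (rule that)
qed

subsection \<open>Measures on the two sections\<close>

lemma annihilator_closed_subgroup:
  assumes "\<Lambda> \<subseteq> carrier \<Gamma>"
  shows "subgroup (annihilator G \<Lambda>) G" "closedin T (annihilator G \<Lambda>)"
proof -
  have one: "\<xi> \<one> = 1" if "\<xi> \<in> \<Lambda>" for \<xi>
    using characterD(1,2)[OF subsetD[OF assms that], of \<one>] characterD(2)[OF subsetD[OF assms that], of \<one> \<one>]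
    by force
  have mult: "\<xi> (x \<otimes> y) = 1" if "\<xi> \<in> \<Lambda>" "x \<in> carrier G" "y \<in> carrier G" "\<xi> x = 1" "\<xi> y = 1" for \<xi> x y
    using characterD(2)[OF subsetD[OF assms that(1)] that(2,3)] that(4,5) by simp
  have inv: "\<xi> (inv x) = 1" if "\<xi> \<in> \<Lambda>" "x \<in> carrier G" "\<xi> x = 1" for \<xi> x
    using characterD(2)[OF subsetD[OF assms that(1)] that(2), of "inv x"] that(2,3) one[OF that(1)] by simp
  show "subgroup (annihilator G \<Lambda>) G"
    by (rule subgroup.intro) (auto simp: annihilator_def one mult inv)
  have "closedin T (\<Inter>(insert (topspace T) ((\<lambda>\<xi>. {x \<in> topspace T. \<xi> x \<in> {1}}) ` \<Lambda>)))"
  proof (rule closedin_Inter)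
    fix S assume "S \<in> insert (topspace T) ((\<lambda>\<xi>. {x \<in> topspace T. \<xi> x \<in> {1}}) ` \<Lambda>)"
    then consider "S = topspace T" | \<xi> where "\<xi> \<in> \<Lambda>" "S = {x \<in> topspace T. \<xi> x \<in> {1}}" by blast
    then show "closedin T S"
    proof cases
      case 2
      then have "continuous_map T euclidean \<xi>" using assms characterD(4) by blast
      then show ?thesis unfolding 2(2) by (rule closedin_continuous_map_preimage) simp
    qed simp
  qed simp
  moreover have "\<Inter>(insert (topspace T) ((\<lambda>\<xi>. {x \<in> topspace T. \<xi> x \<in> {1}}) ` \<Lambda>)) = annihilator G \<Lambda>"
    by (auto simp: annihilator_def topspace_eq)
  ultimately show "closedin T (annihilator G \<Lambda>)" by simp
qed

lemma section_sigma_finite: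
  assumes "\<Lambda> \<subseteq> carrier \<Gamma>" "borel_section G T (annihilator G \<Lambda>) P"
    "section_measure G T (annihilator G \<Lambda>) P m"
  shows "sigma_finite_measure m"
proof -
  obtain \<K> where K: "countable \<K>" "\<And>K. K \<in> \<K> \<Longrightarrow> compactin T K" "topspace T \<subseteq> \<Union>\<K>"
    using second_countable_sigma_compact[OF sc loc_compact] by metis
  have "continuous_map (prod_topology T T) (prod_topology T T) (\<lambda>z. (inv (fst z), snd z))"
    by (intro continuous_map_pairedI continuous_map_snd
        continuous_map_compose[OF continuous_map_fst inv_cont, unfolded o_def])
  from continuous_map_compose[OF this mult_cont]
  have cont: "continuous_map (prod_topology T T) T (\<lambda>(x, y). inv x \<otimes> y)"
    by (simp add: o_def case_prod_unfold)
  show ?thesis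
    using K(3) topspace_eq
    by (intro section_measure_sigma_finite[OF comm_group_axioms annihilator_closed_subgroup(1)[OF assms(1)]
          topspace_eq cont annihilator_closed_subgroup(2)[OF assms(1)] K(1,2) _ assms(2,3)]) simp_all
qed

lemma dual_section_L2_separable:
  assumes "subgroup \<Lambda> \<Gamma>" "closedin \<Theta> \<Lambda>" "borel_section \<Gamma> \<Theta> \<Lambda> D" "section_measure \<Gamma> \<Theta> \<Lambda> D m"
  shows "\<exists>d. separable_hilbert (L2 m) d"
proof -
  obtain \<K> where K: "countable \<K>" "\<And>K. K \<in> \<K> \<Longrightarrow> compactin \<Theta> K" "carrier \<Gamma> \<subseteq> \<Union>\<K>"
    using dual_sigma_compact by metis
  have sf: "sigma_finite_measure m"
    by (rule section_measure_sigma_finite[OF dual_comm_group assms(1) topspace_dual dual_quotient_continuous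
          assms(2) K assms(3,4)])
  obtain \<G> where "countable \<G>" "\<G> \<subseteq> Pow (space m)" "sets m = sigma_sets (space m) \<G>"
    using section_measure_countably_generated[OF dual_second_countable assms(3,4)] .
  then show ?thesis using L2_separable_hilbert[OF sf] by metis
qed

end

section \<open>Bounded operators and the forms they define\<close>

lemma hcarrier_subspace_of [simp]: "hcarrier (subspace_of V H) = V"
  and hinner_subspace_of [simp]: "hinner (subspace_of V H) = hinner H"
  by (simp_all add: subspace_of_def)

lemma hnorm_subspace_of [simp]: "hnorm (subspace_of V H) = hnorm H"
  by (simp add: hnorm_def fun_eq_iff)

lemma heq_subspace_of [simp]: "heq (subspace_of V H) = heq H"
  by (simp add: heq_def fun_eq_iff)

locale bounded_operator = dom: pre_hilbert H + cod: pre_hilbert K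
  for H :: "'v::complex_vec hspace" and K :: "'w::complex_vec hspace" and T :: "'v \<Rightarrow> 'w" +
  assumes bounded: "bounded_op H K T"
begin

lemma in_cod [simp]: "a \<in> hcarrier H \<Longrightarrow> T a \<in> hcarrier K"
  using bounded by (simp add: bounded_op_def linear_op_def)

lemma heq_add: "a \<in> hcarrier H \<Longrightarrow> b \<in> hcarrier H \<Longrightarrow> heq K (T (a + b)) (T a + T b)"
  using bounded by (simp add: bounded_op_def linear_op_def)

lemma heq_scale: "a \<in> hcarrier H \<Longrightarrow> heq K (T (cscale k a)) (cscale k (T a))"
  using bounded by (simp add: bounded_op_def linear_op_def)

lemma norm_bound: "\<exists>C\<ge>0. \<forall>a\<in>hcarrier H. hnorm K (T a) \<le> C * hnorm H a"
proof -
  obtain C where C: "\<forall>a\<in>hcarrier H. hnorm K (T a) \<le> C * hnorm H a"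
    using bounded by (auto simp: bounded_op_def)
  have "hnorm K (T a) \<le> \<bar>C\<bar> * hnorm H a" if a: "a \<in> hcarrier H" for a
    using bspec[OF C a] mult_right_mono[OF abs_ge_self[of C] dom.hnorm_nonneg[OF a]] by simp
  then show ?thesis by (intro exI[of _ "\<bar>C\<bar>"]) simp
qed

lemma inner_add:
  "\<lbrakk>a \<in> hcarrier H; b \<in> hcarrier H; w \<in> hcarrier K\<rbrakk> \<Longrightarrow> hinner K (T (a + b)) w = hinner K (T a) w + hinner K (T b) w"
  using cod.heq_inner_left[OF heq_add, of a b w] cod.inner_add_left[of "T a" "T b" w] by simp

lemma inner_scale:
  "\<lbrakk>a \<in> hcarrier H; w \<in> hcarrier K\<rbrakk> \<Longrightarrow> hinner K (T (cscale k a)) w = k * hinner K (T a) w"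
  using cod.heq_inner_left[OF heq_scale, of a k w] cod.inner_scale_left[of "T a" w k] by simp

lemma norm_diff_le:
  assumes C: "\<forall>a\<in>hcarrier H. hnorm K (T a) \<le> C * hnorm H a"
    and ab: "a \<in> hcarrier H" "b \<in> hcarrier H"
  shows "hnorm K (T a - T b) \<le> C * hnorm H (a - b)"
proof -
  have m: "a - b \<in> hcarrier H" using ab by simp
  have "heq K (T ((a - b) + b)) (T (a - b) + T b)" using heq_add[OF m ab(2)] .
  then have "hnorm K (T a - (T (a - b) + T b)) = 0" by (simp add: heq_def)
  moreover have "(T (a - b) + T b) - T b = T (a - b)" by simp
  ultimately have "hnorm K (T a - T b) \<le> hnorm K (T (a - b))"
    using cod.hnorm_triangle_diff[of "T a" "T (a - b) + T b" "T b"] ab m by simp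
  then show ?thesis using bspec[OF C m] by simp
qed

lemma heq_cong: "\<lbrakk>heq H a b; a \<in> hcarrier H; b \<in> hcarrier H\<rbrakk> \<Longrightarrow> heq K (T a) (T b)"
proof -
  assume ab: "heq H a b" "a \<in> hcarrier H" "b \<in> hcarrier H"
  obtain C where C: "\<forall>a\<in>hcarrier H. hnorm K (T a) \<le> C * hnorm H a" using norm_bound by blast
  have "hnorm K (T a - T b) \<le> 0" using norm_diff_le[OF C ab(2,3)] ab(1) by (simp add: heq_def)
  moreover have "0 \<le> hnorm K (T a - T b)" using ab by simp
  ultimately show "heq K (T a) (T b)" by (simp add: heq_def)
qed

lemma tendsto:
  assumes "\<And>n. s n \<in> hcarrier H" "l \<in> hcarrier H" "(\<lambda>n. hnorm H (s n - l)) \<longlonglongrightarrow> 0"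
  shows "(\<lambda>n. hnorm K (T (s n) - T l)) \<longlonglongrightarrow> 0"
proof -
  obtain C where C: "\<forall>a\<in>hcarrier H. hnorm K (T a) \<le> C * hnorm H a" using norm_bound by blast
  show ?thesis
  proof (rule Lim_null_comparison)
    show "(\<lambda>n. C * hnorm H (s n - l)) \<longlonglongrightarrow> 0" using tendsto_mult_right_zero[OF assms(3)] .
    have "norm (hnorm K (T (s n) - T l)) \<le> C * hnorm H (s n - l)" for n
      using norm_diff_le[OF C assms(1,2)] assms(1,2) by simp
    then show "\<forall>\<^sub>F n in sequentially. norm (hnorm K (T (s n) - T l)) \<le> C * hnorm H (s n - l)" by simp
  qed
qed

lemma gram_form:
  "pre_hilbert \<lparr>hcarrier = hcarrier H, hinner = \<lambda>a b. hinner K (T a) (T b)\<rparr>"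
proof (rule pre_hilbert.intro; (unfold hspace.simps)?)
  show "linear_subset (hcarrier H)" by (rule dom.lin)
  show "hinner K (T (a + b)) (T c) = hinner K (T a) (T c) + hinner K (T b) (T c)"
    if "a \<in> hcarrier H" "b \<in> hcarrier H" "c \<in> hcarrier H" for a b c
    using that by (simp add: inner_add)
  show "hinner K (T (cscale k a)) (T c) = k * hinner K (T a) (T c)"
    if "a \<in> hcarrier H" "c \<in> hcarrier H" for a c k
    using that by (simp add: inner_scale)
  show "hinner K (T b) (T a) = cnj (hinner K (T a) (T b))" if "a \<in> hcarrier H" "b \<in> hcarrier H" for a b
    using that by (intro cod.inner_cnj in_cod)
  show "0 \<le> Re (hinner K (T a) (T a))" if "a \<in> hcarrier H" for a
    using that by (intro cod.inner_nonneg in_cod)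
qed

lemma gram_form_bounded: "\<exists>C. \<forall>a\<in>hcarrier H. Re (hinner K (T a) (T a)) \<le> C * (hnorm H a)\<^sup>2"
proof -
  obtain C where C: "0 \<le> C" "\<forall>a\<in>hcarrier H. hnorm K (T a) \<le> C * hnorm H a" using norm_bound by blast
  have "Re (hinner K (T a) (T a)) \<le> C\<^sup>2 * (hnorm H a)\<^sup>2" if a: "a \<in> hcarrier H" for a
    using power_mono[OF bspec[OF C(2) a] cod.hnorm_nonneg[OF in_cod[OF a]], of 2] a
    by (simp add: cod.hnorm_sq power_mult_distrib)
  then show ?thesis by blast
qed

end

text \<open>Over the complex numbers positivity of the quadratic form forces symmetry, by polarization.\<close>

lemma positive_form:
  assumes H: "pre_hilbert H" and T: "positive_op H T"
  shows "pre_hilbert \<lparr>hcarrier = hcarrier H, hinner = \<lambda>a b. hinner H (T a) b\<rparr>"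
proof -
  interpret pre_hilbert H by (rule H)
  interpret bounded_operator H H T by unfold_locales (use T in \<open>simp add: positive_op_def\<close>)
  have pos: "hinner H (T a) a \<in> \<real>\<^sub>\<ge>\<^sub>0" if "a \<in> hcarrier H" for a using T that by (simp add: positive_op_def)
  have real: "Im (hinner H (T a) a) = 0" "0 \<le> Re (hinner H (T a) a)" if "a \<in> hcarrier H" for a
    using pos[OF that] by (simp_all add: complex_nonneg_Reals_iff)
  show ?thesis
  proof (rule pre_hilbert.intro; (unfold hspace.simps)?)
    show "linear_subset (hcarrier H)" by (rule lin)
    show "hinner H (T (a + b)) c = hinner H (T a) c + hinner H (T b) c"
      if "a \<in> hcarrier H" "b \<in> hcarrier H" "c \<in> hcarrier H" for a b c
      using that by (rule inner_add)
    show "hinner H (T (cscale k a)) c = k * hinner H (T a) c"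
      if "a \<in> hcarrier H" "c \<in> hcarrier H" for a c k
      using that by (rule inner_scale)
    show "0 \<le> Re (hinner H (T a) a)" if "a \<in> hcarrier H" for a by (rule real(2)[OF that])
    fix a b assume ab: "a \<in> hcarrier H" "b \<in> hcarrier H"
    have sum_real: "Im (hinner H (T a) c) + Im (hinner H (T c) a) = 0" if c: "c \<in> hcarrier H" for c
      using real(1)[of "a + c"] real(1)[OF ab(1)] real(1)[OF c] ab c
      by (simp add: inner_add inner_add_right)
    have 1: "Im (hinner H (T a) b) + Im (hinner H (T b) a) = 0" by (rule sum_real[OF ab(2)])
    have 2: "Im (hinner H (T a) (cscale \<i> b)) + Im (hinner H (T (cscale \<i> b)) a) = 0"
      by (rule sum_real) (use ab in simp)
    have "Re (hinner H (T b) a) = Re (hinner H (T a) b)"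
      using 2 ab by (simp add: inner_scale inner_scale_right)
    then show "hinner H (T b) a = cnj (hinner H (T a) b)" using 1 by (simp add: complex_eq_iff)
  qed
qed

lemma positive_form_bounded:
  assumes H: "pre_hilbert H" and T: "bounded_op H H T"
  shows "\<exists>C. \<forall>a\<in>hcarrier H. Re (hinner H (T a) a) \<le> C * (hnorm H a)\<^sup>2"
proof -
  interpret pre_hilbert H by (rule H)
  interpret bounded_operator H H T by unfold_locales (rule T)
  obtain C where C: "0 \<le> C" "\<forall>a\<in>hcarrier H. hnorm H (T a) \<le> C * hnorm H a" using norm_bound by blast
  have "Re (hinner H (T a) a) \<le> C * (hnorm H a)\<^sup>2" if a: "a \<in> hcarrier H" for a
  proof -
    have "Re (hinner H (T a) a) \<le> hnorm H (T a) * hnorm H a"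
      using complex_Re_le_cmod[of "hinner H (T a) a"] Cauchy_Schwarz[OF in_cod[OF a] a] by simp
    also have "\<dots> \<le> C * hnorm H a * hnorm H a"
      using bspec[OF C(2) a] hnorm_nonneg[OF a] by (rule mult_right_mono)
    finally show ?thesis by (simp add: power2_eq_square mult.assoc)
  qed
  then show ?thesis by blast
qed

text \<open>
  Polarization; additivity up to null vectors suffices because null vectors do not affect norms.
\<close>

lemma isometric_iso_inner:
  assumes H: "pre_hilbert H" and K: "pre_hilbert K" and T: "isometric_iso H K T"
    and ab: "a \<in> hcarrier H" "b \<in> hcarrier H"
  shows "hinner K (T a) (T b) = hinner H a b"
proof -
  interpret H: pre_hilbert H by (rule H)
  interpret K: pre_hilbert K by (rule K)
  have iso: "hnorm K (T c) = hnorm H c" if "c \<in> hcarrier H" for c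
    using T that by (simp add: isometric_iso_def)
  interpret bounded_operator H K T
    by unfold_locales (use T in \<open>auto simp: isometric_iso_def bounded_op_def intro!: exI[of _ 1]\<close>)
  have re: "Re (hinner K (T a) (T c)) = Re (hinner H a c)" if c: "c \<in> hcarrier H" for c
  proof -
    have "hnorm K (T a + T c) = hnorm H (a + c)"
      using K.heq_hnorm[OF heq_add[OF ab(1) c]] iso[of "a + c"] ab c by simp
    then show ?thesis
      using K.hnorm_add_sq[of "T a" "T c"] H.hnorm_add_sq[of a c] ab c iso by simp
  qed
  have "hinner K (T a) (T (cscale \<i> b)) = - \<i> * hinner K (T a) (T b)"
    using K.heq_inner_right[OF heq_scale[OF ab(2)], of \<i> "T a"] ab by (simp add: K.inner_scale_right)
  then have "Im (hinner K (T a) (T b)) = Im (hinner H a b)"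
    using re[of "cscale \<i> b"] ab by (simp add: H.inner_scale_right)
  with re[OF ab(2)] show ?thesis by (simp add: complex_eq_iff)
qed

lemma isometric_iso_comp:
  assumes H: "pre_hilbert H" and K: "pre_hilbert K" and L: "pre_hilbert L"
    and S: "isometric_iso H K S" and T: "isometric_iso K L T"
  shows "isometric_iso H L (T \<circ> S)"
proof -
  interpret H: pre_hilbert H by (rule H)
  interpret K: pre_hilbert K by (rule K)
  interpret L: pre_hilbert L by (rule L)
  interpret S: bounded_operator H K S
    by unfold_locales (use S in \<open>auto simp: isometric_iso_def bounded_op_def intro!: exI[of _ 1]\<close>)
  interpret T: bounded_operator K L T
    by unfold_locales (use T in \<open>auto simp: isometric_iso_def bounded_op_def intro!: exI[of _ 1]\<close>)
  have iso: "hnorm L (T (S a)) = hnorm H a" if "a \<in> hcarrier H" for a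
    using S T that by (simp add: isometric_iso_def linear_op_def)
  have add: "heq L (T (S (a + b))) (T (S a) + T (S b))" if ab: "a \<in> hcarrier H" "b \<in> hcarrier H" for a b
    by (rule L.heq_trans[OF T.heq_cong[OF S.heq_add[OF ab]] T.heq_add]) (use ab in simp_all)
  have scale: "heq L (T (S (cscale k a))) (cscale k (T (S a)))" if a: "a \<in> hcarrier H" for a k
    by (rule L.heq_trans[OF T.heq_cong[OF S.heq_scale[OF a]] T.heq_scale]) (use a in simp_all)
  have onto: "\<exists>a\<in>hcarrier H. heq L (T (S a)) c" if c: "c \<in> hcarrier L" for c
  proof -
    obtain b where b: "b \<in> hcarrier K" "heq L (T b) c" using T c by (auto simp: isometric_iso_def)
    obtain a where a: "a \<in> hcarrier H" "heq K (S a) b" using S b by (auto simp: isometric_iso_def)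
    have "heq L (T (S a)) c"
      by (rule L.heq_trans[OF T.heq_cong[OF a(2)] b(2)]) (use a b c in simp_all)
    then show ?thesis using a(1) by blast
  qed
  show ?thesis unfolding isometric_iso_def linear_op_def using add scale onto iso by simp
qed

section \<open>Operators that act fibrewise\<close>

text \<open>
  The situation of the theorem without the groups: \<open>L\<close> is \<open>L\<^sup>2(G)\<close>, \<open>H\<close> is \<open>L\<^sup>2(D)\<close>, \<open>m\<close> is the measure of
  \<open>\<Pi>\<close>, and \<open>Zt\<close> is the composition of the Fourier and the Zak transform.
\<close>

locale decomposed_operator =
  fixes L :: "'v::complex_vec hspace" and m :: "'a measure" and H :: "'w::complex_vec hspace" and d :: "nat \<Rightarrow> 'w"
    and Zt :: "'v \<Rightarrow> 'a \<Rightarrow> 'w" and W :: "'v set" and J :: "'a \<Rightarrow> 'w set"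
    and U :: "'v \<Rightarrow> 'v" and R :: "'a \<Rightarrow> 'w set \<times> ('w \<Rightarrow> 'w)"
  assumes L: "hilbert L" and H: "separable_hilbert H d" and m: "sigma_finite_measure m"
    and Zt: "isometric_iso L (L2_vec m H) Zt" and W: "closed_subspace L W"
    and J: "range_function_of L m H Zt W J"
    and U: "bounded_op (subspace_of W L) (subspace_of W L) U"
    and R: "range_operator_of m H Zt W J U R"
begin

sublocale H: separable_hilbert H d by (rule H)
sublocale L: hilbert L by (rule L)
sublocale K: pre_hilbert "L2_vec m H" by (rule H.L2_vec_pre_hilbert)
sublocale W: hilbert "subspace_of W L" by (rule L.closed_subspace_hilbert[OF W])
sublocale U: bounded_operator "subspace_of W L" "subspace_of W L" U
  by unfold_locales (rule U)

lemma W_sub: "W \<subseteq> hcarrier L"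
  using W by (simp add: closed_subspace_def)

lemma Zt_in: "f \<in> hcarrier L \<Longrightarrow> Zt f \<in> hcarrier (L2_vec m H)"
  using Zt by (simp add: isometric_iso_def linear_op_def)

lemma Zt_inner: "f \<in> hcarrier L \<Longrightarrow> g \<in> hcarrier L \<Longrightarrow> hinner (L2_vec m H) (Zt f) (Zt g) = hinner L f g"
  by (rule isometric_iso_inner[OF L.pre_hilbert_axioms K.pre_hilbert_axioms Zt])

lemma Zt_integral: "f \<in> hcarrier L \<Longrightarrow> g \<in> hcarrier L \<Longrightarrow> (LINT x|m. hinner H (Zt f x) (Zt g x)) = hinner L f g"
  using Zt_inner by (simp add: L2_vec_def)

lemma W_iff: "f \<in> W \<longleftrightarrow> f \<in> hcarrier L \<and> (AE x in m. Zt f x \<in> J x)"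
proof -
  have "W = {f \<in> hcarrier L. AE x in m. Zt f x \<in> J x}" using J by (simp add: range_function_of_def)
  then show ?thesis by blast
qed

lemma J_closed: "x \<in> space m \<Longrightarrow> closed_subspace H (J x)"
  using J by (simp add: range_function_of_def measurable_range_function_def)

lemma J_sub: "x \<in> space m \<Longrightarrow> J x \<subseteq> hcarrier H"
  using J_closed by (simp add: closed_subspace_def)

definition P :: "'a \<Rightarrow> 'w \<Rightarrow> 'w" where
  "P x c = orth_proj H (J x) c"

lemma P_in: "x \<in> space m \<Longrightarrow> c \<in> hcarrier H \<Longrightarrow> P x c \<in> J x"
  unfolding P_def by (rule H.orth_proj(1)[OF J_closed])

lemma P_in_H: "x \<in> space m \<Longrightarrow> c \<in> hcarrier H \<Longrightarrow> P x c \<in> hcarrier H"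
  using P_in J_sub by blast

lemma P_orth: "x \<in> space m \<Longrightarrow> c \<in> hcarrier H \<Longrightarrow> v \<in> J x \<Longrightarrow> hinner H (P x c) v = hinner H c v"
  using H.orth_proj(2)[OF J_closed, of x c v] H.inner_diff_left[of c "P x c" v] P_in_H[of x c] J_sub[of x]
  unfolding P_def by auto

text \<open>
  Since \<open>P x c - v\<close> lies in \<open>J x\<close>, it is orthogonal to \<open>c - P x c\<close>.
\<close>

lemma P_contracts:
  assumes x: "x \<in> space m" and c: "c \<in> hcarrier H" and v: "v \<in> J x"
  shows "hnorm H (P x c - v) \<le> hnorm H (c - v)"
proof -
  have vH: "v \<in> hcarrier H" and p: "P x c \<in> hcarrier H" "P x c \<in> J x" using J_sub[OF x] v P_in[OF x c] by auto
  have "P x c - v \<in> J x"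
    by (rule linear_subset_diff[OF H.closed_subspace_linear[OF J_closed[OF x]] p(2) v])
  then have "hinner H (c - P x c) (P x c - v) = 0"
    using P_orth[OF x c] H.inner_diff_left[of c "P x c" "P x c - v"] c p vH by simp
  moreover have "(c - P x c) + (P x c - v) = c - v" by simp
  ultimately have "(hnorm H (c - v))\<^sup>2 = (hnorm H (c - P x c))\<^sup>2 + (hnorm H (P x c - v))\<^sup>2"
    using H.hnorm_add_sq[of "c - P x c" "P x c - v"] c p vH by simp
  then have "(hnorm H (P x c - v))\<^sup>2 \<le> (hnorm H (c - v))\<^sup>2" by simp
  then show ?thesis by (rule power2_le_imp_le) (simp add: c vH)
qed

lemma P_measurable:
  assumes c: "c \<in> hcarrier H"
  shows "(\<lambda>x. P x c) \<in> measurable m (hborel H)"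
proof (rule H.measurable_hborelI)
  show "P x c \<in> hcarrier H" if "x \<in> space m" for x using that c by (rule P_in_H)
  show "(\<lambda>x. hinner H (P x c) (d n)) \<in> borel_measurable m" for n
    using J c unfolding P_def by (simp add: range_function_of_def measurable_range_function_def)
qed

text \<open>The multiples \<open>k(x) P\<^sub>J(x) c\<close> of a projected constant are the fibres of members of \<open>W\<close>.\<close>

lemma section_exists:
  fixes k :: "'a \<Rightarrow> real"
  assumes c: "c \<in> hcarrier H" and k: "k \<in> borel_measurable m" "integrable m (\<lambda>x. (k x)\<^sup>2)"
  shows "\<exists>a\<in>W. AE x in m. heq H (Zt a x) (cscale (complex_of_real (k x)) (P x c))"
proof -
  define s where "s x = cscale (complex_of_real (k x)) (P x c)" for x
  have sm: "s \<in> measurable m (hborel H)"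
    unfolding s_def by (rule H.measurable_hborel_scale[OF _ P_measurable[OF c]]) (use k in measurable)
  have "integrable m (\<lambda>x. (hnorm H (s x))\<^sup>2)"
  proof (rule Bochner_Integration.integrable_bound)
    show "integrable m (\<lambda>x. (k x)\<^sup>2 * (hnorm H c)\<^sup>2)" using k(2) by simp
    show "(\<lambda>x. (hnorm H (s x))\<^sup>2) \<in> borel_measurable m"
      by (rule borel_measurable_power[OF H.measurable_hnorm[OF sm]])
    show "AE x in m. norm ((hnorm H (s x))\<^sup>2) \<le> norm ((k x)\<^sup>2 * (hnorm H c)\<^sup>2)"
    proof (rule AE_I2)
      fix x assume x: "x \<in> space m"
      have "0 \<in> J x" using H.closed_subspace_linear[OF J_closed[OF x]] by (simp add: linear_subset_def)
      then have "hnorm H (P x c) \<le> hnorm H c" using P_contracts[OF x c, of 0] by simp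
      then have "(hnorm H (P x c))\<^sup>2 \<le> (hnorm H c)\<^sup>2" by (rule power_mono) (simp add: P_in_H x c)
      then have "(k x)\<^sup>2 * (hnorm H (P x c))\<^sup>2 \<le> (k x)\<^sup>2 * (hnorm H c)\<^sup>2" by (rule mult_left_mono) simp
      then show "norm ((hnorm H (s x))\<^sup>2) \<le> norm ((k x)\<^sup>2 * (hnorm H c)\<^sup>2)"
        by (simp add: s_def P_in_H x c power_mult_distrib)
    qed
  qed
  then have sK: "s \<in> hcarrier (L2_vec m H)" using sm by (simp add: H.L2_vec_carrier)
  then obtain a where a: "a \<in> hcarrier L" "heq (L2_vec m H) (Zt a) s"
    using Zt by (auto simp: isometric_iso_def)
  have eq: "AE x in m. heq H (Zt a x) (s x)" by (rule H.L2_vec_heq_AE[OF Zt_in[OF a(1)] sK a(2)])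
  with AE_space have "AE x in m. Zt a x \<in> J x"
  proof eventually_elim
    case (elim x)
    have pJ: "s x \<in> J x"
      unfolding s_def using H.closed_subspace_linear[OF J_closed[OF elim(1)]] P_in[OF elim(1) c]
      by (simp add: linear_subset_def)
    have ZH: "Zt a x \<in> hcarrier H" by (rule H.L2_vec_in[OF Zt_in[OF a(1)] elim(1)])
    have sH: "s x \<in> hcarrier H" using pJ J_sub[OF elim(1)] by blast
    show ?case by (rule H.closed_subspace_heq[OF J_closed[OF elim(1)] pJ ZH H.heq_sym[OF elim(2) ZH sH]])
  qed
  then have "a \<in> W" using a(1) W_iff by simp
  then show ?thesis using eq unfolding s_def by blast
qed

lemma fibre_bounded: "AE x in m. bounded_op (subspace_of (J x) H) H (snd (R x))"
proof -
  have 1: "\<And>x. x \<in> space m \<Longrightarrow> bounded_op (subspace_of (fst (R x)) H) H (snd (R x))"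
    and 2: "AE x in m. fst (R x) = J x"
    using R by (simp_all add: range_operator_of_def measurable_range_operator_def)
  from AE_space 2 show ?thesis
    by eventually_elim (metis 1)
qed

lemma fibre_operator:
  assumes "x \<in> space m" "bounded_op (subspace_of (J x) H) H (snd (R x))"
  shows "bounded_operator (subspace_of (J x) H) H (snd (R x))"
  using H.closed_subspace_hilbert[OF J_closed[OF assms(1)]] H.pre_hilbert_axioms assms(2)
  by (intro bounded_operator.intro bounded_operator_axioms.intro) (simp_all add: hilbert_def)

text \<open>
  The defining relation of the range operator determines the fibres of \<open>U a\<close> up to null vectors; boundedness
  of \<open>R(x)\<close> on \<open>J(x)\<close> lets the scalar \<open>k(x)\<close> be pulled out.
\<close>

lemma section_fibre:
  fixes k :: "'a \<Rightarrow> real"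
  assumes c: "c \<in> hcarrier H" and a: "a \<in> W"
    and eq: "AE x in m. heq H (Zt a x) (cscale (complex_of_real (k x)) (P x c))"
  shows "AE x in m. Zt (U a) x \<in> J x \<and>
    heq H (Zt (U a) x) (cscale (complex_of_real (k x)) (snd (R x) (P x c)))"
proof -
  have Ua: "U a \<in> W" using U.in_cod[of a] a by simp
  have aL: "a \<in> hcarrier L" "U a \<in> hcarrier L" using a Ua W_sub by auto
  have ZUa: "AE x in m. Zt (U a) x \<in> J x" and Za: "AE x in m. Zt a x \<in> J x" using a Ua W_iff by auto
  have Ra: "AE x in m. heq H (Zt (U a) x) (snd (R x) (Zt a x))"
    using R a by (simp add: range_operator_of_def)
  from AE_space fibre_bounded ZUa Za Ra eq show ?thesis
  proof eventually_elim
    case (elim x)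
    interpret T: bounded_operator "subspace_of (J x) H" H "snd (R x)"
      by (rule fibre_operator[OF elim(1,2)])
    have p: "P x c \<in> J x" by (rule P_in[OF elim(1) c])
    have kp: "cscale (complex_of_real (k x)) (P x c) \<in> J x"
      using H.closed_subspace_linear[OF J_closed[OF elim(1)]] p by (simp add: linear_subset_def)
    have 1: "heq H (snd (R x) (Zt a x)) (snd (R x) (cscale (complex_of_real (k x)) (P x c)))"
      using T.heq_cong elim(4,6) kp by simp
    have 2: "heq H (snd (R x) (cscale (complex_of_real (k x)) (P x c))) (cscale (complex_of_real (k x)) (snd (R x) (P x c)))"
      using T.heq_scale p by simp
    have in_H: "Zt (U a) x \<in> hcarrier H" "snd (R x) (Zt a x) \<in> hcarrier H"
      "snd (R x) (cscale (complex_of_real (k x)) (P x c)) \<in> hcarrier H"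
      "cscale (complex_of_real (k x)) (snd (R x) (P x c)) \<in> hcarrier H"
      using elim(3,4) J_sub[OF elim(1)] T.in_cod p kp by auto
    have "heq H (Zt (U a) x) (cscale (complex_of_real (k x)) (snd (R x) (P x c)))"
      by (rule H.heq_trans[OF elim(5) H.heq_trans[OF 1 2 in_H(2-4)] in_H(1,2,4)])
    then show ?case using elim(3) by blast
  qed
qed

lemma weight_exists:
  obtains h :: "'a \<Rightarrow> real" where "h \<in> borel_measurable m" "integrable m (\<lambda>x. (h x)\<^sup>2)"
    "\<forall>x\<in>space m. 0 < h x"
proof -
  obtain g where g: "g \<in> borel_measurable m" "integral\<^sup>N m g \<noteq> \<infinity>" "\<forall>x\<in>space m. 0 < g x \<and> g x < \<infinity>"
    using sigma_finite_measure.Ex_finite_integrable_function[OF m] by blast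
  define h where "h x = sqrt (enn2real (g x))" for x
  have hm: "h \<in> borel_measurable m" unfolding h_def using g(1) by measurable
  have hsq: "(h x)\<^sup>2 = enn2real (g x)" for x by (simp add: h_def)
  have "(\<integral>\<^sup>+x. ennreal (norm ((h x)\<^sup>2)) \<partial>m) = integral\<^sup>N m g"
  proof (rule nn_integral_cong)
    fix x assume "x \<in> space m"
    then have "g x < \<infinity>" using g(3) by blast
    then show "ennreal (norm ((h x)\<^sup>2)) = g x" by (simp add: hsq)
  qed
  then have "integrable m (\<lambda>x. (h x)\<^sup>2)"
    using g(2) hm by (simp add: integrable_iff_bounded less_top[symmetric])
  moreover have "\<forall>x\<in>space m. 0 < h x"
    using g(3) by (simp add: h_def enn2real_positive_iff)
  ultimately show ?thesis using hm that by blast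
qed

subsection \<open>Properties of almost every fibre\<close>

definition countable_dense :: "'w set \<Rightarrow> bool" where
  "countable_dense C \<longleftrightarrow> countable C \<and> C \<subseteq> hcarrier H \<and> (\<forall>a\<in>hcarrier H. \<forall>\<epsilon>>0. \<exists>c\<in>C. hnorm H (a - c) < \<epsilon>)"

lemma countable_dense_exists: "\<exists>C. countable_dense C"
proof -
  obtain C where C: "countable C \<and> C \<subseteq> hcarrier H \<and> range d \<subseteq> C \<and>
      (\<forall>a\<in>hcarrier H. \<forall>\<epsilon>>0. \<exists>c\<in>C. hnorm H (a - c) < \<epsilon>)" using H.countable_denseuence ..
  show ?thesis by (rule exI[of _ C]) (use C in \<open>simp add: countable_dense_def\<close>)
qed

text \<open>
  Since the projection fixes \<open>a\<close> and contracts distances, it maps approximations of \<open>a\<close> to approximations.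
\<close>

lemma projected_dense:
  assumes C: "countable_dense C" and x: "x \<in> space m" and a: "a \<in> J x"
  shows "\<exists>c. (\<forall>n. c n \<in> C) \<and> (\<lambda>n. hnorm H (P x (c n) - a)) \<longlonglongrightarrow> 0"
proof -
  have aH: "a \<in> hcarrier H" using a J_sub[OF x] by blast
  have "\<exists>c\<in>C. hnorm H (a - c) < 1 / (real n + 1)" for n
    using C aH unfolding countable_dense_def by simp
  then obtain c where c: "\<And>n. c n \<in> C" "\<And>n. hnorm H (a - c n) < 1 / (real n + 1)" by metis
  have cH: "c n \<in> hcarrier H" for n using c(1)[of n] C by (auto simp: countable_dense_def)
  have "(\<lambda>n. hnorm H (P x (c n) - a)) \<longlonglongrightarrow> 0"
  proof (rule Lim_null_comparison)
    have "norm (hnorm H (P x (c n) - a)) \<le> 1 / (real n + 1)" for n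
    proof -
      have "0 \<le> hnorm H (P x (c n) - a)" by (rule H.hnorm_nonneg[OF H.diff_in[OF P_in_H[OF x cH] aH]])
      then show ?thesis
        using P_contracts[OF x cH a, of n] c(2)[of n] H.hnorm_minus_commute[OF aH cH, of n] by simp
    qed
    then show "\<forall>\<^sub>F n in sequentially. norm (hnorm H (P x (c n) - a)) \<le> 1 / (real n + 1)" by simp
    show "(\<lambda>n. 1 / (real n + 1)) \<longlonglongrightarrow> 0"
      using LIMSEQ_inverse_real_of_nat by (simp add: inverse_eq_divide add.commute)
  qed
  then show ?thesis using c(1) by blast
qed

text \<open>
  \<open>U\<close> maps \<open>W\<close> to itself, so the fibres of \<open>U a\<close> lie in \<open>J(x)\<close>; dividing by \<open>h(x) > 0\<close> gives the claim on the
  vectors \<open>P x c\<close> with \<open>c\<close> in a countable dense set, and closedness of \<open>J(x)\<close> gives the rest.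
\<close>

lemma fibre_invariant: "AE x in m. \<forall>a\<in>J x. snd (R x) a \<in> J x"
proof -
  obtain C where C: "countable_dense C" using countable_dense_exists by blast
  obtain h :: "'a \<Rightarrow> real" where h: "h \<in> borel_measurable m" "integrable m (\<lambda>x. (h x)\<^sup>2)" "\<forall>x\<in>space m. 0 < h x"
    by (rule weight_exists)
  have "AE x in m. snd (R x) (P x c) \<in> J x" if "c \<in> C" for c
  proof -
    have c: "c \<in> hcarrier H" using that C by (auto simp: countable_dense_def)
    obtain a where a: "a \<in> W" "AE x in m. heq H (Zt a x) (cscale (complex_of_real (h x)) (P x c))"
      using section_exists[OF c h(1,2)] by blast
    from AE_space fibre_bounded section_fibre[OF c a] show ?thesis
    proof eventually_elim
      case (elim x)
      interpret T: bounded_operator "subspace_of (J x) H" H "snd (R x)"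
        by (rule fibre_operator[OF elim(1,2)])
      have RP: "snd (R x) (P x c) \<in> hcarrier H" using T.in_cod P_in[OF elim(1) c] by simp
      have "cscale (complex_of_real (h x)) (snd (R x) (P x c)) \<in> J x"
        by (rule H.closed_subspace_heq[OF J_closed[OF elim(1)], of "Zt (U a) x"]) (use elim RP in simp_all)
      then have "cscale (complex_of_real (1 / h x)) (cscale (complex_of_real (h x)) (snd (R x) (P x c))) \<in> J x"
        using H.closed_subspace_linear[OF J_closed[OF elim(1)]] unfolding linear_subset_def by blast
      moreover have "h x \<noteq> 0" using h(3) elim(1) by force
      ultimately show ?case by (simp add: cscale_cscale cscale_one)
    qed
  qed
  then have "AE x in m. \<forall>c\<in>C. snd (R x) (P x c) \<in> J x"
    using C by (intro AE_ball_countable') (auto simp: countable_dense_def)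
  with AE_space fibre_bounded show ?thesis
  proof eventually_elim
    case (elim x)
    interpret T: bounded_operator "subspace_of (J x) H" H "snd (R x)"
      by (rule fibre_operator[OF elim(1,2)])
    show ?case
    proof
      fix a assume a: "a \<in> J x"
      obtain c where c: "\<And>n. c n \<in> C" "(\<lambda>n. hnorm H (P x (c n) - a)) \<longlonglongrightarrow> 0"
        using projected_dense[OF C elim(1) a] by blast
      have cH: "c n \<in> hcarrier H" for n using c(1)[of n] C by (auto simp: countable_dense_def)
      have lim: "(\<lambda>n. hnorm H (snd (R x) (P x (c n)) - snd (R x) a)) \<longlonglongrightarrow> 0"
        using T.tendsto[of "\<lambda>n. P x (c n)" a] P_in[OF elim(1) cH] a c(2) by simp
      have RJ: "snd (R x) (P x (c n)) \<in> J x" for n using elim(3) c(1) by blast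
      have "snd (R x) a \<in> hcarrier H" using T.in_cod a by simp
      with RJ show "snd (R x) a \<in> J x" using lim by (rule H.closed_subspace_limit[OF J_closed[OF elim(1)]])
    qed
  qed
qed

lemma fibre_bounded_self: "AE x in m. bounded_op (subspace_of (J x) H) (subspace_of (J x) H) (snd (R x))"
  using fibre_bounded fibre_invariant
  by eventually_elim (simp add: bounded_op_def linear_op_def)

lemma section_form:
  fixes k :: "'a \<Rightarrow> real"
  assumes c: "c \<in> hcarrier H" and a: "a \<in> W"
    and eq: "AE x in m. heq H (Zt a x) (cscale (complex_of_real (k x)) (P x c))"
  shows "AE x in m. hinner H (Zt (U a) x) (Zt a x) = complex_of_real ((k x)\<^sup>2) * hinner H (snd (R x) (P x c)) (P x c)"
    and "AE x in m. (hnorm H (Zt (U a) x))\<^sup>2 = (k x)\<^sup>2 * (hnorm H (snd (R x) (P x c)))\<^sup>2"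
proof -
  have aL: "a \<in> hcarrier L" "U a \<in> hcarrier L" using a U.in_cod[of a] W_sub by auto
  have both: "AE x in m. hinner H (Zt (U a) x) (Zt a x) = complex_of_real ((k x)\<^sup>2) * hinner H (snd (R x) (P x c)) (P x c)
      \<and> (hnorm H (Zt (U a) x))\<^sup>2 = (k x)\<^sup>2 * (hnorm H (snd (R x) (P x c)))\<^sup>2"
    using AE_space fibre_bounded section_fibre[OF c a eq] eq
  proof eventually_elim
    case (elim x)
    interpret T: bounded_operator "subspace_of (J x) H" H "snd (R x)"
      by (rule fibre_operator[OF elim(1,2)])
    have p: "P x c \<in> hcarrier H" "snd (R x) (P x c) \<in> hcarrier H"
      using P_in_H[OF elim(1) c] T.in_cod P_in[OF elim(1) c] by auto
    have Z: "Zt a x \<in> hcarrier H" "Zt (U a) x \<in> hcarrier H"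
      using H.L2_vec_in[OF Zt_in elim(1)] aL by auto
    let ?k = "complex_of_real (k x)"
    have "hinner H (Zt (U a) x) (Zt a x) = hinner H (cscale ?k (snd (R x) (P x c))) (Zt a x)"
      by (rule H.heq_inner_left) (use elim(3) p Z in simp_all)
    also have "\<dots> = hinner H (cscale ?k (snd (R x) (P x c))) (cscale ?k (P x c))"
      by (rule H.heq_inner_right) (use elim(4) p Z in simp_all)
    also have "\<dots> = ?k\<^sup>2 * hinner H (snd (R x) (P x c)) (P x c)"
      using p by (simp add: H.inner_scale_left H.inner_scale_right power2_eq_square)
    finally have 1: "hinner H (Zt (U a) x) (Zt a x) = complex_of_real ((k x)\<^sup>2) * hinner H (snd (R x) (P x c)) (P x c)"
      by simp
    have "hnorm H (Zt (U a) x) = hnorm H (cscale ?k (snd (R x) (P x c)))"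
      by (rule H.heq_hnorm) (use elim(3) p Z in simp_all)
    then show ?case using 1 p by (simp add: power_mult_distrib)
  qed
  from both show "AE x in m. hinner H (Zt (U a) x) (Zt a x) = complex_of_real ((k x)\<^sup>2) * hinner H (snd (R x) (P x c)) (P x c)"
    by eventually_elim blast
  from both show "AE x in m. (hnorm H (Zt (U a) x))\<^sup>2 = (k x)\<^sup>2 * (hnorm H (snd (R x) (P x c)))\<^sup>2"
    by eventually_elim blast
qed

text \<open>Cutting a section down to \<open>A\<close> restricts the integral of the fibre form to \<open>A\<close>.\<close>

lemma fibre_positive_on_sections:
  assumes pos: "positive_op (subspace_of W L) U" and c: "c \<in> hcarrier H"
  shows "AE x in m. hinner H (snd (R x) (P x c)) (P x c) \<in> \<real>\<^sub>\<ge>\<^sub>0"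
proof -
  obtain h :: "'a \<Rightarrow> real" where h: "h \<in> borel_measurable m" "integrable m (\<lambda>x. (h x)\<^sup>2)" "\<forall>x\<in>space m. 0 < h x"
    by (rule weight_exists)
  obtain a where a: "a \<in> W" "AE x in m. heq H (Zt a x) (cscale (complex_of_real (h x)) (P x c))"
    using section_exists[OF c h(1,2)] by blast
  have WL: "f \<in> hcarrier L" "U f \<in> hcarrier L" if "f \<in> W" for f using that U.in_cod[of f] W_sub by auto
  define q where "q x = hinner H (Zt (U a) x) (Zt a x)" for x
  have q: "integrable m q" unfolding q_def
    by (rule H.L2_vec_integrable_hinner[OF Zt_in[OF WL(2)[OF a(1)]] Zt_in[OF WL(1)[OF a(1)]]])
  have "AE x in m. q x \<in> \<real>\<^sub>\<ge>\<^sub>0"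
  proof (rule AE_nonneg_Reals_of_set_integrals[OF q])
    fix A assume A: "A \<in> sets m"
    define k :: "'a \<Rightarrow> real" where "k x = indicator A x * h x" for x
    have k: "k \<in> borel_measurable m" unfolding k_def using A h(1) by measurable
    have "(k x)\<^sup>2 = indicator A x * (h x)\<^sup>2" for x by (simp add: k_def indicator_def)
    then have k2: "integrable m (\<lambda>x. (k x)\<^sup>2)" using integrable_mult_indicator[OF A h(2)] by simp
    obtain b where b: "b \<in> W" "AE x in m. heq H (Zt b x) (cscale (complex_of_real (k x)) (P x c))"
      using section_exists[OF c k k2] by blast
    have "(LINT x|m. indicator A x * q x) = (LINT x|m. hinner H (Zt (U b) x) (Zt b x))"
    proof (rule integral_cong_AE)
      show "(\<lambda>x. indicator A x * q x) \<in> borel_measurable m" using q A by measurable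
      show "(\<lambda>x. hinner H (Zt (U b) x) (Zt b x)) \<in> borel_measurable m"
        using H.L2_vec_integrable_hinner[OF Zt_in[OF WL(2)[OF b(1)]] Zt_in[OF WL(1)[OF b(1)]]] by simp
      from section_form(1)[OF c a] section_form(1)[OF c b]
      show "AE x in m. indicator A x * q x = hinner H (Zt (U b) x) (Zt b x)"
        by eventually_elim (simp add: q_def k_def indicator_def)
    qed
    also have "\<dots> = hinner L (U b) b" by (rule Zt_integral[OF WL(2)[OF b(1)] WL(1)[OF b(1)]])
    finally show "(LINT x|m. indicator A x * q x) \<in> \<real>\<^sub>\<ge>\<^sub>0" using pos b(1) by (simp add: positive_op_def)
  qed
  with AE_space section_form(1)[OF c a] show ?thesis
  proof eventually_elim
    case (elim x)
    have "0 < (h x)\<^sup>2" using bspec[OF h(3) elim(1)] by simp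
    then show ?case using elim(2,3) unfolding q_def
      by (simp add: complex_nonneg_Reals_iff zero_le_mult_iff del: of_real_power)
  qed
qed

text \<open>
  The quadratic form of a bounded operator is continuous, and nonnegative reals form a closed set.
\<close>

lemma fibre_positive:
  assumes pos: "positive_op (subspace_of W L) U"
  shows "AE x in m. positive_op (subspace_of (J x) H) (snd (R x))"
proof -
  obtain C where C: "countable_dense C" using countable_dense_exists by blast
  have "AE x in m. \<forall>c\<in>C. hinner H (snd (R x) (P x c)) (P x c) \<in> \<real>\<^sub>\<ge>\<^sub>0"
    using C by (intro AE_ball_countable' fibre_positive_on_sections[OF pos]) (auto simp: countable_dense_def)
  with AE_space fibre_bounded fibre_bounded_self show ?thesis
  proof eventually_elim
    case (elim x)
    interpret T: bounded_operator "subspace_of (J x) H" H "snd (R x)"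
      by (rule fibre_operator[OF elim(1,2)])
    have "hinner H (snd (R x) a) a \<in> \<real>\<^sub>\<ge>\<^sub>0" if a: "a \<in> J x" for a
    proof -
      obtain c where c: "\<And>n. c n \<in> C" "(\<lambda>n. hnorm H (P x (c n) - a)) \<longlonglongrightarrow> 0"
        using projected_dense[OF C elim(1) a] by blast
      have cH: "c n \<in> hcarrier H" for n using c(1)[of n] C by (auto simp: countable_dense_def)
      note pJ = P_in[OF elim(1) cH]
      have aH: "a \<in> hcarrier H" "snd (R x) a \<in> hcarrier H" using a J_sub[OF elim(1)] T.in_cod by auto
      have lim: "(\<lambda>n. hnorm H (snd (R x) (P x (c n)) - snd (R x) a)) \<longlonglongrightarrow> 0"
        using T.tendsto[of "\<lambda>n. P x (c n)" a] pJ a c(2) by simp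
      have RH: "snd (R x) (P x (c n)) \<in> hcarrier H" for n using T.in_cod pJ by simp
      have form: "(\<lambda>n. hinner H (snd (R x) (P x (c n))) (P x (c n))) \<longlonglongrightarrow> hinner H (snd (R x) a) a"
        by (rule H.tendsto_inner[OF RH aH(2) lim P_in_H[OF elim(1) cH] aH(1) c(2)])
      have "hinner H (snd (R x) (P x (c n))) (P x (c n)) \<in> \<real>\<^sub>\<ge>\<^sub>0" for n using elim(4) c(1) by blast
      then show ?thesis using form by (rule closed_sequentially[OF closed_nonneg_Reals_complex])
    qed
    then show ?case using elim(3) by (simp add: positive_op_def)
  qed
qed

subsection \<open>The trace of almost every fibre\<close>

text \<open>
  Since \<open>v(x) \<in> J(x)\<close>, the inner product \<open>\<langle>a\<^sub>n, v\<rangle>\<close> is \<open>\<integral> h(x) \<langle>d\<^sub>n, v(x)\<rangle> dx\<close>.  Its square is at most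
  \<open>\<parallel>h\<parallel>\<^sup>2 \<integral> |\<langle>d\<^sub>n, v(x)\<rangle>|\<^sup>2 dx\<close> by Cauchy-Schwarz, and the sum over \<open>n\<close> of the integrands is at most
  \<open>\<parallel>v(x)\<parallel>\<^sup>2\<close>.
\<close>

lemma sections_Bessel:
  fixes h :: "'a \<Rightarrow> real" and a :: "nat \<Rightarrow> 'v"
  assumes h: "h \<in> borel_measurable m" "integrable m (\<lambda>x. (h x)\<^sup>2)"
    and a: "\<And>n. a n \<in> W" "\<And>n. AE x in m. heq H (Zt (a n) x) (cscale (complex_of_real (h x)) (P x (d n)))"
    and A: "finite A" and v: "v \<in> W"
  shows "(\<Sum>n\<in>A. (cmod (hinner L (a n) v))\<^sup>2) \<le> (LINT x|m. (h x)\<^sup>2) * (hnorm L v)\<^sup>2"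
proof -
  interpret S: hilbert "L2 m" by (rule L2_hilbert)
  have vL: "v \<in> hcarrier L" and aL: "a n \<in> hcarrier L" for n using v a(1) W_sub by auto
  have ZvK: "Zt v \<in> hcarrier (L2_vec m H)" by (rule Zt_in[OF vL])
  have Zvm: "Zt v \<in> measurable m (hborel H)" and Zvi: "integrable m (\<lambda>x. (hnorm H (Zt v x))\<^sup>2)"
    using ZvK by (simp_all add: H.L2_vec_carrier)
  have ZvH: "Zt v x \<in> hcarrier H" if "x \<in> space m" for x by (rule H.L2_vec_in[OF ZvK that])
  have ZvJ: "AE x in m. Zt v x \<in> J x" using v W_iff by simp
  define g where "g n x = hinner H (Zt v x) (d n)" for n x
  have gm: "g n \<in> borel_measurable m" for n unfolding g_def using H.measurable_hinner_d[OF Zvm] .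
  have gi: "integrable m (\<lambda>x. (cmod (g n x))\<^sup>2)" for n
  proof (rule Bochner_Integration.integrable_bound)
    show "integrable m (\<lambda>x. (hnorm H (d n))\<^sup>2 * (hnorm H (Zt v x))\<^sup>2)" using Zvi by simp
    show "(\<lambda>x. (cmod (g n x))\<^sup>2) \<in> borel_measurable m" using gm by measurable
    show "AE x in m. norm ((cmod (g n x))\<^sup>2) \<le> norm ((hnorm H (d n))\<^sup>2 * (hnorm H (Zt v x))\<^sup>2)"
    proof (rule AE_I2)
      fix x assume "x \<in> space m"
      from power_mono[OF H.Cauchy_Schwarz[OF ZvH[OF this] H.d_in[of n]] norm_ge_zero, of 2]
      show "norm ((cmod (g n x))\<^sup>2) \<le> norm ((hnorm H (d n))\<^sup>2 * (hnorm H (Zt v x))\<^sup>2)"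
        by (simp add: g_def power_mult_distrib mult.commute)
    qed
  qed
  have gL: "g n \<in> hcarrier (L2 m)" for n using gm gi by (simp add: L2_carrier)
  have hL: "(\<lambda>x. complex_of_real (h x)) \<in> hcarrier (L2 m)" using h by (simp add: L2_carrier)
  have inner: "hinner L (a n) v = hinner (L2 m) (\<lambda>x. complex_of_real (h x)) (g n)" for n
  proof -
    have "hinner L (a n) v = (LINT x|m. hinner H (Zt (a n) x) (Zt v x))"
      by (rule Zt_integral[OF aL vL, symmetric])
    also have "\<dots> = (LINT x|m. complex_of_real (h x) * cnj (g n x))"
    proof (rule integral_cong_AE)
      show "(\<lambda>x. hinner H (Zt (a n) x) (Zt v x)) \<in> borel_measurable m"
        using H.L2_vec_integrable_hinner[OF Zt_in[OF aL] ZvK] by simp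
      show "(\<lambda>x. complex_of_real (h x) * cnj (g n x)) \<in> borel_measurable m"
        using scalar.L2_vec_integrable_hinner[OF hL gL[of n]] by (simp add: hinner_complex)
      from AE_space a(2)[of n] ZvJ
      show "AE x in m. hinner H (Zt (a n) x) (Zt v x) = complex_of_real (h x) * cnj (g n x)"
      proof eventually_elim
        case (elim x)
        note z = ZvH[OF elim(1)] and p = P_in_H[OF elim(1) H.d_in]
        have "hinner H (Zt (a n) x) (Zt v x) = hinner H (cscale (complex_of_real (h x)) (P x (d n))) (Zt v x)"
          by (rule H.heq_inner_left[OF elim(2) H.L2_vec_in[OF Zt_in[OF aL] elim(1)] H.scale_in[OF p] z])
        also have "\<dots> = complex_of_real (h x) * hinner H (d n) (Zt v x)"
          using P_orth[OF elim(1) H.d_in elim(3)] p z by (simp add: H.inner_scale_left)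
        also have "hinner H (d n) (Zt v x) = cnj (g n x)"
          unfolding g_def by (rule H.inner_cnj[OF z H.d_in])
        finally show ?case .
      qed
    qed
    finally show ?thesis by (simp add: L2_hinner)
  qed
  have "(\<Sum>n\<in>A. (cmod (hinner L (a n) v))\<^sup>2)
      \<le> (\<Sum>n\<in>A. (LINT x|m. (h x)\<^sup>2) * (LINT x|m. (cmod (g n x))\<^sup>2))"
  proof (rule sum_mono)
    fix n
    have "(cmod (hinner L (a n) v))\<^sup>2 \<le> (hnorm (L2 m) (\<lambda>x. complex_of_real (h x)) * hnorm (L2 m) (g n))\<^sup>2"
      unfolding inner by (rule power_mono[OF S.Cauchy_Schwarz[OF hL gL] norm_ge_zero])
    then show "(cmod (hinner L (a n) v))\<^sup>2 \<le> (LINT x|m. (h x)\<^sup>2) * (LINT x|m. (cmod (g n x))\<^sup>2)"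
      using L2_hnorm[OF hL] L2_hnorm[OF gL, of n] by (simp add: power_mult_distrib)
  qed
  also have "\<dots> = (LINT x|m. (h x)\<^sup>2) * (LINT x|m. (\<Sum>n\<in>A. (cmod (g n x))\<^sup>2))"
    using gi by (simp add: sum_distrib_left)
  also have "\<dots> \<le> (LINT x|m. (h x)\<^sup>2) * (LINT x|m. (hnorm H (Zt v x))\<^sup>2)"
  proof (rule mult_left_mono)
    show "(LINT x|m. (\<Sum>n\<in>A. (cmod (g n x))\<^sup>2)) \<le> (LINT x|m. (hnorm H (Zt v x))\<^sup>2)"
    proof (rule integral_mono)
      show "integrable m (\<lambda>x. \<Sum>n\<in>A. (cmod (g n x))\<^sup>2)" using gi by simp
      fix x assume "x \<in> space m"
      from sums_unique[OF H.parseval_sums[OF ZvH[OF this]]] sums_summable[OF H.parseval_sums[OF ZvH[OF this]]]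
      show "(\<Sum>n\<in>A. (cmod (g n x))\<^sup>2) \<le> (hnorm H (Zt v x))\<^sup>2"
        unfolding g_def using sum_le_suminf[of "\<lambda>n. (cmod (hinner H (Zt v x) (d n)))\<^sup>2" A] A by simp
    qed (rule Zvi)
  qed simp
  also have "(LINT x|m. (hnorm H (Zt v x))\<^sup>2) = (hnorm L v)\<^sup>2"
    using H.L2_vec_hnorm_sq[OF ZvK] Zt vL by (simp add: isometric_iso_def)
  finally show ?thesis .
qed

lemma AE_summable_of_integrals:
  fixes q :: "nat \<Rightarrow> 'a \<Rightarrow> real"
  assumes q: "\<And>n. integrable m (q n)" "\<And>n. AE x in m. 0 \<le> q n x"
    and le: "\<And>N. (\<Sum>n<N. LINT x|m. q n x) \<le> C"
  shows "AE x in m. summable (\<lambda>n. q n x)"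
proof -
  have [measurable]: "q n \<in> borel_measurable m" for n using q(1) by simp
  have "(\<integral>\<^sup>+x. (\<Sum>n. ennreal (q n x)) \<partial>m) = (\<Sum>n. \<integral>\<^sup>+x. ennreal (q n x) \<partial>m)"
    by (rule nn_integral_suminf) measurable
  also have "\<dots> = (\<Sum>n. ennreal (LINT x|m. q n x))"
    by (simp add: nn_integral_eq_integral[OF q(1) q(2)])
  also have "\<dots> \<le> ennreal C"
  proof (rule suminf_le_const)
    show "(\<Sum>n<N. ennreal (LINT x|m. q n x)) \<le> ennreal C" for N
      using le[of N] by (subst sum_ennreal) (auto intro: integral_nonneg_AE q(2) ennreal_leI)
  qed simp
  also have "\<dots> < \<infinity>" by simp
  finally have "AE x in m. (\<Sum>n. ennreal (q n x)) \<noteq> \<infinity>"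
    by (intro nn_integral_noteq_infinite) auto
  moreover have "AE x in m. \<forall>n. 0 \<le> q n x" by (intro iffD2[OF AE_all_countable] allI q(2))
  ultimately show ?thesis
    by eventually_elim (simp add: summable_suminf_not_top)
qed

text \<open>
  The function \<open>b n x\<close> is the value at \<open>P x (d n)\<close> of the quadratic form on the fibre at \<open>x\<close>, and \<open>q n\<close> is the
  integrand of \<open>\<beta>(a\<^sub>n, a\<^sub>n)\<close>.  The sums of the integrals of \<open>q n\<close> are bounded by the trace estimate, so
  \<open>\<Sum>\<^sub>n q n x\<close> converges for almost every \<open>x\<close>, and \<open>h(x)\<^sup>2\<close> can be cancelled.
\<close>

lemma fibre_trace_finite:
  fixes h :: "'a \<Rightarrow> real" and a :: "nat \<Rightarrow> 'v" and b :: "nat \<Rightarrow> 'a \<Rightarrow> real" and q :: "nat \<Rightarrow> 'a \<Rightarrow> real"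
  assumes h: "h \<in> borel_measurable m" "integrable m (\<lambda>x. (h x)\<^sup>2)" "\<forall>x\<in>space m. 0 < h x"
    and a: "\<And>n. a n \<in> W" "\<And>n. AE x in m. heq H (Zt (a n) x) (cscale (complex_of_real (h x)) (P x (d n)))"
    and \<beta>: "pre_hilbert \<lparr>hcarrier = W, hinner = \<beta>\<rparr>" "\<exists>C. \<forall>f\<in>W. Re (\<beta> f f) \<le> C * (hnorm L f)\<^sup>2"
    and E: "orthonormal_basis (subspace_of W L) E" "(\<lambda>e. Re (\<beta> e e)) summable_on E"
    and q: "\<And>n. integrable m (q n)" "\<And>n. (LINT x|m. q n x) = Re (\<beta> (a n) (a n))"
    and b: "\<And>n. AE x in m. q n x = (h x)\<^sup>2 * b n x" "\<And>n. AE x in m. 0 \<le> b n x"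
  shows "AE x in m. (\<lambda>n. b n x) summable_on UNIV"
proof -
  obtain C where C: "\<forall>f\<in>W. Re (\<beta> f f) \<le> C * (hnorm L f)\<^sup>2" using \<beta>(2) by blast
  define c where "c = (LINT x|m. (h x)\<^sup>2)"
  have c0: "0 \<le> c" unfolding c_def by simp
  have q0: "AE x in m. 0 \<le> q n x" for n
    using b(1)[of n] b(2)[of n] by eventually_elim simp
  have "AE x in m. summable (\<lambda>n. q n x)"
  proof (rule AE_summable_of_integrals[OF q(1) q0])
    fix N
    have "(\<Sum>n<N. Re (\<beta> (a n) (a n))) \<le> c * infsum (\<lambda>e. Re (\<beta> e e)) E"
    proof (rule W.trace_le_of_Bessel_family[where \<beta> = \<beta> and C = C and g = "\<lambda>e. e" and I = E])
      show "W.parseval_family E (\<lambda>e. e)" by (rule W.orthonormal_basis_parseval[OF E(1)])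
      show "((\<lambda>e. Re (\<beta> e e)) has_sum infsum (\<lambda>e. Re (\<beta> e e)) E) E" by (rule has_sum_infsum[OF E(2)])
      show "(\<Sum>n<N. (cmod (hinner (subspace_of W L) (a n) v))\<^sup>2) \<le> c * (hnorm (subspace_of W L) v)\<^sup>2"
        if "v \<in> hcarrier (subspace_of W L)" for v
        using sections_Bessel[OF h(1,2) a, of "{..<N}" v] that by (simp add: c_def)
    qed (use \<beta>(1) C a(1) c0 in simp_all)
    then show "(\<Sum>n<N. LINT x|m. q n x) \<le> c * infsum (\<lambda>e. Re (\<beta> e e)) E" by (simp add: q(2))
  qed
  moreover have "AE x in m. \<forall>n. q n x = (h x)\<^sup>2 * b n x" by (intro iffD2[OF AE_all_countable] allI b(1))
  moreover have "AE x in m. \<forall>n. 0 \<le> b n x" by (intro iffD2[OF AE_all_countable] allI b(2))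
  ultimately show ?thesis using AE_space
  proof eventually_elim
    case (elim x)
    have "(h x)\<^sup>2 \<noteq> 0" using h(3) elim(4) by force
    moreover have "summable (\<lambda>n. (h x)\<^sup>2 * b n x)" using elim(1,2) by simp
    ultimately have "summable (\<lambda>n. b n x)" by (simp add: summable_cmult_iff)
    then show ?case using elim(3) by (simp add: summable_on_UNIV_nonneg_real_iff)
  qed
qed

lemma fibre_parseval:
  assumes "x \<in> space m"
  shows "pre_hilbert.parseval_family (subspace_of (J x) H) UNIV (\<lambda>n. P x (d n))"
  unfolding P_def by (rule H.projected_parseval[OF H.parseval J_closed[OF assms]])

lemma weighted_sections:
  obtains h :: "'a \<Rightarrow> real" and a :: "nat \<Rightarrow> 'v"
  where "h \<in> borel_measurable m" "integrable m (\<lambda>x. (h x)\<^sup>2)" "\<forall>x\<in>space m. 0 < h x"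
    "\<forall>n. a n \<in> W \<and> (AE x in m. heq H (Zt (a n) x) (cscale (complex_of_real (h x)) (P x (d n))))"
proof -
  obtain h :: "'a \<Rightarrow> real" where h: "h \<in> borel_measurable m" "integrable m (\<lambda>x. (h x)\<^sup>2)" "\<forall>x\<in>space m. 0 < h x"
    by (rule weight_exists)
  have "\<forall>n. \<exists>a. a \<in> W \<and> (AE x in m. heq H (Zt a x) (cscale (complex_of_real (h x)) (P x (d n))))"
    using section_exists[OF H.d_in h(1,2)] by blast
  then have "\<exists>a. \<forall>n. a n \<in> W \<and> (AE x in m. heq H (Zt (a n) x) (cscale (complex_of_real (h x)) (P x (d n))))"
    by (rule choice)
  then obtain a where "\<forall>n. a n \<in> W \<and> (AE x in m. heq H (Zt (a n) x) (cscale (complex_of_real (h x)) (P x (d n))))" ..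
  with h show ?thesis by (rule that)
qed

theorem fibres_hilbert_schmidt:
  assumes HS: "hilbert_schmidt (subspace_of W L) U"
  shows "AE x in m. hilbert_schmidt (subspace_of (J x) H) (snd (R x))"
proof -
  obtain h :: "'a \<Rightarrow> real" and a :: "nat \<Rightarrow> 'v"
    where h: "h \<in> borel_measurable m" "integrable m (\<lambda>x. (h x)\<^sup>2)" "\<forall>x\<in>space m. 0 < h x"
    and a': "\<forall>n. a n \<in> W \<and> (AE x in m. heq H (Zt (a n) x) (cscale (complex_of_real (h x)) (P x (d n))))"
    by (rule weighted_sections)
  have a: "a n \<in> W" "AE x in m. heq H (Zt (a n) x) (cscale (complex_of_real (h x)) (P x (d n)))" for n
    using a' by simp_all
  obtain E where E: "orthonormal_basis (subspace_of W L) E" "(\<lambda>e. (hnorm L (U e))\<^sup>2) summable_on E"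
    using HS by (auto simp: hilbert_schmidt_def)
  have EW: "E \<subseteq> W" using E(1) by (simp add: orthonormal_basis_def)
  have UL: "U f \<in> hcarrier L" if "f \<in> W" for f using that U.in_cod[of f] W_sub by auto
  have ZUK: "Zt (U (a n)) \<in> hcarrier (L2_vec m H)" for n by (rule Zt_in[OF UL[OF a(1)]])
  have Usq: "Re (hinner L (U f) (U f)) = (hnorm L (U f))\<^sup>2" if "f \<in> W" for f
    using L.hnorm_sq[OF UL[OF that]] by simp
  have "AE x in m. (\<lambda>n. (hnorm H (snd (R x) (P x (d n))))\<^sup>2) summable_on UNIV"
  proof (rule fibre_trace_finite[OF h a])
    show "pre_hilbert \<lparr>hcarrier = W, hinner = \<lambda>f g. hinner L (U f) (U g)\<rparr>" using U.gram_form by simp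
    show "\<exists>C. \<forall>f\<in>W. Re (hinner L (U f) (U f)) \<le> C * (hnorm L f)\<^sup>2" using U.gram_form_bounded by simp
    show "(\<lambda>e. Re (hinner L (U e) (U e))) summable_on E"
      using E(2) by (rule summable_on_cong[THEN iffD1, rotated]) (use EW Usq in auto)
    show "integrable m (\<lambda>x. (hnorm H (Zt (U (a n)) x))\<^sup>2)" for n using ZUK[of n] by (simp add: H.L2_vec_carrier)
    show "(LINT x|m. (hnorm H (Zt (U (a n)) x))\<^sup>2) = Re (hinner L (U (a n)) (U (a n)))" for n
      using H.L2_vec_hnorm_sq[OF ZUK[of n]] Zt UL[OF a(1)] Usq[OF a(1)] by (simp add: isometric_iso_def)
    show "AE x in m. (hnorm H (Zt (U (a n)) x))\<^sup>2 = (h x)\<^sup>2 * (hnorm H (snd (R x) (P x (d n))))\<^sup>2" for n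
      by (rule section_form(2)[OF H.d_in a])
  qed (use E(1) in simp_all)
  with AE_space fibre_bounded fibre_bounded_self show ?thesis
  proof eventually_elim
    case (elim x)
    interpret V: hilbert "subspace_of (J x) H" by (rule H.closed_subspace_hilbert[OF J_closed[OF elim(1)]])
    interpret T: bounded_operator "subspace_of (J x) H" H "snd (R x)"
      by (rule fibre_operator[OF elim(1,2)])
    let ?\<beta> = "\<lambda>v w. hinner H (snd (R x) v) (snd (R x) w)"
    have sq: "Re (?\<beta> v v) = (hnorm H (snd (R x) v))\<^sup>2" if "v \<in> J x" for v
      using H.hnorm_sq[of "snd (R x) v"] T.in_cod[of v] that by simp
    obtain E where E: "orthonormal_basis (subspace_of (J x) H) E" using V.orthonormal_basis_exists by blast
    obtain C where C: "\<forall>v\<in>J x. Re (?\<beta> v v) \<le> C * (hnorm H v)\<^sup>2" using T.gram_form_bounded by auto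
    have "(\<lambda>e. Re (?\<beta> e e)) summable_on E"
    proof (rule V.trace_summable_orthonormal[where C = C, OF T.gram_form _ fibre_parseval[OF elim(1)]])
      show "(\<lambda>n. Re (?\<beta> (P x (d n)) (P x (d n)))) summable_on UNIV"
        using elim(4) sq[OF P_in[OF elim(1) H.d_in]] by simp
    qed (use C V.orthonormal_basis_imp_orthonormal[OF E] in simp_all)
    moreover have "E \<subseteq> J x" using E by (simp add: orthonormal_basis_def)
    ultimately have "(\<lambda>e. (hnorm H (snd (R x) e))\<^sup>2) summable_on E"
      by (subst summable_on_cong[where g = "\<lambda>e. Re (?\<beta> e e)"]) (use sq in auto)
    then show ?case using elim(3) E by (auto simp: hilbert_schmidt_def)
  qed
qed

theorem fibres_positive_finite_trace:
  assumes tr: "positive_finite_trace (subspace_of W L) U"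
  shows "AE x in m. positive_finite_trace (subspace_of (J x) H) (snd (R x))"
proof -
  obtain h :: "'a \<Rightarrow> real" and a :: "nat \<Rightarrow> 'v"
    where h: "h \<in> borel_measurable m" "integrable m (\<lambda>x. (h x)\<^sup>2)" "\<forall>x\<in>space m. 0 < h x"
    and a': "\<forall>n. a n \<in> W \<and> (AE x in m. heq H (Zt (a n) x) (cscale (complex_of_real (h x)) (P x (d n))))"
    by (rule weighted_sections)
  have a: "a n \<in> W" "AE x in m. heq H (Zt (a n) x) (cscale (complex_of_real (h x)) (P x (d n)))" for n
    using a' by simp_all
  obtain E where E: "orthonormal_basis (subspace_of W L) E" "(\<lambda>e. Re (hinner L (U e) e)) summable_on E"
    using tr by (auto simp: positive_finite_trace_def)
  have pos: "positive_op (subspace_of W L) U" using tr by (simp add: positive_finite_trace_def)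
  have aL: "a n \<in> hcarrier L" "U (a n) \<in> hcarrier L" for n using a(1) U.in_cod[of "a n"] W_sub by auto
  note fpos = fibre_positive[OF pos]
  have "AE x in m. (\<lambda>n. Re (hinner H (snd (R x) (P x (d n))) (P x (d n)))) summable_on UNIV"
  proof (rule fibre_trace_finite[OF h a])
    show "pre_hilbert \<lparr>hcarrier = W, hinner = \<lambda>f g. hinner L (U f) g\<rparr>"
      using positive_form[OF W.pre_hilbert_axioms pos] by simp
    show "\<exists>C. \<forall>f\<in>W. Re (hinner L (U f) f) \<le> C * (hnorm L f)\<^sup>2"
      using positive_form_bounded[OF W.pre_hilbert_axioms U] by simp
    have i: "integrable m (\<lambda>x. hinner H (Zt (U (a n)) x) (Zt (a n) x))" for n
      by (rule H.L2_vec_integrable_hinner[OF Zt_in[OF aL(2)] Zt_in[OF aL(1)]])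
    then show "integrable m (\<lambda>x. Re (hinner H (Zt (U (a n)) x) (Zt (a n) x)))" for n by simp
    show "(LINT x|m. Re (hinner H (Zt (U (a n)) x) (Zt (a n) x))) = Re (hinner L (U (a n)) (a n))" for n
      using integral_Re[OF i[of n]] Zt_integral[OF aL(2)[of n] aL(1)[of n]] by simp
    show "AE x in m. Re (hinner H (Zt (U (a n)) x) (Zt (a n) x))
        = (h x)\<^sup>2 * Re (hinner H (snd (R x) (P x (d n))) (P x (d n)))" for n
      using section_form(1)[OF H.d_in[of n] a(1)[of n] a(2)[of n]] by eventually_elim (simp del: of_real_power)
    show "AE x in m. 0 \<le> Re (hinner H (snd (R x) (P x (d n))) (P x (d n)))" for n
      using fibre_positive_on_sections[OF pos H.d_in[of n]]
      by eventually_elim (simp add: complex_nonneg_Reals_iff)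
  qed (rule E)+
  with AE_space fpos show ?thesis
  proof eventually_elim
    case (elim x)
    interpret V: hilbert "subspace_of (J x) H" by (rule H.closed_subspace_hilbert[OF J_closed[OF elim(1)]])
    let ?\<beta> = "\<lambda>v w. hinner H (snd (R x) v) w"
    have \<beta>: "pre_hilbert \<lparr>hcarrier = hcarrier (subspace_of (J x) H), hinner = ?\<beta>\<rparr>"
      using positive_form[OF V.pre_hilbert_axioms elim(2)] by simp
    obtain E where E: "orthonormal_basis (subspace_of (J x) H) E" using V.orthonormal_basis_exists by blast
    have "bounded_op (subspace_of (J x) H) (subspace_of (J x) H) (snd (R x))"
      using elim(2) by (simp add: positive_op_def)
    then obtain C where C: "\<forall>v\<in>J x. Re (?\<beta> v v) \<le> C * (hnorm H v)\<^sup>2"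
      using positive_form_bounded[OF V.pre_hilbert_axioms] by auto
    have "(\<lambda>e. Re (?\<beta> e e)) summable_on E"
      by (rule V.trace_summable_orthonormal[where C = C, OF \<beta> _ fibre_parseval[OF elim(1)] elim(3)])
        (use C V.orthonormal_basis_imp_orthonormal[OF E] in simp_all)
    then show ?case using elim(2) E by (auto simp: positive_finite_trace_def)
  qed
qed

end

theorem proposition2p8:
  fixes G :: "('g, 'b) monoid_scheme"
    and T :: "'g topology"
    and \<Lambda> D :: "('g \<Rightarrow> complex) set"
    and P :: "'g set"
    and \<mu> mP :: "'g measure"
    and \<nu> \<tau> mD :: "('g \<Rightarrow> complex) measure"
    and F :: "('g \<Rightarrow> complex) \<Rightarrow> ('g \<Rightarrow> complex) \<Rightarrow> complex"
    and Z :: "(('g \<Rightarrow> complex) \<Rightarrow> complex) \<Rightarrow> 'g \<Rightarrow> ('g \<Rightarrow> complex) \<Rightarrow> complex"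
    and W :: "('g \<Rightarrow> complex) set"
    and J :: "'g \<Rightarrow> (('g \<Rightarrow> complex) \<Rightarrow> complex) set"
    and U :: "('g \<Rightarrow> complex) \<Rightarrow> 'g \<Rightarrow> complex"
    and R :: "'g \<Rightarrow> (('g \<Rightarrow> complex) \<Rightarrow> complex) set \<times>
                ((('g \<Rightarrow> complex) \<Rightarrow> complex) \<Rightarrow> ('g \<Rightarrow> complex) \<Rightarrow> complex)"
  assumes G: "lca_group G T" "second_countable T"
    and \<Lambda>: "subgroup \<Lambda> (dual_group G T)" "closedin (dual_topology G T) \<Lambda>"
    and \<mu>: "haar_measure G T \<mu>"
    and \<nu>: "haar_measure (dual_group G T) (dual_topology G T) \<nu>"
    and \<tau>: "haar_measure ((dual_group G T)\<lparr>carrier := \<Lambda>\<rparr>) (subtopology (dual_topology G T) \<Lambda>) \<tau>"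
    and P: "borel_section G T (annihilator G \<Lambda>) P"
           "section_measure G T (annihilator G \<Lambda>) P mP"
    and D: "borel_section (dual_group G T) (dual_topology G T) \<Lambda> D"
           "section_measure (dual_group G T) (dual_topology G T) \<Lambda> D mD"
    and F: "fourier_transform \<mu> \<nu> F"
    and Z: "zak_transform (dual_group G T) (dual_topology G T) \<Lambda> \<nu> \<tau> mP mD Z"
    and W: "modulation_invariant \<mu> \<Lambda> W"
    and J: "range_function_of (L2 \<mu>) mP (L2 mD) (Z \<circ> F) W J"
    and U: "compact_op (subspace_of W (L2 \<mu>)) (subspace_of W (L2 \<mu>)) U"
           "modulation_preserving \<mu> \<Lambda> W U"
    and R: "range_operator_of mP (L2 mD) (Z \<circ> F) W J U R"
  shows "(hilbert_schmidt (subspace_of W (L2 \<mu>)) U \<longrightarrow>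
            (AE x in mP. hilbert_schmidt (subspace_of (J x) (L2 mD)) (snd (R x)))) \<and>
         (positive_finite_trace (subspace_of W (L2 \<mu>)) U \<longrightarrow>
            (AE x in mP. positive_finite_trace (subspace_of (J x) (L2 mD)) (snd (R x))))"
proof -
  interpret lca G T by (rule lca.intro[OF G])
  have \<Lambda>c: "\<Lambda> \<subseteq> carrier (dual_group G T)" by (rule subgroup.subset[OF \<Lambda>(1)])
  obtain d where d: "separable_hilbert (L2 mD) d" using dual_section_L2_separable[OF \<Lambda> D] by blast
  interpret H: separable_hilbert "L2 mD" d by (rule d)
  have iso: "isometric_iso (L2 \<mu>) (L2_vec mP (L2 mD)) (Z \<circ> F)"
    by (rule isometric_iso_comp[where K = "L2 \<nu>", OF scalar.L2_vec_pre_hilbert scalar.L2_vec_pre_hilbert H.L2_vec_pre_hilbert])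
      (use F Z in \<open>simp_all add: fourier_transform_def zak_transform_def\<close>)
  interpret decomposed_operator "L2 \<mu>" mP "L2 mD" d "Z \<circ> F" W J U R
  proof (rule decomposed_operator.intro[OF L2_hilbert d section_sigma_finite[OF \<Lambda>c P] iso _ J _ R])
    show "closed_subspace (L2 \<mu>) W" using W by (simp add: modulation_invariant_def)
    show "bounded_op (subspace_of W (L2 \<mu>)) (subspace_of W (L2 \<mu>)) U" using U(1) by (simp add: compact_op_def)
  qed
  show ?thesis using fibres_hilbert_schmidt fibres_positive_finite_trace by blast
qed

end
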